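(* Let $\Bbbk$ be an algebraically closed field with $\mathrm{char}(\Bbbk)=0$. Let $A=\Bbbk[x_1,x_2,x_3]$ be a quadratic polynomial Poisson algebra in three variables. If $A$ has nontrivial (i.e. not identically zero) Poisson bracket, then $A$ is strongly Poisson cancellative.
   Context: A Poisson algebra is a commutative $\Bbbk$-algebra with a $\Bbbk$-bilinear bracket $\{-,-\}$ that is a Lie bracket and a biderivation; isomorphisms preserve products and brackets. A Poisson bracket on $A=\Bbbk[x_1,\dots,x_n]$ is quadratic if each $\{x_i,x_j\}$ is a homogeneous polynomial of degree $2$ (or zero) in the standard grading. For a Poisson algebra $A$, $A[t_1,\dots,t_n]$ denotes the polynomial extension with the bracket extending that of $A$ and with all $t_i$ Poisson central. $A$ is strongly Poisson cancellative if for every $n\ge1$ and every Poisson algebra $B$, a Poisson isomorphism $A[t_1,\dots,t_n]\cong B[s_1,\dots,s_n]$ implies $A\cong B$ as Poisson algebras. *)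

theory Defs
  imports
    "HOL-Computational_Algebra.Computational_Algebra"
    "HOL-Library.Poly_Mapping"
    "HOL-Library.Numeral_Type"
begin

section \<open>Poisson algebras\<close>

text \<open>
  The underlying commutative ring is a type of class \<open>comm_ring_1\<close>; the action of the
  ground field and the bracket are parameters.
\<close>

locale poisson_algebra = vector_space scale
  for scale :: "'k::field \<Rightarrow> 'a::comm_ring_1 \<Rightarrow> 'a" +
  fixes bracket :: "'a \<Rightarrow> 'a \<Rightarrow> 'a"
  assumes scale_mult_left: "scale r (a * b) = scale r a * b"
    and bracket_linear_left: "Vector_Spaces.linear scale scale (\<lambda>a. bracket a b)"
    and bracket_linear_right: "Vector_Spaces.linear scale scale (\<lambda>b. bracket a b)"
    and bracket_self: "bracket a a = 0"
    and bracket_jacobi: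
      "bracket a (bracket b c) + bracket b (bracket c a) + bracket c (bracket a b) = 0"
    and bracket_leibniz_left: "bracket (a * b) c = a * bracket b c + bracket a c * b"
    and bracket_leibniz_right: "bracket a (b * c) = b * bracket a c + bracket a b * c"

text \<open>
  Poisson isomorphism between the Poisson algebras carried by the subsets \<open>S\<close> and \<open>T\<close>
  of the ambient rings.
\<close>

definition poisson_isomorphic ::
  "'a::comm_ring_1 set \<Rightarrow> ('k::field \<Rightarrow> 'a \<Rightarrow> 'a) \<Rightarrow> ('a \<Rightarrow> 'a \<Rightarrow> 'a) \<Rightarrow>
   'b::comm_ring_1 set \<Rightarrow> ('k \<Rightarrow> 'b \<Rightarrow> 'b) \<Rightarrow> ('b \<Rightarrow> 'b \<Rightarrow> 'b) \<Rightarrow> bool" where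
  "poisson_isomorphic S scale1 bracket1 T scale2 bracket2 \<longleftrightarrow>
    (\<exists>f. bij_betw f S T \<and> f 1 = 1 \<and>
      (\<forall>x\<in>S. \<forall>y\<in>S. f (x + y) = f x + f y) \<and>
      (\<forall>x\<in>S. \<forall>y\<in>S. f (x * y) = f x * f y) \<and>
      (\<forall>c. \<forall>x\<in>S. f (scale1 c x) = scale2 c (f x)) \<and>
      (\<forall>x\<in>S. \<forall>y\<in>S. f (bracket1 x y) = bracket2 (f x) (f y)))"


section \<open>Polynomial rings and polynomial extensions\<close>

text \<open>
  Polynomials over \<open>'a\<close> in variables indexed by \<open>'v\<close>: finitely supported functions from
  monomials (finitely supported exponent functions) to coefficients, with the convolution
  product.
\<close>

type_synonym ('v, 'a) mpoly = "('v \<Rightarrow>\<^sub>0 nat) \<Rightarrow>\<^sub>0 'a"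

definition var :: "'v \<Rightarrow> ('v, 'a::comm_ring_1) mpoly" where
  "var i = Poly_Mapping.single (Poly_Mapping.single i 1) 1"

definition total_deg :: "('v \<Rightarrow>\<^sub>0 nat) \<Rightarrow> nat" where
  "total_deg m = (\<Sum>i\<in>Poly_Mapping.keys m. Poly_Mapping.lookup m i)"

text \<open>The zero polynomial is homogeneous of every degree.\<close>

definition homogeneous :: "nat \<Rightarrow> ('v, 'a::zero) mpoly \<Rightarrow> bool" where
  "homogeneous d p \<longleftrightarrow> (\<forall>m\<in>Poly_Mapping.keys p. total_deg m = d)"

text \<open>Coefficientwise action of the ground field.\<close>

definition poly_scale ::
  "('k \<Rightarrow> 'a \<Rightarrow> 'a) \<Rightarrow> 'k \<Rightarrow> ('v, 'a::comm_ring_1) mpoly \<Rightarrow> ('v, 'a) mpoly" where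
  "poly_scale scale c p = Poly_Mapping.map (scale c) p"

text \<open>
  The extension of a bracket from the coefficients that makes all variables Poisson central,
  i.e. the biadditive extension of \<open>{a t\<^sup>m, b t\<^sup>m'} = {a, b} t\<^sup>m\<^sup>+\<^sup>m'\<close>.
\<close>

definition poly_bracket ::
  "('a \<Rightarrow> 'a \<Rightarrow> 'a) \<Rightarrow> ('v, 'a::comm_ring_1) mpoly \<Rightarrow> ('v, 'a) mpoly \<Rightarrow> ('v, 'a) mpoly" where
  "poly_bracket bracket p q =
    (\<Sum>m\<in>Poly_Mapping.keys p. \<Sum>m'\<in>Poly_Mapping.keys q.
      Poly_Mapping.single (m + m') (bracket (Poly_Mapping.lookup p m) (Poly_Mapping.lookup q m')))"

text \<open>
  The carrier of \<open>A[t\<^sub>1,\<dots>,t\<^sub>n]\<close> with \<open>A\<close> the whole type \<open>'a\<close>: polynomials in countably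
  many variables that involve only those with index below \<open>n\<close>.
\<close>

definition polys_in :: "nat \<Rightarrow> (nat, 'a::comm_ring_1) mpoly set" where
  "polys_in n = {p. \<forall>m\<in>Poly_Mapping.keys p. Poly_Mapping.keys m \<subseteq> {..<n}}"

context poisson_algebra
begin

lemma bracket_add: "bracket (a + b) c = bracket a c + bracket b c"
    "bracket a (b + c) = bracket a b + bracket a c"
  using bracket_linear_left[of c] bracket_linear_right[of a]
  by (simp_all add: Vector_Spaces.linear_def module_hom_iff)

lemma bracket_scale: "bracket (scale r a) c = scale r (bracket a c)"
    "bracket a (scale r c) = scale r (bracket a c)"
  using bracket_linear_left[of c] bracket_linear_right[of a]
  by (simp_all add: Vector_Spaces.linear_def module_hom_iff)

lemma bracket_zero [simp]: "bracket 0 a = 0" "bracket a 0 = 0"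
  using bracket_add(1)[of 0 0 a] bracket_add(2)[of a 0 0] by simp_all

lemma bracket_one [simp]: "bracket 1 a = 0" "bracket a 1 = 0"
  using bracket_leibniz_left[of 1 1 a] bracket_leibniz_right[of a 1 1] by simp_all

lemma bracket_anti: "bracket a b = - bracket b a"
proof -
  have "bracket a b + bracket b a = 0"
    using bracket_self[of "a + b"] by (simp add: bracket_add bracket_self[of a] bracket_self[of b] add.commute)
  then show ?thesis by (simp add: eq_neg_iff_add_eq_0)
qed

lemma poly_bracket_single:
  "poly_bracket bracket (Poly_Mapping.single m a) (Poly_Mapping.single m' b) =
    Poly_Mapping.single (m + m') (bracket a b)"
  by (simp add: poly_bracket_def)

lemma poly_bracket_var:
  "poly_bracket bracket (var i) p = 0" "poly_bracket bracket p (var i) = 0"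
  by (simp_all add: poly_bracket_def var_def)

lemma poly_bracket_supersets:
  fixes p q :: "('v, 'a) mpoly"
  assumes "finite S" "finite T" "Poly_Mapping.keys p \<subseteq> S" "Poly_Mapping.keys q \<subseteq> T"
  shows "poly_bracket bracket p q =
    (\<Sum>m\<in>S. \<Sum>m'\<in>T.
      Poly_Mapping.single (m + m') (bracket (Poly_Mapping.lookup p m) (Poly_Mapping.lookup q m')))"
  unfolding poly_bracket_def
  apply (subst sum.mono_neutral_left[of S "Poly_Mapping.keys p"])
  using assms apply (auto simp: in_keys_iff)
  apply (rule sum.cong, simp)
  apply (rule sum.mono_neutral_left)
  using assms apply (auto simp: in_keys_iff)
  done

lemma poly_bracket_0: "poly_bracket bracket 0 q = 0" "poly_bracket bracket q 0 = 0"
  by (simp_all add: poly_bracket_def)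

lemma poly_bracket_add1:
  fixes p q r :: "('v, 'a) mpoly"
  shows "poly_bracket bracket (p + q) r = poly_bracket bracket p r + poly_bracket bracket q r"
proof -
  let ?S = "Poly_Mapping.keys p \<union> Poly_Mapping.keys q" and ?T = "Poly_Mapping.keys r"
  have "Poly_Mapping.keys (p + q) \<subseteq> ?S" by (rule Poly_Mapping.keys_add)
  then show ?thesis
    by (simp add: poly_bracket_supersets[of ?S ?T] lookup_add bracket_add single_add sum.distrib)
qed

lemma poly_bracket_add2:
  fixes p q r :: "('v, 'a) mpoly"
  shows "poly_bracket bracket r (p + q) = poly_bracket bracket r p + poly_bracket bracket r q"
proof -
  let ?S = "Poly_Mapping.keys p \<union> Poly_Mapping.keys q" and ?T = "Poly_Mapping.keys r"
  have "Poly_Mapping.keys (p + q) \<subseteq> ?S" by (rule Poly_Mapping.keys_add)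
  then show ?thesis
    by (simp add: poly_bracket_supersets[of ?T ?S] lookup_add bracket_add single_add sum.distrib)
qed

lemma mpoly_induct [case_names zero single add]:
  fixes p :: "('v, 'a) mpoly"
  assumes "P 0" "\<And>m a. P (Poly_Mapping.single m a)" "\<And>p q. P p \<Longrightarrow> P q \<Longrightarrow> P (p + q)"
  shows "P p"
proof -
  have "P (\<Sum>m\<in>S. Poly_Mapping.single m (Poly_Mapping.lookup p m))" if "finite S" for S
    using that by induction (auto intro: assms)
  moreover have "(\<Sum>m\<in>Poly_Mapping.keys p. Poly_Mapping.single m (Poly_Mapping.lookup p m)) = p"
    by (rule poly_mapping_eqI) (auto simp: lookup_sum lookup_single when_def in_keys_iff)
  ultimately show ?thesis by (metis finite_keys)
qed

lemmas poly_bracket_additive = poly_bracket_0 poly_bracket_add1 poly_bracket_add2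

lemma poly_bracket_anti:
  fixes p q :: "('v, 'a) mpoly"
  shows "poly_bracket bracket p q = - poly_bracket bracket q p"
proof (induction p rule: mpoly_induct)
  case (single m a)
  show ?case
  proof (induction q rule: mpoly_induct)
    case (single m' b)
    show ?case
      using bracket_anti[of a b]
      by (simp add: poly_bracket_single single_uminus add.commute)
  qed (auto simp: poly_bracket_additive)
qed (auto simp: poly_bracket_additive)

lemma poly_bracket_self:
  fixes p :: "('v, 'a) mpoly"
  shows "poly_bracket bracket p p = 0"
proof (induction p rule: mpoly_induct)
  case (add p q)
  then show ?case using poly_bracket_anti[of p q] by (simp add: poly_bracket_additive)
qed (auto simp: poly_bracket_0 poly_bracket_single bracket_self)

lemma poly_bracket_leibniz_left:
  fixes p q r :: "('v, 'a) mpoly"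
  shows "poly_bracket bracket (p * q) r =
    p * poly_bracket bracket q r + poly_bracket bracket p r * q"
proof (induction p rule: mpoly_induct)
  case (single m a)
  show ?case
  proof (induction q rule: mpoly_induct)
    case (single m' b)
    show ?case
    proof (induction r rule: mpoly_induct)
      case (single m'' c)
      show ?case
        by (simp add: poly_bracket_single mult_single bracket_leibniz_left single_add ac_simps)
    qed (auto simp: poly_bracket_additive algebra_simps)
  qed (auto simp: poly_bracket_additive algebra_simps)
qed (auto simp: poly_bracket_additive algebra_simps)

lemma poly_bracket_leibniz_right:
  fixes p q r :: "('v, 'a) mpoly"
  shows "poly_bracket bracket p (q * r) =
    q * poly_bracket bracket p r + poly_bracket bracket p q * r"
  using poly_bracket_leibniz_left[of q r p] poly_bracket_anti[of p "q * r"]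
    poly_bracket_anti[of p r] poly_bracket_anti[of p q]
  by (simp add: algebra_simps)

lemma sum3_zeroI:
  fixes a :: "'c::ab_group_add"
  assumes "a + b + c = 0" "a' + b' + c' = 0"
  shows "(a + a') + (b + b') + (c + c') = 0"
proof -
  have "(a + a') + (b + b') + (c + c') = (a + b + c) + (a' + b' + c')"
    by (simp add: algebra_simps)
  with assms show ?thesis by simp
qed

lemma poly_bracket_jacobi:
  fixes p q r :: "('v, 'a) mpoly"
  shows "poly_bracket bracket p (poly_bracket bracket q r) +
    poly_bracket bracket q (poly_bracket bracket r p) +
    poly_bracket bracket r (poly_bracket bracket p q) = 0"
proof (induction p rule: mpoly_induct)
  case (single m a)
  show ?case
  proof (induction q rule: mpoly_induct)
    case (single m' b)
    show ?case
    proof (induction r rule: mpoly_induct)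
      case (single m'' c)
      show ?case
        using bracket_jacobi[of a b c]
        by (simp add: poly_bracket_single ac_simps flip: single_add)
    qed (simp add: poly_bracket_0, unfold poly_bracket_additive, rule sum3_zeroI)
  qed (simp add: poly_bracket_0, unfold poly_bracket_additive, rule sum3_zeroI)
qed (simp add: poly_bracket_0, unfold poly_bracket_additive, rule sum3_zeroI)

lemma lookup_poly_scale:
  "Poly_Mapping.lookup (poly_scale scale r p) m = scale r (Poly_Mapping.lookup p m)"
  by (simp add: poly_scale_def Poly_Mapping.map.rep_eq when_def)

lemma vector_space_poly_scale:
  "vector_space (poly_scale scale :: 'k \<Rightarrow> ('v, 'a) mpoly \<Rightarrow> ('v, 'a) mpoly)"
  by unfold_locales
    (auto intro!: poly_mapping_eqI
      simp: lookup_poly_scale lookup_add scale_right_distrib scale_left_distrib)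

lemma poly_scale_add: "poly_scale scale r (p + q) = poly_scale scale r p + poly_scale scale r q"
  by (rule poly_mapping_eqI) (simp add: lookup_poly_scale lookup_add scale_right_distrib)

lemma poly_scale_single:
  "poly_scale scale r (Poly_Mapping.single m a) = Poly_Mapping.single m (scale r a)"
  by (rule poly_mapping_eqI) (simp add: lookup_poly_scale lookup_single when_def)

lemma poly_scale_0: "poly_scale scale r 0 = 0"
  by (rule poly_mapping_eqI) (simp add: lookup_poly_scale)

lemma poly_scale_mult_left:
  fixes p q :: "('v, 'a) mpoly"
  shows "poly_scale scale r (p * q) = poly_scale scale r p * q"
proof (induction p rule: mpoly_induct)
  case (single m a)
  show ?case
  proof (induction q rule: mpoly_induct)
    case (single m' b)
    show ?case by (simp add: mult_single poly_scale_single scale_mult_left)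
  qed (simp_all add: poly_scale_0 poly_scale_add algebra_simps)
qed (simp_all add: poly_scale_0 poly_scale_add algebra_simps)

lemma poly_bracket_scale_left:
  fixes p q :: "('v, 'a) mpoly"
  shows "poly_bracket bracket (poly_scale scale r p) q = poly_scale scale r (poly_bracket bracket p q)"
proof (induction p rule: mpoly_induct)
  case (single m a)
  show ?case
  proof (induction q rule: mpoly_induct)
    case (single m' b)
    show ?case by (simp add: poly_bracket_single poly_scale_single bracket_scale)
  qed (simp_all add: poly_scale_0 poly_scale_add poly_bracket_additive)
qed (simp_all add: poly_scale_0 poly_scale_add poly_bracket_additive)

lemma poly_scale_minus: "poly_scale scale r (- p) = - poly_scale scale r p"
  by (rule poly_mapping_eqI) (simp add: lookup_poly_scale)

lemma poly_bracket_scale_right: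
  fixes p q :: "('v, 'a) mpoly"
  shows "poly_bracket bracket p (poly_scale scale r q) = poly_scale scale r (poly_bracket bracket p q)"
  using poly_bracket_scale_left[of r q p] poly_bracket_anti[of p q]
    poly_bracket_anti[of p "poly_scale scale r q"]
  by (simp add: poly_scale_minus)

theorem poisson_algebra_polynomial_extension:
  "poisson_algebra
    (poly_scale scale :: 'k \<Rightarrow> ('v, 'a) mpoly \<Rightarrow> ('v, 'a) mpoly) (poly_bracket bracket)"
proof -
  interpret P: vector_space "poly_scale scale :: 'k \<Rightarrow> ('v, 'a) mpoly \<Rightarrow> ('v, 'a) mpoly"
    by (rule vector_space_poly_scale)
  show ?thesis
    by unfold_locales
      (simp_all add: poly_bracket_additive poly_bracket_scale_left poly_bracket_scale_right
        poly_scale_mult_left poly_bracket_self poly_bracket_jacobi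
        poly_bracket_leibniz_left poly_bracket_leibniz_right)
qed

end


section \<open>Strong Poisson cancellation\<close>

text \<open>
  HOL cannot quantify over types inside a formula, so the type of the algebras \<open>B\<close> is an
  argument; a statement of cancellativity has it as a free type variable.  The class
  \<open>comm_ring_1\<close> imposes \<open>0 \<noteq> 1\<close> on \<open>B\<close>.  This loses nothing: \<open>A\<close> is nonzero as well, and
  then \<open>A[t\<^sub>1,\<dots>,t\<^sub>n]\<close> is not isomorphic to the zero ring.
\<close>

definition strongly_poisson_cancellative ::
  "'b::comm_ring_1 itself \<Rightarrow>
   ('k::field \<Rightarrow> 'a::comm_ring_1 \<Rightarrow> 'a) \<Rightarrow> ('a \<Rightarrow> 'a \<Rightarrow> 'a) \<Rightarrow> bool" where
  "strongly_poisson_cancellative TYPE('b) scaleA bracketA \<longleftrightarrow>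
    (\<forall>n\<ge>1. \<forall>(scaleB :: 'k \<Rightarrow> 'b \<Rightarrow> 'b) bracketB.
      poisson_algebra scaleB bracketB \<longrightarrow>
      poisson_isomorphic
        (polys_in n) (poly_scale scaleA) (poly_bracket bracketA)
        (polys_in n) (poly_scale scaleB) (poly_bracket bracketB) \<longrightarrow>
      poisson_isomorphic UNIV scaleA bracketA UNIV scaleB bracketB)"


section \<open>Quadratic brackets on a polynomial ring\<close>

text \<open>\<open>poly_scale (*)\<close> is the standard action of the field on its polynomial ring.\<close>

definition quadratic_poisson ::
  "(('v::finite, 'k::field) mpoly \<Rightarrow> ('v, 'k) mpoly \<Rightarrow> ('v, 'k) mpoly) \<Rightarrow> bool" where
  "quadratic_poisson bracket \<longleftrightarrow>
    poisson_algebra (poly_scale (*)) bracket \<and>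
    (\<forall>i j. homogeneous 2 (bracket (var i) (var j)))"

end

theory Submission
  imports Defs "Jordan_Normal_Form.Determinant"
begin

text \<open>
  Let \<open>f\<close> be a Poisson isomorphism from \<open>A[t]\<close> to \<open>B[s]\<close>.  The derivatives in the \<open>s\<^sub>k\<close> transport along
  \<open>f\<close> to locally nilpotent derivations \<open>D\<^sub>k\<close> of \<open>A[t]\<close> that respect the bracket.  What they do to the
  Poisson centre \<open>Z\<close> of \<open>A\<close> decides the argument.

  If all \<open>D\<^sub>k\<close> kill \<open>Z\<close>, then \<open>f\<close> maps \<open>Z\<close> onto the centre of \<open>B\<close>, by invertibility of a Jacobian
  matrix (\<open>centres_correspond\<close>).  In this case \<open>f\<close> followed by evaluation at \<open>s = 0\<close> is an
  isomorphism from \<open>A\<close> to \<open>B\<close>: its inverse comes from substituting suitable central elements of \<open>A\<close>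
  for the \<open>t\<^sub>j\<close> (\<open>isomorphic_if_centre_killed\<close>).

  The centre of a nonzero quadratic bracket in three variables is graded, and any two central
  elements have parallel gradients, since the bracket has rank two.  By Euler's identity
  homogeneous central elements \<open>z\<close> and \<open>w\<close> of degrees \<open>a\<close> and \<open>b\<close> satisfy \<open>w\<^sup>a = c z\<^sup>b\<close>, so a
  nonzero homogeneous \<open>z\<close> of positive degree divides a power of every central element without
  constant term.  Suppose that \<open>D\<^sub>k\<close> maps \<open>Z\<close> to polynomials whose coefficients have no constant term.  Then the last
  nonzero iterate of \<open>D\<^sub>k\<close> on \<open>z\<close> has a power divisible by \<open>z\<close>, and it is killed by \<open>D\<^sub>k\<close>.  As the kernel
  of a locally nilpotent derivation contains the factors of its nonzero elements, \<open>D\<^sub>k z = 0\<close>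
  (\<open>Ds_centre_zero\<close>).

  Otherwise \<open>D\<^sub>k l\<close> does not vanish at \<open>x = 0\<close> for some \<open>k\<close> and some central linear form \<open>l\<close>.  Then all
  brackets of coordinates are multiples of one quadratic form \<open>q\<close>.  Since \<open>D\<^sub>k\<close> respects the bracket, it
  maps \<open>q\<close> to a multiple of \<open>q\<close>, hence to zero by local nilpotency, and so \<open>q\<close> is constant in a
  direction on which \<open>l\<close> does not vanish (\<open>W_invariant\<close>).  Therefore \<open>A = A\<^sub>0[l]\<close> with \<open>l\<close> central and
  \<open>A\<^sub>0\<close> generated by linear forms.  Here \<open>Z\<close> is the polynomial ring in \<open>l\<close>, and the centre \<open>R\<close> of \<open>B\<close>
  has the property that \<open>R[s]\<close> is the polynomial ring in \<open>l\<close> and the \<open>t\<^sub>j\<close>.  Cancellation for the affine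
  line gives \<open>R = k[g]\<close>, and sending \<open>l\<close> to \<open>g\<close> defines an isomorphism from \<open>A\<close> to \<open>B\<close>.

  For the cancellation itself, linear algebra over the polynomial ring shows that the gradients of
  the elements \<open>w\<close> of \<open>R\<close> are multiples \<open>\<delta> w v\<close> of one vector, where \<open>\<delta>\<close> is a derivation of \<open>R\<close>
  (\<open>gradient_on_R\<close>).  Comparing orders of nilpotency, \<open>\<delta>\<close> lowers a degree.  So it takes some \<open>g\<close> to
  a nonzero constant, and integration of polynomials in \<open>g\<close> exhausts \<open>R\<close> (\<open>R_is_polynomial_ring\<close>).
\<close>

section \<open>Subrings\<close>

locale subring_of =
  fixes C :: "'a::comm_ring_1 set"
  assumes one_closed [simp, intro]: "1 \<in> C"
    and diff_closed [simp, intro]: "x \<in> C \<Longrightarrow> y \<in> C \<Longrightarrow> x - y \<in> C"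
    and mult_closed [simp, intro]: "x \<in> C \<Longrightarrow> y \<in> C \<Longrightarrow> x * y \<in> C"
begin

lemma zero_closed [simp, intro]: "0 \<in> C"
  using diff_closed[OF one_closed one_closed] by simp

lemma uminus_closed [simp, intro]: "x \<in> C \<Longrightarrow> - x \<in> C"
  using diff_closed[OF zero_closed] by fastforce

lemma add_closed [simp, intro]: "x \<in> C \<Longrightarrow> y \<in> C \<Longrightarrow> x + y \<in> C"
  using diff_closed[of x "- y"] by auto

lemma sum_closed [simp, intro]: "(\<And>i. i \<in> I \<Longrightarrow> h i \<in> C) \<Longrightarrow> sum h I \<in> C"
  by (induction I rule: infinite_finite_induct) auto

lemma power_closed [simp, intro]: "x \<in> C \<Longrightarrow> x ^ n \<in> C"
  by (induction n) auto

lemma prod_closed [intro]: "(\<And>i. i \<in> I \<Longrightarrow> h i \<in> C) \<Longrightarrow> prod h I \<in> C"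
  by (induction I rule: infinite_finite_induct) auto

lemma of_int_closed [simp, intro]: "of_int k \<in> C"
proof -
  have "of_nat m \<in> C" for m by (induction m) auto
  then show ?thesis by (cases k rule: int_cases2) auto
qed

subsection \<open>Radicals of principal ideals\<close>

definition radical :: "'a \<Rightarrow> 'a set" where
  "radical d = {x \<in> C. \<exists>N. \<exists>v\<in>C. x ^ N = d * v}"

lemma radical_mult:
  assumes "x \<in> radical d" "y \<in> C"
  shows "x * y \<in> radical d"
proof -
  from assms obtain N v where "x \<in> C" "v \<in> C" "x ^ N = d * v" by (auto simp: radical_def)
  then have "(x * y) ^ N = d * (v * y ^ N)" by (simp add: power_mult_distrib mult.assoc)
  then show ?thesis using assms \<open>x \<in> C\<close> \<open>v \<in> C\<close> unfolding radical_def by blast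
qed

lemma radical_add:
  assumes "x \<in> radical d" "y \<in> radical d"
  shows "x + y \<in> radical d"
proof -
  from assms obtain N v M u where x: "x \<in> C" "v \<in> C" "x ^ N = d * v"
    and y: "y \<in> C" "u \<in> C" "y ^ M = d * u" by (auto simp: radical_def)
  have "\<exists>w\<in>C. of_nat ((N + M) choose k) * x ^ k * y ^ (N + M - k) = d * w" for k
  proof -
    let ?b = "of_nat ((N + M) choose k) :: 'a"
    have b: "?b \<in> C" using of_int_closed[of "int ((N + M) choose k)"] by simp
    show ?thesis
    proof (cases "N \<le> k")
      case True
      then have "x ^ k = d * v * x ^ (k - N)" by (metis x(3) le_add_diff_inverse power_add)
      then have "?b * x ^ k * y ^ (N + M - k) = d * (?b * v * x ^ (k - N) * y ^ (N + M - k))"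
        by (simp add: mult_ac)
      moreover have "?b * v * x ^ (k - N) * y ^ (N + M - k) \<in> C" using b x y by auto
      ultimately show ?thesis by blast
    next
      case False
      then have "M + (N - k) = N + M - k" by simp
      then have "y ^ (N + M - k) = d * u * y ^ (N - k)" by (metis y(3) power_add)
      then have "?b * x ^ k * y ^ (N + M - k) = d * (?b * x ^ k * u * y ^ (N - k))"
        by (simp add: mult_ac)
      moreover have "?b * x ^ k * u * y ^ (N - k) \<in> C" using b x y by auto
      ultimately show ?thesis by blast
    qed
  qed
  then obtain w where w: "\<And>k. w k \<in> C"
    "\<And>k. of_nat ((N + M) choose k) * x ^ k * y ^ (N + M - k) = d * w k" by metis
  have "(x + y) ^ (N + M) = d * (\<Sum>k\<le>N + M. w k)"
    unfolding binomial_ring w(2) by (simp add: sum_distrib_left)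
  moreover have "(\<Sum>k\<le>N + M. w k) \<in> C" using w(1) by (intro sum_closed)
  ultimately show ?thesis using x(1) y(1) unfolding radical_def by blast
qed

lemma radical_zero: "d \<in> C \<Longrightarrow> 0 \<in> radical d"
  unfolding radical_def by (auto intro!: exI[of _ 1] bexI[of _ 0])

lemma radical_sum:
  "d \<in> C \<Longrightarrow> (\<And>i. i \<in> I \<Longrightarrow> h i \<in> radical d) \<Longrightarrow> sum h I \<in> radical d"
  by (induction I rule: infinite_finite_induct) (auto intro: radical_add radical_zero)

end

section \<open>Locally nilpotent derivations\<close>

locale derivation = subring_of C for C :: "'a::comm_ring_1 set" +
  fixes D :: "'a \<Rightarrow> 'a"
  assumes D_closed [simp, intro]: "x \<in> C \<Longrightarrow> D x \<in> C"
    and D_add: "x \<in> C \<Longrightarrow> y \<in> C \<Longrightarrow> D (x + y) = D x + D y"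
    and D_mult: "x \<in> C \<Longrightarrow> y \<in> C \<Longrightarrow> D (x * y) = D x * y + x * D y"
begin

lemma D_zero [simp]: "D 0 = 0"
  using D_add[of 0 0] by simp

lemma D_one [simp]: "D 1 = 0"
  using D_mult[of 1 1] by simp

lemma D_diff: "x \<in> C \<Longrightarrow> y \<in> C \<Longrightarrow> D (x - y) = D x - D y"
  using D_add[of "x - y" y] by simp

lemma D_sum: "(\<And>i. i \<in> I \<Longrightarrow> h i \<in> C) \<Longrightarrow> D (sum h I) = (\<Sum>i\<in>I. D (h i))"
  by (induction I rule: infinite_finite_induct) (auto simp: D_add sum_closed)

lemma D_power_zero: "x \<in> C \<Longrightarrow> D x = 0 \<Longrightarrow> D (x ^ n) = 0"
  by (induction n) (auto simp: D_mult)

lemma D_power: "x \<in> C \<Longrightarrow> D (x ^ Suc i) = of_nat (Suc i) * x ^ i * D x"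
  by (induction i) (auto simp: D_mult algebra_simps)

lemma funpow_closed [simp, intro]: "x \<in> C \<Longrightarrow> (D ^^ n) x \<in> C"
  by (induction n) auto

lemma funpow_zero [simp]: "(D ^^ n) 0 = 0"
  by (induction n) auto

lemma funpow_D_add: "x \<in> C \<Longrightarrow> y \<in> C \<Longrightarrow> (D ^^ n) (x + y) = (D ^^ n) x + (D ^^ n) y"
  by (induction n) (auto simp: D_add)

lemma funpow_vanish: "(D ^^ n) x = 0 \<Longrightarrow> n \<le> m \<Longrightarrow> (D ^^ m) x = 0"
  by (metis funpow_add funpow_zero le_add_diff_inverse2 o_apply)

text \<open>
  In the iterated Leibniz rule for a product only one term survives at the top order;
  this is what makes the nilpotency order of a product additive.
\<close>

lemma funpow_mult_top:
  assumes "x \<in> C" "y \<in> C" "(D ^^ Suc n) x = 0" "(D ^^ Suc m) y = 0"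
  shows "(D ^^ Suc (n + m)) (x * y) = 0 \<and>
    (D ^^ (n + m)) (x * y) = of_nat ((n + m) choose n) * (D ^^ n) x * (D ^^ m) y"
  using assms
proof (induction "n + m" arbitrary: n m x y)
  case 0
  then show ?case by (auto simp: D_mult)
next
  case (Suc N)
  have left: "(D ^^ (n + m)) (D x * y) = 0 \<and> (D ^^ N) (D x * y) =
      of_nat (if n = 0 then 0 else N choose (n - 1)) * (D ^^ n) x * (D ^^ m) y"
  proof (cases n)
    case 0
    then show ?thesis using Suc.prems by simp
  next
    case (Suc n')
    then have "N = n' + m" using \<open>Suc N = n + m\<close> by simp
    from Suc.hyps(1)[OF this, of "D x" y] Suc.prems Suc \<open>N = n' + m\<close> show ?thesis
      by (auto simp: funpow_Suc_right simp del: funpow.simps)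
  qed
  have right: "(D ^^ (n + m)) (x * D y) = 0 \<and> (D ^^ N) (x * D y) =
      of_nat (if m = 0 then 0 else N choose n) * (D ^^ n) x * (D ^^ m) y"
  proof (cases m)
    case 0
    then show ?thesis using Suc.prems by simp
  next
    case (Suc m')
    then have "N = n + m'" using \<open>Suc N = n + m\<close> by simp
    from Suc.hyps(1)[OF this, of x "D y"] Suc.prems Suc \<open>N = n + m'\<close> show ?thesis
      by (auto simp: funpow_Suc_right simp del: funpow.simps)
  qed
  have binom: "(if n = 0 then 0 else N choose (n - 1)) + (if m = 0 then 0 else N choose n) =
      (n + m) choose n"
    using Suc.hyps(2) by (cases n; cases m) (auto simp flip: Suc.hyps(2))
  have cl: "D x * y \<in> C" "x * D y \<in> C" using Suc.prems by auto
  have step: "(D ^^ Suc k) (x * y) = (D ^^ k) (D x * y) + (D ^^ k) (x * D y)" for k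
    using Suc.prems cl by (simp add: funpow_Suc_right D_mult funpow_D_add del: funpow.simps)
  have "(D ^^ (n + m)) (x * y) = of_nat ((n + m) choose n) * (D ^^ n) x * (D ^^ m) y"
    unfolding Suc.hyps(2)[symmetric] step using left right
    by (simp add: Suc.hyps(2) flip: binom of_nat_add distrib_right)
  moreover have "(D ^^ Suc (n + m)) (x * y) = 0"
    unfolding step using left right by simp
  ultimately show ?case by blast
qed

definition nil :: "'a \<Rightarrow> bool" where "nil x \<longleftrightarrow> (\<exists>n. (D ^^ n) x = 0)"

lemma nil_add: "x \<in> C \<Longrightarrow> y \<in> C \<Longrightarrow> nil x \<Longrightarrow> nil y \<Longrightarrow> nil (x + y)"
  unfolding nil_def
  by (metis add.right_neutral funpow_D_add funpow_vanish nle_le)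

lemma nil_mult: "x \<in> C \<Longrightarrow> y \<in> C \<Longrightarrow> nil x \<Longrightarrow> nil y \<Longrightarrow> nil (x * y)"
  unfolding nil_def
  by (metis funpow_mult_top funpow_vanish le_add2 plus_1_eq_Suc)

definition ndeg :: "'a \<Rightarrow> nat" where "ndeg x = (LEAST n. (D ^^ Suc n) x = 0)"

end

locale locally_nilpotent = derivation C D for C :: "'a::{idom,ring_char_0} set" and D +
  assumes all_nil: "x \<in> C \<Longrightarrow> nil x"
begin

lemma funpow_ndeg:
  assumes "x \<in> C"
  shows "(D ^^ Suc (ndeg x)) x = 0" "x \<noteq> 0 \<Longrightarrow> (D ^^ ndeg x) x \<noteq> 0"
proof -
  from all_nil[OF assms] obtain n where "(D ^^ n) x = 0" by (auto simp: nil_def)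
  then have "(D ^^ Suc n) x = 0" by simp
  then show 1: "(D ^^ Suc (ndeg x)) x = 0" unfolding ndeg_def by (rule LeastI)
  show "(D ^^ ndeg x) x \<noteq> 0" if "x \<noteq> 0"
  proof (cases "ndeg x")
    case (Suc k)
    then show ?thesis using not_less_Least[of k "\<lambda>n. (D ^^ Suc n) x = 0"]
      unfolding ndeg_def by auto
  qed (use that in simp)
qed

lemma ndeg_unique: "(D ^^ Suc n) x = 0 \<Longrightarrow> (D ^^ n) x \<noteq> 0 \<Longrightarrow> ndeg x = n"
  unfolding ndeg_def
  by (rule Least_equality) (auto, metis funpow_vanish not_less_eq_eq funpow.simps(2) o_apply)

lemma ndeg_eq_0_iff: "x \<in> C \<Longrightarrow> ndeg x = 0 \<longleftrightarrow> D x = 0"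
  using funpow_ndeg(1)[of x] ndeg_unique[of 0 x] by (cases "x = 0") (auto simp: ndeg_def)

lemma ndeg_D: "x \<in> C \<Longrightarrow> D x \<noteq> 0 \<Longrightarrow> ndeg x = Suc (ndeg (D x))"
  using funpow_ndeg[of "D x"]
  by (intro ndeg_unique) (auto simp: funpow_Suc_right simp del: funpow.simps)

lemma ndeg_mult:
  assumes "x \<in> C" "y \<in> C" "x \<noteq> 0" "y \<noteq> 0"
  shows "ndeg (x * y) = ndeg x + ndeg y"
  using funpow_mult_top[OF assms(1,2) funpow_ndeg(1)[OF assms(1)] funpow_ndeg(1)[OF assms(2)]]
    funpow_ndeg(2)[OF assms(1,3)] funpow_ndeg(2)[OF assms(2,4)]
  by (intro ndeg_unique) auto

text \<open>Nilpotency orders add up in products, so a product of order zero has factors of order zero.\<close>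

lemma kernel_factorially_closed:
  assumes "x \<in> C" "y \<in> C" "x * y \<noteq> 0" "D (x * y) = 0"
  shows "D x = 0"
  using assms ndeg_mult[of x y] ndeg_eq_0_iff[of x] ndeg_eq_0_iff[of "x * y"] by auto

text \<open>
  Multiplication by a nonzero element does not lower the nilpotency order, but a derivation with
  nonzero value does.
\<close>

lemma kernel_if_dvd_derivative:
  assumes "x \<in> C" "y \<in> C" "D x = x * y"
  shows "D x = 0"
  using assms ndeg_mult[of x y] ndeg_D[of x] by auto

end

section \<open>Calculus in polynomial rings\<close>

locale hom_on = subring_of C for C :: "'a::comm_ring_1 set" +
  fixes h :: "'a \<Rightarrow> 'b::comm_ring_1"
  assumes h_one [simp]: "h 1 = 1"
    and h_add: "x \<in> C \<Longrightarrow> y \<in> C \<Longrightarrow> h (x + y) = h x + h y"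
    and h_mult: "x \<in> C \<Longrightarrow> y \<in> C \<Longrightarrow> h (x * y) = h x * h y"
begin

lemma h_zero [simp]: "h 0 = 0"
  using h_add[of 0 0] by simp

lemma h_diff: "x \<in> C \<Longrightarrow> y \<in> C \<Longrightarrow> h (x - y) = h x - h y"
  using h_add[of "x - y" y] by simp

lemma h_sum: "(\<And>i. i \<in> I \<Longrightarrow> g i \<in> C) \<Longrightarrow> h (sum g I) = (\<Sum>i\<in>I. h (g i))"
  by (induction I rule: infinite_finite_induct) (auto simp: h_add sum_closed)

lemma h_power: "x \<in> C \<Longrightarrow> h (x ^ n) = h x ^ n"
  by (induction n) (auto simp: h_mult)

lemma h_of_nat: "C = UNIV \<Longrightarrow> h (of_nat m) = of_nat m"
  by (induction m) (auto simp: h_add)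

end

lemma subring_of_UNIV [simp]: "subring_of UNIV"
  by unfold_locales auto

abbreviation Const :: "'a \<Rightarrow> ('v, 'a::comm_ring_1) mpoly" where
  "Const a \<equiv> Poly_Mapping.single 0 a"

lemma Const_mult: "Const (a * b) = Const a * Const b"
  by (simp add: mult_single)

lemma Const_sum: "Const (sum h I) = (\<Sum>i\<in>I. Const (h i))"
  by (induction I rule: infinite_finite_induct) (auto simp: single_add)

lemma Const_power: "Const (a ^ n) = Const a ^ n"
  by (induction n) (auto simp: Const_mult)

lemma Const_eq_iff [simp]: "Const a = Const b \<longleftrightarrow> a = b"
  using injD[OF inj_single] by metis

lemma Const_eq_0_iff [simp]: "Const a = 0 \<longleftrightarrow> a = 0"
  by (metis Const_eq_iff single_zero)

lemma sum_singles: "(\<Sum>m\<in>Poly_Mapping.keys p. Poly_Mapping.single m (Poly_Mapping.lookup p m)) = p"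
  by (rule poly_mapping_eqI) (auto simp: lookup_sum lookup_single when_def in_keys_iff)

lemma mult_eq_sum:
  fixes p q :: "('c::monoid_add) \<Rightarrow>\<^sub>0 'a::comm_ring_1"
  shows "p * q = (\<Sum>m\<in>Poly_Mapping.keys p. \<Sum>m'\<in>Poly_Mapping.keys q.
    Poly_Mapping.single (m + m') (Poly_Mapping.lookup p m * Poly_Mapping.lookup q m'))"
  by (subst (1) sum_singles[of p, symmetric], subst (1) sum_singles[of q, symmetric])
    (simp add: sum_product mult_single)

lemma single_induct [case_names zero single add]:
  fixes p :: "'c \<Rightarrow>\<^sub>0 'a::comm_monoid_add"
  assumes "P 0" "\<And>m a. P (Poly_Mapping.single m a)" "\<And>p q. P p \<Longrightarrow> P q \<Longrightarrow> P (p + q)"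
  shows "P p"
proof -
  have "P (\<Sum>m\<in>S. Poly_Mapping.single m (Poly_Mapping.lookup p m))" if "finite S" for S
    using that by induction (auto intro: assms)
  then show ?thesis using sum_singles[of p] finite_keys[of p] by metis
qed

lemma monomial_induct [case_names zero mult]:
  fixes m :: "'v \<Rightarrow>\<^sub>0 nat"
  assumes "P 0" "\<And>m j. P m \<Longrightarrow> P (m + Poly_Mapping.single j 1)"
  shows "P m"
proof (induction m rule: single_induct)
  case (add p q)
  have "P (p + q)" if "P p" for p
    using that
  proof (induction q arbitrary: p rule: single_induct)
    case (single j k)
    show ?case
    proof (induction k)
      case (Suc k)
      have "p + Poly_Mapping.single j (Suc k) =
          (p + Poly_Mapping.single j k) + Poly_Mapping.single j 1"
        by (simp add: add.assoc flip: single_add)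
      then show ?case using assms(2)[OF Suc] by simp
    qed (use single in simp)
  qed (auto simp flip: add.assoc)
  with add show ?case by blast
next
  case (single j k)
  show ?case
  proof (induction k)
    case (Suc k)
    have "Poly_Mapping.single j (Suc k) = Poly_Mapping.single j k + Poly_Mapping.single j 1"
      by (simp flip: single_add)
    then show ?case using assms(2)[OF Suc] by simp
  qed (use assms in simp)
qed (use assms in simp)

lemma keys_add_nat: "Poly_Mapping.keys (m + m') =
    Poly_Mapping.keys m \<union> Poly_Mapping.keys (m' :: 'v \<Rightarrow>\<^sub>0 nat)"
  by (auto simp: in_keys_iff lookup_add)

text \<open>
  The coefficients are taken from a subset since the Poisson centre, for which this is needed, is
  not a type.
\<close>

definition polys_over :: "'a set \<Rightarrow> 'v set \<Rightarrow> ('v, 'a::comm_ring_1) mpoly set" where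
  "polys_over Z I = {p. \<forall>m\<in>Poly_Mapping.keys p.
     Poly_Mapping.keys m \<subseteq> I \<and> Poly_Mapping.lookup p m \<in> Z}"

lemma polys_in_eq: "polys_in n = polys_over UNIV {..<n}"
  by (auto simp: polys_in_def polys_over_def)

lemma lookup_Const_mult: "Poly_Mapping.lookup (Const a * p) m = a * Poly_Mapping.lookup p m"
proof (induction p rule: single_induct)
  case (add p q)
  then show ?case by (simp add: lookup_add algebra_simps)
qed (auto simp: mult_single lookup_single when_def)

lemma lookup_mult_0:
  fixes p q :: "('v, 'a::comm_ring_1) mpoly"
  shows "Poly_Mapping.lookup (p * q) 0 = Poly_Mapping.lookup p 0 * Poly_Mapping.lookup q 0"
proof (induction p rule: single_induct)
  case (single m a)
  show ?case
  proof (induction q rule: single_induct)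
    case (single m' b)
    have "m + m' = 0 \<longleftrightarrow> m = 0 \<and> m' = 0"
      by (auto simp: poly_mapping_eq_iff lookup_add fun_eq_iff)
    then show ?case by (auto simp: mult_single lookup_single when_def)
  qed (auto simp: lookup_add algebra_simps)
qed (auto simp: lookup_add algebra_simps)

lemma lookup_var_0 [simp]: "Poly_Mapping.lookup (var i :: ('v, 'a::comm_ring_1) mpoly) 0 = 0"
  by (auto simp: var_def lookup_single when_def poly_mapping_eq_iff fun_eq_iff)

lemma hom_Const: "hom_on UNIV (\<lambda>a :: 'a. Const a :: ('v, 'a::comm_ring_1) mpoly)"
  by unfold_locales (auto simp: single_add Const_mult)

lemma single_eq_Const_mult:
  "Poly_Mapping.single m a = Const a * Poly_Mapping.single m (1 :: 'a::comm_ring_1)"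
  by (simp add: mult_single)

lemma polys_over_single:
  "0 \<in> Z \<Longrightarrow> Poly_Mapping.single m a \<in> polys_over Z I \<longleftrightarrow>
    a = 0 \<or> (Poly_Mapping.keys m \<subseteq> I \<and> a \<in> Z)"
  by (auto simp: polys_over_def)

lemma polys_over_cases_sum:
  assumes "p \<in> polys_over Z I"
  shows "p = (\<Sum>m\<in>Poly_Mapping.keys p. Poly_Mapping.single m (Poly_Mapping.lookup p m))"
    "m \<in> Poly_Mapping.keys p \<Longrightarrow> Poly_Mapping.keys m \<subseteq> I"
    "m \<in> Poly_Mapping.keys p \<Longrightarrow> Poly_Mapping.lookup p m \<in> Z"
  using assms by (auto simp: sum_singles polys_over_def)

context subring_of
begin

lemma polys_over_diff:
  assumes "p \<in> polys_over C I" "q \<in> polys_over C I"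
  shows "p - q \<in> polys_over C I"
proof -
  have "Poly_Mapping.lookup p m \<in> C" "Poly_Mapping.lookup q m \<in> C" for m
    using assms by (cases "Poly_Mapping.lookup p m = 0"; cases "Poly_Mapping.lookup q m = 0"; auto simp: polys_over_def in_keys_iff)+
  moreover have "Poly_Mapping.keys (p - q) \<subseteq> Poly_Mapping.keys p \<union> Poly_Mapping.keys q"
    by (auto simp: in_keys_iff lookup_minus)
  ultimately show ?thesis
    using assms unfolding polys_over_def by (simp add: lookup_minus diff_closed) blast
qed

lemma polys_over_0: "0 \<in> polys_over C I"
  by (simp add: polys_over_def)

lemma polys_over_add:
  assumes "p \<in> polys_over C I" "q \<in> polys_over C I"
  shows "p + q \<in> polys_over C I"
  using polys_over_diff[OF assms(1) polys_over_diff[OF polys_over_0 assms(2)]] by simp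

lemma polys_over_sum: "(\<And>i. i \<in> S \<Longrightarrow> h i \<in> polys_over C I) \<Longrightarrow> sum h S \<in> polys_over C I"
  by (induction S rule: infinite_finite_induct) (auto intro: polys_over_add polys_over_0)

lemma subring_polys_over: "subring_of (polys_over C I :: ('v, 'a) mpoly set)"
proof
  fix p q :: "('v, 'a) mpoly"
  assume p: "p \<in> polys_over C I" and q: "q \<in> polys_over C I"
  show "p - q \<in> polys_over C I" using p q by (rule polys_over_diff)
  show "p * q \<in> polys_over C I"
    unfolding mult_eq_sum
    using polys_over_cases_sum(2,3)[OF p] polys_over_cases_sum(2,3)[OF q]
    by (intro polys_over_sum) (auto simp: polys_over_single keys_add_nat)
qed (auto simp: polys_over_def)

lemma Const_in_polys_over [simp]: "Const a \<in> polys_over C I \<longleftrightarrow> a \<in> C"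
  by (auto simp: polys_over_single)

lemma var_in_polys_over [simp]: "j \<in> I \<Longrightarrow> var j \<in> polys_over C I"
  by (auto simp: polys_over_single var_def)

lemma polys_over_induct [consumes 1, case_names Const var add mult]:
  fixes p :: "('v, 'a) mpoly"
  assumes p: "p \<in> polys_over C I"
    and Const: "\<And>a. a \<in> C \<Longrightarrow> P (Const a)" and var: "\<And>j. j \<in> I \<Longrightarrow> P (var j)"
    and add: "\<And>p q. p \<in> polys_over C I \<Longrightarrow> q \<in> polys_over C I \<Longrightarrow> P p \<Longrightarrow> P q \<Longrightarrow> P (p + q)"
    and mult: "\<And>p q. p \<in> polys_over C I \<Longrightarrow> q \<in> polys_over C I \<Longrightarrow> P p \<Longrightarrow> P q \<Longrightarrow> P (p * q)"
  shows "P p"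
proof -
  interpret P: subring_of "polys_over C I :: ('v, 'a) mpoly set" by (rule subring_polys_over)
  have mon: "P (Poly_Mapping.single m 1)" if "Poly_Mapping.keys m \<subseteq> I" for m :: "'v \<Rightarrow>\<^sub>0 nat"
    using that
  proof (induction m rule: monomial_induct)
    case zero
    show ?case using Const[of 1] by simp
  next
    case (mult m j)
    then have "j \<in> I" "Poly_Mapping.keys m \<subseteq> I" by (auto simp: keys_add_nat)
    then have "P (Poly_Mapping.single m 1 * var j)"
      using mult.IH by (intro assms(5)) (auto simp: polys_over_single intro: var)
    then show ?case by (simp add: var_def mult_single)
  qed
  have "P (\<Sum>m\<in>S. Poly_Mapping.single m (Poly_Mapping.lookup p m))"
    if "finite S" "S \<subseteq> Poly_Mapping.keys p" for S
    using that
  proof (induction S)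
    case empty
    then show ?case using Const[of 0] by simp
  next
    case (insert m S)
    then have m: "Poly_Mapping.keys m \<subseteq> I" "Poly_Mapping.lookup p m \<in> C"
      using polys_over_cases_sum[OF p] by auto
    then have "P (Poly_Mapping.single m (Poly_Mapping.lookup p m))"
      by (subst single_eq_Const_mult, intro mult) (auto simp: polys_over_single Const mon)
    moreover have "(\<Sum>m\<in>S. Poly_Mapping.single m (Poly_Mapping.lookup p m)) \<in> polys_over C I"
      using insert.prems polys_over_cases_sum[OF p]
      by (intro polys_over_sum) (auto simp: polys_over_single)
    ultimately show ?case using insert m
      by (auto intro!: add simp: polys_over_single)
  qed
  from this[of "Poly_Mapping.keys p"] show ?thesis by (simp add: sum_singles)
qed

end

lemma polys_over_UNIV [simp]: "polys_over UNIV UNIV = UNIV"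
  by (auto simp: polys_over_def)

lemma mpoly_gen_induct [case_names Const var add mult]:
  fixes p :: "('v, 'a::comm_ring_1) mpoly"
  assumes "\<And>a. P (Const a)" "\<And>j. P (var j)"
    "\<And>p q. P p \<Longrightarrow> P q \<Longrightarrow> P (p + q)" "\<And>p q. P p \<Longrightarrow> P q \<Longrightarrow> P (p * q)"
  shows "P p"
  using subring_of.polys_over_induct[OF subring_of_UNIV, of p UNIV P] assms by simp

subsection \<open>Evaluation\<close>

definition mono_eval :: "('v \<Rightarrow> 'c::comm_ring_1) \<Rightarrow> ('v \<Rightarrow>\<^sub>0 nat) \<Rightarrow> 'c" where
  "mono_eval c m = (\<Prod>i\<in>Poly_Mapping.keys m. c i ^ Poly_Mapping.lookup m i)"

definition poly_eval ::
  "('a \<Rightarrow> 'c) \<Rightarrow> ('v \<Rightarrow> 'c) \<Rightarrow> ('v, 'a::comm_ring_1) mpoly \<Rightarrow> 'c::comm_ring_1" where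
  "poly_eval h c p = (\<Sum>m\<in>Poly_Mapping.keys p. h (Poly_Mapping.lookup p m) * mono_eval c m)"

lemma mono_eval_add: "mono_eval c (m + m') = mono_eval c m * mono_eval c m'"
proof -
  let ?S = "Poly_Mapping.keys m \<union> Poly_Mapping.keys m'"
  have "mono_eval c k = (\<Prod>i\<in>?S. c i ^ Poly_Mapping.lookup k i)" if "Poly_Mapping.keys k \<subseteq> ?S" for k
    unfolding mono_eval_def using that
    by (intro prod.mono_neutral_left) (auto simp: in_keys_iff)
  then show ?thesis
    by (simp add: keys_add_nat lookup_add power_add prod.distrib)
qed

context hom_on
begin

context
  assumes C: "C = UNIV"
begin

lemma poly_eval_single: "poly_eval h c (Poly_Mapping.single m a) = h a * mono_eval c m"
  by (simp add: poly_eval_def)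

lemma poly_eval_add:
  fixes p q :: "('v, 'a) mpoly"
  shows "poly_eval h c (p + q) = poly_eval h c p + poly_eval h c q"
proof -
  have "poly_eval h c k = (\<Sum>m\<in>Poly_Mapping.keys p \<union> Poly_Mapping.keys q.
      h (Poly_Mapping.lookup k m) * mono_eval c m)"
    if "Poly_Mapping.keys k \<subseteq> Poly_Mapping.keys p \<union> Poly_Mapping.keys q" for k :: "('v, 'a) mpoly"
    unfolding poly_eval_def using that
    by (intro sum.mono_neutral_left) (auto simp: in_keys_iff)
  then show ?thesis using Poly_Mapping.keys_add[of p q]
    by (simp add: lookup_add h_add C algebra_simps sum.distrib)
qed

lemma poly_eval_mult:
  fixes p q :: "('v, 'a) mpoly"
  shows "poly_eval h c (p * q) = poly_eval h c p * poly_eval h c q"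
proof (induction p rule: single_induct)
  case (single m a)
  show ?case
  proof (induction q rule: single_induct)
    case (single m' b)
    show ?case by (simp add: mult_single poly_eval_single mono_eval_add h_mult C)
  qed (auto simp: poly_eval_add algebra_simps, simp add: poly_eval_def)
qed (auto simp: poly_eval_add algebra_simps, simp add: poly_eval_def)

lemma poly_eval_Const [simp]: "poly_eval h c (Const a) = h a"
  by (simp add: poly_eval_single mono_eval_def)

lemma poly_eval_var [simp]: "poly_eval h c (var j) = c j"
  by (simp add: var_def poly_eval_single mono_eval_def)

lemma hom_poly_eval: "hom_on UNIV (poly_eval h c)"
proof
  show "poly_eval h c 1 = 1" using poly_eval_Const[of c 1] by simp
qed (auto simp: poly_eval_add poly_eval_mult)

end

end

subsection \<open>Derivations of polynomial rings\<close>

definition dvar :: "'v \<Rightarrow> ('v, 'a::comm_ring_1) mpoly \<Rightarrow> ('v, 'a) mpoly" where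
  "dvar j p = (\<Sum>m\<in>Poly_Mapping.keys p. Poly_Mapping.single (m - Poly_Mapping.single j 1)
     (of_nat (Poly_Mapping.lookup m j) * Poly_Mapping.lookup p m))"

lemma dvar_single: "dvar j (Poly_Mapping.single m a) =
    Poly_Mapping.single (m - Poly_Mapping.single j 1) (of_nat (Poly_Mapping.lookup m j) * a)"
  by (simp add: dvar_def)

lemma dvar_add:
  fixes p q :: "('v, 'a::comm_ring_1) mpoly"
  shows "dvar j (p + q) = dvar j p + dvar j q"
proof -
  have "dvar j k = (\<Sum>m\<in>Poly_Mapping.keys p \<union> Poly_Mapping.keys q.
      Poly_Mapping.single (m - Poly_Mapping.single j 1)
        (of_nat (Poly_Mapping.lookup m j) * Poly_Mapping.lookup k m))"
    if "Poly_Mapping.keys k \<subseteq> Poly_Mapping.keys p \<union> Poly_Mapping.keys q" for k :: "('v, 'a) mpoly"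
    unfolding dvar_def using that
    by (intro sum.mono_neutral_left) (auto simp: in_keys_iff)
  then show ?thesis using Poly_Mapping.keys_add[of p q]
    by (simp add: lookup_add algebra_simps sum.distrib single_add)
qed

lemma dvar_0 [simp]: "dvar j 0 = 0"
  by (simp add: dvar_def)

lemma dvar_mult: "dvar j (p * q) = dvar j p * q + p * dvar j q"
proof (induction p rule: single_induct)
  case (single m a)
  show ?case
  proof (induction q rule: single_induct)
    case (single m' b)
    let ?e = "Poly_Mapping.single j (1::nat)"
    have *: "(m - ?e) + m' = m + m' - ?e" if "Poly_Mapping.lookup m j \<noteq> 0" for m m' :: "'a \<Rightarrow>\<^sub>0 nat"
      using that
      by (intro poly_mapping_eqI) (auto simp: lookup_add lookup_minus lookup_single when_def)
    have "Poly_Mapping.single ((m - ?e) + m') (of_nat (Poly_Mapping.lookup m j) * a * b) =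
        Poly_Mapping.single (m + m' - ?e) (of_nat (Poly_Mapping.lookup m j) * a * b)"
      using *[of m m'] by (cases "Poly_Mapping.lookup m j = 0") auto
    moreover have "Poly_Mapping.single (m + (m' - ?e)) (a * (of_nat (Poly_Mapping.lookup m' j) * b)) =
        Poly_Mapping.single (m + m' - ?e) (a * (of_nat (Poly_Mapping.lookup m' j) * b))"
      using *[of m' m] by (cases "Poly_Mapping.lookup m' j = 0") (auto simp: add.commute)
    ultimately show ?case
      by (simp add: mult_single dvar_single lookup_add algebra_simps flip: single_add)
  qed (auto simp: dvar_add algebra_simps)
qed (auto simp: dvar_add algebra_simps)

lemma derivation_dvar: "derivation UNIV (dvar j)"
  by unfold_locales (auto simp: dvar_add dvar_mult)

lemma dvar_Const [simp]: "dvar j (Const a) = 0"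
  by (simp add: dvar_single)

lemma dvar_var: "dvar j (var i) = (if i = j then 1 else 0)"
  by (auto simp: var_def dvar_single lookup_single)

lemma lookup_dvar:
  "Poly_Mapping.lookup (dvar j p) m =
    of_nat (Suc (Poly_Mapping.lookup m j)) * Poly_Mapping.lookup p (m + Poly_Mapping.single j 1)"
proof (induction p rule: single_induct)
  case (single m0 a)
  let ?e = "Poly_Mapping.single j (1::nat)"
  show ?case
  proof (cases "m0 = m + ?e")
    case True
    then show ?thesis by (simp add: dvar_single lookup_add)
  next
    case False
    have "m0 - ?e = m \<Longrightarrow> Poly_Mapping.lookup m0 j \<noteq> 0 \<Longrightarrow> m0 = m + ?e"
      by (intro poly_mapping_eqI) (auto simp: lookup_add lookup_minus lookup_single when_def)
    with False show ?thesis
      by (cases "Poly_Mapping.lookup m0 j = 0")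
        (auto simp: dvar_single lookup_single when_def simp del: One_nat_def)
  qed
qed (auto simp: dvar_add lookup_add algebra_simps)

lemma lookup_var_mult_dvar:
  "Poly_Mapping.lookup (var j * dvar j p) m =
    of_nat (Poly_Mapping.lookup m j) * Poly_Mapping.lookup p m"
proof (induction p rule: single_induct)
  case (single m0 a)
  have "Poly_Mapping.single j 1 + (m0 - Poly_Mapping.single j 1) = m0"
    if "Poly_Mapping.lookup m0 j \<noteq> 0"
    using that
    by (intro poly_mapping_eqI) (auto simp: lookup_add lookup_minus lookup_single when_def)
  then show ?case
    by (cases "Poly_Mapping.lookup m0 j = 0")
      (auto simp: var_def dvar_single mult_single lookup_single when_def)
qed (auto simp: dvar_add lookup_add algebra_simps)

lemma (in subring_of) dvar_polys_over: "p \<in> polys_over C I \<Longrightarrow> dvar j p \<in> polys_over C I"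
proof (induction p rule: polys_over_induct)
  case (mult p q)
  interpret P: subring_of "polys_over C I" by (rule subring_polys_over)
  show ?case using mult by (simp add: dvar_mult P.add_closed P.mult_closed)
qed (auto simp: dvar_var dvar_add polys_over_add polys_over_0 subring_of.one_closed[OF subring_polys_over])

lemma nil_dvar: "derivation.nil (dvar j) p"
proof -
  interpret D: derivation UNIV "dvar j" by (rule derivation_dvar)
  show ?thesis
  proof (induction p rule: mpoly_gen_induct)
    case (Const a)
    have "(dvar j ^^ 1) (Const a) = 0" by simp
    then show ?case unfolding D.nil_def by blast
  next
    case (var i)
    have "(dvar j ^^ 2) (var i) = 0" by (simp add: numeral_2_eq_2 dvar_var)
    then show ?case unfolding D.nil_def by blast
  qed (auto intro: D.nil_add D.nil_mult)
qed

definition lift_coeff :: "('a \<Rightarrow> 'a) \<Rightarrow> ('v, 'a::comm_ring_1) mpoly \<Rightarrow> ('v, 'a) mpoly" where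
  "lift_coeff d p = Poly_Mapping.map d p"

context derivation
begin

lemma lookup_lift_coeff [simp]:
  "Poly_Mapping.lookup (lift_coeff D p) m = D (Poly_Mapping.lookup p m)"
  by (simp add: lift_coeff_def Poly_Mapping.map.rep_eq when_def)

lemma lift_coeff_Const [simp]: "lift_coeff D (Const a) = Const (D a)"
  by (rule poly_mapping_eqI) (auto simp: lookup_single when_def)

lemma lift_coeff_var [simp]: "lift_coeff D (var j) = 0"
  by (rule poly_mapping_eqI) (auto simp: var_def lookup_single when_def)

lemma derivation_lift_coeff:
  assumes "C = UNIV"
  shows "derivation UNIV (lift_coeff D :: ('v, 'a) mpoly \<Rightarrow> ('v, 'a) mpoly)"
proof -
  have lift_single: "lift_coeff D (Poly_Mapping.single m a) = Poly_Mapping.single m (D a)"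
    for m :: "'v \<Rightarrow>\<^sub>0 nat" and a
    by (rule poly_mapping_eqI) (auto simp: lookup_single when_def)
  have add: "lift_coeff D (p + q) = lift_coeff D p + lift_coeff D q"
    for p q :: "('v, 'a) mpoly"
    by (rule poly_mapping_eqI) (auto simp: lookup_add D_add assms)
  have zero: "lift_coeff D (0 :: ('v, 'a) mpoly) = 0" by (rule poly_mapping_eqI) simp
  have mult: "lift_coeff D (p * q) = lift_coeff D p * q + p * lift_coeff D q"
    for p q :: "('v, 'a) mpoly"
  proof (induction p rule: single_induct)
    case (single m a)
    show ?case
    proof (induction q rule: single_induct)
      case (single m' b)
      show ?case by (simp add: mult_single lift_single D_mult assms single_add)
    qed (auto simp: add zero algebra_simps)
  qed (auto simp: add zero algebra_simps)
  show ?thesis by unfold_locales (auto simp: add mult)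
qed

end

text \<open>
  The last assumption is characteristic zero for a coefficient ring that may have zero divisors.
\<close>

lemma const_if_dvar_zero:
  fixes p :: "('v, 'a::comm_ring_1) mpoly"
  assumes "\<And>m. m \<in> Poly_Mapping.keys p \<Longrightarrow> Poly_Mapping.keys m \<subseteq> I"
    and "\<And>j. j \<in> I \<Longrightarrow> dvar j p = 0"
    and char0: "\<And>k (a :: 'a). of_nat (Suc k) * a = 0 \<Longrightarrow> a = 0"
  shows "p = Const (Poly_Mapping.lookup p 0)"
proof (rule poly_mapping_eqI)
  fix m
  have "Poly_Mapping.lookup p m = 0" if "m \<noteq> 0"
  proof (rule ccontr)
    assume *: "Poly_Mapping.lookup p m \<noteq> 0"
    from that obtain j where j: "Poly_Mapping.lookup m j \<noteq> 0"
      by (auto simp: poly_mapping_eq_iff fun_eq_iff)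
    then have "j \<in> I" using assms(1)[of m] * by (auto simp: in_keys_iff)
    let ?m = "m - Poly_Mapping.single j 1"
    have "?m + Poly_Mapping.single j 1 = m" using j
      by (intro poly_mapping_eqI) (auto simp: lookup_add lookup_minus lookup_single when_def)
    with lookup_dvar[of j p ?m] assms(2)[OF \<open>j \<in> I\<close>] * char0 show False by auto
  qed
  then show "Poly_Mapping.lookup p m = Poly_Mapping.lookup (Const (Poly_Mapping.lookup p 0)) m"
    by (auto simp: lookup_single when_def)
qed

section \<open>Isomorphisms of polynomial extensions of Poisson algebras\<close>

text \<open>
  A right inverse makes the determinant of \<open>J\<close> a unit, and multiplying \<open>J v = 0\<close> by the adjugate
  of \<open>J\<close> gives \<open>det J v = 0\<close>.
\<close>

lemma matrix_kernel_trivial: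
  fixes J K :: "nat \<Rightarrow> nat \<Rightarrow> 'a::comm_ring_1"
  assumes inv: "\<And>i l. i < n \<Longrightarrow> l < n \<Longrightarrow> (\<Sum>j<n. J i j * K j l) = (if i = l then 1 else 0)"
    and ker: "\<And>i. i < n \<Longrightarrow> (\<Sum>j<n. J i j * v j) = 0"
    and "j < n"
  shows "v j = 0"
proof -
  define A where "A = mat n n (\<lambda>(i, j). J i j)"
  define B where "B = mat n n (\<lambda>(i, j). K i j)"
  define w where "w = vec n v"
  have car: "A \<in> carrier_mat n n" "B \<in> carrier_mat n n" "w \<in> carrier_vec n"
    by (auto simp: A_def B_def w_def)
  have "A * B = 1\<^sub>m n"
    by (rule eq_matI) (auto simp: A_def B_def scalar_prod_def atLeast0LessThan inv)
  then have unit: "det A * det B = 1"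
    using det_mult[OF car(1,2)] by simp
  have "A *\<^sub>v w = 0\<^sub>v n"
    by (rule eq_vecI) (auto simp: A_def w_def scalar_prod_def atLeast0LessThan ker)
  then have "(adj_mat A * A) *\<^sub>v w = adj_mat A *\<^sub>v 0\<^sub>v n"
    using assoc_mult_mat_vec[OF adj_mat(1)[OF car(1)] car(1,3)] by simp
  then have "(det A \<cdot>\<^sub>m 1\<^sub>m n) *\<^sub>v w = adj_mat A *\<^sub>v 0\<^sub>v n"
    using adj_mat(3)[OF car(1)] by simp
  moreover have "adj_mat A *\<^sub>v 0\<^sub>v n = 0\<^sub>v n"
    using adj_mat(1)[OF car(1)] by (intro eq_vecI) auto
  moreover have "(det A \<cdot>\<^sub>m 1\<^sub>m n) *\<^sub>v w = det A \<cdot>\<^sub>v w"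
    using car(3) by (intro eq_vecI) (auto simp: scalar_prod_def w_def if_distrib if_distribR cong: if_cong)
  ultimately have "(det A \<cdot>\<^sub>v w) $ j = 0" using \<open>j < n\<close> by simp
  then have "det A * v j = 0" using \<open>j < n\<close> by (simp add: w_def)
  then have "det B * (det A * v j) = 0" by simp
  with unit show ?thesis by (simp add: mult.assoc[symmetric] mult.commute[of "det B"])
qed

definition poisson_centre :: "('a \<Rightarrow> 'a \<Rightarrow> 'a::comm_ring_1) \<Rightarrow> 'a set" where
  "poisson_centre br = {a. \<forall>b. br a b = 0}"

context poisson_algebra
begin

lemma scale_eq: "scale r a = scale r 1 * a"
  using scale_mult_left[of r 1 a] by simp

lemma hom_scale_one: "hom_on UNIV (\<lambda>r. scale r 1)"
  by unfold_locales (auto simp: scale_left_distrib scale_mult_left[symmetric])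

lemma scale_of_nat: "scale (of_nat m) a = of_nat m * a"
  by (induction m) (auto simp: scale_left_distrib algebra_simps)

lemma bracket_of_nat:
  "bracket (of_nat m * a) b = of_nat m * bracket a b"
  "bracket a (of_nat m * b) = of_nat m * bracket a b"
  by (metis bracket_scale scale_of_nat)+

lemma bracket_diff: "bracket (a - b) c = bracket a c - bracket b c"
  using bracket_add(1)[of "a - b" b c] by simp

lemma subring_centre: "subring_of (poisson_centre bracket)"
  by unfold_locales (auto simp: poisson_centre_def bracket_diff bracket_leibniz_left)

lemma scale_one_in_centre [simp]: "scale r 1 \<in> poisson_centre bracket"
  by (auto simp: poisson_centre_def bracket_scale)

lemma centreD [simp]:
  assumes "z \<in> poisson_centre bracket" shows "bracket z a = 0" "bracket a z = 0"
  using assms bracket_anti[of a z] by (auto simp: poisson_centre_def)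

lemma lookup_poly_bracket_Const:
  "Poly_Mapping.lookup (poly_bracket bracket p (Const b)) m = bracket (Poly_Mapping.lookup p m) b"
  by (induction p rule: single_induct)
    (auto simp: poly_bracket_additive poly_bracket_single lookup_add lookup_single when_def
      bracket_add)

lemma lookup_poly_bracket_0:
  fixes p q :: "('v, 'a) mpoly"
  shows "Poly_Mapping.lookup (poly_bracket bracket p q) 0 =
    bracket (Poly_Mapping.lookup p 0) (Poly_Mapping.lookup q 0)"
proof (induction p rule: single_induct)
  case (single m a)
  show ?case
  proof (induction q rule: single_induct)
    case (single m' b)
    have "m + m' = 0 \<longleftrightarrow> m = 0 \<and> m' = 0"
      by (auto simp: poly_mapping_eq_iff lookup_add fun_eq_iff)
    then show ?case by (auto simp: poly_bracket_single lookup_single when_def)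
  qed (auto simp: poly_bracket_additive lookup_add bracket_add)
qed (auto simp: poly_bracket_additive lookup_add bracket_add)

text \<open>Brackets with constants are taken coefficientwise and thus detect a noncentral coefficient.\<close>

lemma poly_centre_iff:
  assumes "p \<in> polys_in n"
  shows "p \<in> polys_over (poisson_centre bracket) {..<n} \<longleftrightarrow>
    (\<forall>q\<in>polys_in n. poly_bracket bracket p q = 0)"
proof
  assume "p \<in> polys_over (poisson_centre bracket) {..<n}"
  then have "m \<in> Poly_Mapping.keys p \<Longrightarrow> Poly_Mapping.lookup p m \<in> poisson_centre bracket" for m
    by (auto simp: polys_over_def)
  then show "\<forall>q\<in>polys_in n. poly_bracket bracket p q = 0"
    by (auto simp: poly_bracket_def)
next
  assume *: "\<forall>q\<in>polys_in n. poly_bracket bracket p q = 0"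
  have "bracket (Poly_Mapping.lookup p m) b = 0" for m b
  proof -
    have "Const b \<in> polys_in n" by (auto simp: polys_in_def)
    with * have "poly_bracket bracket p (Const b) = 0" by blast
    then show ?thesis using lookup_poly_bracket_Const[of p b m] by simp
  qed
  then have "Poly_Mapping.lookup p m \<in> poisson_centre bracket" for m
    unfolding poisson_centre_def by blast
  with assms show "p \<in> polys_over (poisson_centre bracket) {..<n}"
    unfolding polys_over_def polys_in_def by blast
qed

lemma poly_bracket_closed:
  fixes p q :: "(nat, 'a) mpoly"
  assumes "p \<in> polys_in n" "q \<in> polys_in n"
  shows "poly_bracket bracket p q \<in> polys_in n"
proof -
  interpret S: subring_of "UNIV :: 'a set" by simp
  have "Poly_Mapping.single (m + m') a \<in> polys_over UNIV {..<n}"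
    if "m \<in> Poly_Mapping.keys p" "m' \<in> Poly_Mapping.keys q" for m m' and a :: 'a
    using that assms by (auto simp: polys_over_def polys_in_def keys_add_nat)
  then show ?thesis
    unfolding poly_bracket_def polys_in_eq by (intro S.polys_over_sum) blast
qed

lemma dvar_poly_bracket:
  fixes p q :: "('v, 'a) mpoly"
  shows "dvar j (poly_bracket bracket p q) =
    poly_bracket bracket (dvar j p) q + poly_bracket bracket p (dvar j q)"
proof (induction p rule: single_induct)
  case (single m a)
  show ?case
  proof (induction q rule: single_induct)
    case (single m' b)
    let ?e = "Poly_Mapping.single j (1::nat)"
    have *: "(m - ?e) + m' = m + m' - ?e" if "Poly_Mapping.lookup m j \<noteq> 0" for m m' :: "'v \<Rightarrow>\<^sub>0 nat"
      using that
      by (intro poly_mapping_eqI) (auto simp: lookup_add lookup_minus lookup_single when_def)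
    have "Poly_Mapping.single ((m - ?e) + m') (of_nat (Poly_Mapping.lookup m j) * bracket a b) =
        Poly_Mapping.single (m + m' - ?e) (of_nat (Poly_Mapping.lookup m j) * bracket a b)"
      using *[of m m'] by (cases "Poly_Mapping.lookup m j = 0") auto
    moreover have "Poly_Mapping.single (m + (m' - ?e)) (of_nat (Poly_Mapping.lookup m' j) * bracket a b) =
        Poly_Mapping.single (m + m' - ?e) (of_nat (Poly_Mapping.lookup m' j) * bracket a b)"
      using *[of m' m] by (cases "Poly_Mapping.lookup m' j = 0") (auto simp: add.commute)
    ultimately show ?case
      by (simp add: poly_bracket_single dvar_single lookup_add bracket_of_nat distrib_right
          single_add)
  qed (auto simp: dvar_add poly_bracket_additive)
qed (auto simp: dvar_add poly_bracket_additive)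

end

lemma poisson_algebra_char0:
  fixes scale :: "'k::field_char_0 \<Rightarrow> 'a::comm_ring_1 \<Rightarrow> 'a"
  assumes "poisson_algebra scale bracket" "of_nat (Suc k) * (a :: 'a) = 0"
  shows "a = 0"
proof -
  interpret poisson_algebra scale bracket by fact
  have "scale (of_nat (Suc k)) a = 0" unfolding scale_of_nat by (rule assms)
  then show ?thesis using scale_eq_0_iff of_nat_neq_0 by metis
qed

locale poisson_extension_iso =
  A: poisson_algebra sA bA + B: poisson_algebra sB bB
  for sA :: "'k::field_char_0 \<Rightarrow> 'a::comm_ring_1 \<Rightarrow> 'a" and bA
    and sB :: "'k \<Rightarrow> 'b::comm_ring_1 \<Rightarrow> 'b" and bB +
  fixes n :: nat and f :: "(nat, 'a) mpoly \<Rightarrow> (nat, 'b) mpoly"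
  assumes bij: "bij_betw f (polys_in n) (polys_in n)"
    and f_one: "f 1 = 1"
    and f_add: "x \<in> polys_in n \<Longrightarrow> y \<in> polys_in n \<Longrightarrow> f (x + y) = f x + f y"
    and f_mult: "x \<in> polys_in n \<Longrightarrow> y \<in> polys_in n \<Longrightarrow> f (x * y) = f x * f y"
    and f_scale: "x \<in> polys_in n \<Longrightarrow> f (poly_scale sA c x) = poly_scale sB c (f x)"
    and f_bracket: "x \<in> polys_in n \<Longrightarrow> y \<in> polys_in n \<Longrightarrow>
      f (poly_bracket bA x y) = poly_bracket bB (f x) (f y)"
begin

abbreviation "CA \<equiv> polys_in n :: (nat, 'a) mpoly set"
abbreviation "CB \<equiv> polys_in n :: (nat, 'b) mpoly set"
abbreviation "ZA \<equiv> poisson_centre bA"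
abbreviation "ZB \<equiv> poisson_centre bB"
abbreviation "ZCA \<equiv> polys_over ZA {..<n}"
abbreviation "ZCB \<equiv> polys_over ZB {..<n}"

definition g :: "(nat, 'b) mpoly \<Rightarrow> (nat, 'a) mpoly" where
  "g = inv_into CA f"

lemma f_closed [simp]: "p \<in> CA \<Longrightarrow> f p \<in> CB"
  using bij by (auto simp: bij_betw_def)

lemma g_closed [simp]: "q \<in> CB \<Longrightarrow> g q \<in> CA"
  using bij by (metis bij_betw_def g_def inv_into_into)

lemma f_g [simp]: "q \<in> CB \<Longrightarrow> f (g q) = q"
  using bij by (metis bij_betw_def f_inv_into_f g_def)

lemma g_f [simp]: "p \<in> CA \<Longrightarrow> g (f p) = p"
  using bij by (metis bij_betw_def inv_into_f_f g_def)

sublocale CA: subring_of CA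
  unfolding polys_in_eq by (rule subring_of.subring_polys_over) simp

sublocale CB: subring_of CB
  unfolding polys_in_eq by (rule subring_of.subring_polys_over) simp

sublocale ZA: subring_of ZA by (rule A.subring_centre)
sublocale ZB: subring_of ZB by (rule B.subring_centre)
sublocale ZCA: subring_of ZCA by (rule ZA.subring_polys_over)
sublocale ZCB: subring_of ZCB by (rule ZB.subring_polys_over)

lemma ZCA_CA: "p \<in> ZCA \<Longrightarrow> p \<in> CA" and ZCB_CB: "q \<in> ZCB \<Longrightarrow> q \<in> CB"
  by (auto simp: polys_over_def polys_in_def)

lemma Const_CA [simp]: "Const a \<in> CA" and Const_CB [simp]: "Const b \<in> CB"
  by (auto simp: polys_in_def)

lemma var_CA [simp]: "j < n \<Longrightarrow> var j \<in> CA" and var_CB [simp]: "j < n \<Longrightarrow> var j \<in> CB"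
  by (auto simp: polys_in_def var_def)

sublocale f: hom_on CA f
  by unfold_locales (auto simp: f_one f_add f_mult)

lemma g_eqI: "p \<in> CA \<Longrightarrow> f p = q \<Longrightarrow> g q = p"
  by auto

sublocale g: hom_on CB g
  by unfold_locales (auto intro!: g_eqI simp: f_one f_add f_mult)

lemma f_Const_scale: "f (Const (sA c 1)) = Const (sB c 1)"
  by (metis CA.one_closed A.poly_scale_single B.poly_scale_single f_one f_scale single_one)

lemma g_Const_scale: "g (Const (sB c 1)) = Const (sA c 1)"
  by (rule g_eqI) (simp_all add: f_Const_scale)

lemma f_centre: "p \<in> ZCA \<Longrightarrow> f p \<in> ZCB"
proof -
  assume p: "p \<in> ZCA"
  note C = ZCA_CA[OF p]
  have "poly_bracket bB (f p) q = 0" if "q \<in> CB" for q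
    using f_bracket[OF C g_closed[OF that]] p that
    by (simp add: A.poly_centre_iff[OF C])
  then show ?thesis using B.poly_centre_iff[OF f_closed[OF C]] by blast
qed

lemma g_bracket: "x \<in> CB \<Longrightarrow> y \<in> CB \<Longrightarrow> g (poly_bracket bB x y) = poly_bracket bA (g x) (g y)"
  by (rule g_eqI) (auto simp: f_bracket intro: A.poly_bracket_closed)

lemma g_centre: "q \<in> ZCB \<Longrightarrow> g q \<in> ZCA"
proof -
  assume q: "q \<in> ZCB"
  note C = ZCB_CB[OF q]
  have "poly_bracket bA (g q) p = 0" if "p \<in> CA" for p
    using g_bracket[OF C f_closed[OF that]] q that
    by (simp add: B.poly_centre_iff[OF C])
  then show ?thesis using A.poly_centre_iff[OF g_closed[OF C]] by blast
qed

subsection \<open>The derivations transported from the other side\<close>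

definition Ds :: "nat \<Rightarrow> (nat, 'a) mpoly \<Rightarrow> (nat, 'a) mpoly" where
  "Ds j p = g (dvar j (f p))"

lemma dvar_ZCB: "q \<in> ZCB \<Longrightarrow> dvar j q \<in> ZCB"
  by (rule ZB.dvar_polys_over)

lemma dvar_CB: "q \<in> CB \<Longrightarrow> dvar j q \<in> CB"
  unfolding polys_in_eq by (rule subring_of.dvar_polys_over) auto

sublocale Ds: derivation CA "Ds j" for j
proof -
  interpret d: derivation UNIV "dvar j :: (nat, 'b) mpoly \<Rightarrow> _" by (rule derivation_dvar)
  show "derivation CA (Ds j)"
    by unfold_locales
      (auto simp: Ds_def dvar_CB f_add f_mult dvar_add dvar_mult g.h_add g.h_mult)
qed

lemma funpow_Ds: "p \<in> CA \<Longrightarrow> (Ds j ^^ N) p = g ((dvar j ^^ N) (f p)) \<and> (dvar j ^^ N) (f p) \<in> CB"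
  by (induction N) (auto simp: Ds_def dvar_CB)

lemma nil_Ds: "p \<in> CA \<Longrightarrow> derivation.nil (Ds j) p"
  using nil_dvar[of j "f p"] funpow_Ds[of p _ j]
  unfolding Ds.nil_def derivation.nil_def[OF derivation_dvar] by (metis g.h_zero)

lemma Ds_ZCA: "p \<in> ZCA \<Longrightarrow> Ds j p \<in> ZCA"
  by (simp add: Ds_def g_centre dvar_ZCB f_centre)

lemma Ds_scale [simp]: "Ds j (Const (sA c 1)) = 0"
  by (simp add: Ds_def f_Const_scale)

lemma Ds_g_var: "k < n \<Longrightarrow> Ds j (g (var k)) = (if j = k then 1 else 0)"
  by (simp add: Ds_def dvar_var)

lemma Ds_g_Const [simp]: "Ds j (g (Const b)) = 0"
  by (simp add: Ds_def)

lemma Ds_bracket: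
  assumes "p \<in> CA" "q \<in> CA"
  shows "Ds j (poly_bracket bA p q) =
    poly_bracket bA (Ds j p) q + poly_bracket bA p (Ds j q)"
  using assms
  by (simp add: Ds_def f_bracket B.dvar_poly_bracket g.h_add g_bracket B.poly_bracket_closed dvar_CB)

lemma Ds_zero_imp_Const:
  assumes "p \<in> CA" "\<And>j. j < n \<Longrightarrow> Ds j p = 0"
  shows "f p = Const (Poly_Mapping.lookup (f p) 0)"
proof (rule const_if_dvar_zero[where I = "{..<n}"])
  show "Poly_Mapping.keys m \<subseteq> {..<n}" if "m \<in> Poly_Mapping.keys (f p)" for m
    using f_closed[OF assms(1)] that by (auto simp: polys_in_def)
  show "dvar j (f p) = 0" if "j \<in> {..<n}" for j
    using assms(2)[of j] that f_g[of "dvar j (f p)"] by (simp add: Ds_def dvar_CB assms(1))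
  show "b = 0" if "of_nat (Suc k) * b = 0" for k and b :: 'b
    using poisson_algebra_char0[OF B.poisson_algebra_axioms that] .
qed

lemma lookup_ZCB_0: "q \<in> ZCB \<Longrightarrow> Poly_Mapping.lookup q 0 \<in> ZB"
  by (cases "Poly_Mapping.lookup q 0 = 0") (auto simp: polys_over_def in_keys_iff)

text \<open>
  If the transported derivations kill the centre of \<open>A\<close>, then on central polynomials they are
  combinations of the derivatives in the \<open>t\<^sub>j\<close>, with the Jacobian matrix as coefficients.  That
  matrix is invertible, so an element killed by all of them has zero derivatives in the \<open>t\<^sub>j\<close>; this
  applies to the preimages of the central elements of \<open>B\<close>.
\<close>

lemma centres_correspond:
  assumes kill: "\<And>j z. j < n \<Longrightarrow> z \<in> ZA \<Longrightarrow> Ds j (Const z) = 0"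
  shows "z \<in> ZA \<Longrightarrow> \<exists>w\<in>ZB. f (Const z) = Const w"
    and "w \<in> ZB \<Longrightarrow> \<exists>z\<in>ZA. f (Const z) = Const w"
proof -
  show "\<exists>w\<in>ZB. f (Const z) = Const w" if "z \<in> ZA" for z
  proof -
    have "f (Const z) = Const (Poly_Mapping.lookup (f (Const z)) 0)"
      using kill that by (intro Ds_zero_imp_Const) auto
    moreover have "Poly_Mapping.lookup (f (Const z)) 0 \<in> ZB"
      using that by (intro lookup_ZCB_0 f_centre) auto
    ultimately show ?thesis by blast
  qed
  have chain: "Ds k p = (\<Sum>j<n. Ds k (var j) * dvar j p)" if "p \<in> ZCA" "k < n" for k p
    using that(1)
  proof (induction p rule: ZA.polys_over_induct)
    case (mult p q)
    have "(\<Sum>j<n. Ds k (var j) * dvar j p) * q + p * (\<Sum>j<n. Ds k (var j) * dvar j q) =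
      (\<Sum>j<n. Ds k (var j) * dvar j (p * q))"
      by (simp add: dvar_mult sum_distrib_left sum_distrib_right algebra_simps sum.distrib)
    then show ?case using mult by (simp add: Ds.D_mult ZCA_CA)
  next
    case (add p q)
    then show ?case by (simp add: Ds.D_add ZCA_CA dvar_add algebra_simps sum.distrib)
  qed (use that kill in \<open>auto simp: dvar_var if_distrib[of "\<lambda>x. _ * x"] cong: if_cong\<close>)
  show "\<exists>z\<in>ZA. f (Const z) = Const w" if w: "w \<in> ZB" for w
  proof -
    let ?p = "g (Const w)"
    have p: "?p \<in> ZCA" using w by (intro g_centre) auto
    have "dvar j ?p = 0" if "j < n" for j
    proof (rule matrix_kernel_trivial[where n = n and j = j and v = "\<lambda>j. dvar j ?p"])
      fix i l assume il: "i < n" "l < n"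
      then have "g (var l) \<in> ZCA" by (intro g_centre) auto
      from chain[OF this il(1)] show
        "(\<Sum>j<n. Ds i (var j) * dvar j (g (var l))) = (if i = l then 1 else 0)"
        using il by (simp add: Ds_g_var)
    next
      fix i assume "i < n"
      from chain[OF p this] show "(\<Sum>j<n. Ds i (var j) * dvar j ?p) = 0" by simp
    qed (use that in simp)
    then have "?p = Const (Poly_Mapping.lookup ?p 0)"
      using p poisson_algebra_char0[OF A.poisson_algebra_axioms]
      by (intro const_if_dvar_zero[where I = "{..<n}"]) (auto simp: polys_over_def)
    moreover from this have "Poly_Mapping.lookup ?p 0 \<in> ZA"
      using p by (metis ZA.Const_in_polys_over)
    ultimately show ?thesis by (metis Const_CB f_g)
  qed
qed

subsection \<open>Descending an isomorphism to the coefficients\<close>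

definition ev :: "'a \<Rightarrow> 'b" where "ev a = Poly_Mapping.lookup (f (Const a)) 0"

sublocale ev: hom_on UNIV ev
proof
  show "ev 1 = 1" unfolding ev_def single_one f_one lookup_one_zero ..
  show "ev (x + y) = ev x + ev y" for x y
    by (simp only: ev_def single_add f_add[OF Const_CA Const_CA] lookup_add)
  show "ev (x * y) = ev x * ev y" for x y
    by (simp only: ev_def Const_mult f_mult[OF Const_CA Const_CA] lookup_mult_0)
qed auto

lemma ev_scale: "ev (sA c a) = sB c (ev a)"
  by (metis A.poly_scale_single B.lookup_poly_scale Const_CA ev_def f_scale)

lemma ev_bracket: "ev (bA a b) = bB (ev a) (ev b)"
proof -
  have "f (Const (bA a b)) = poly_bracket bB (f (Const a)) (f (Const b))"
    using f_bracket[of "Const a" "Const b"] unfolding A.poly_bracket_single by simp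
  then show ?thesis by (simp add: ev_def B.lookup_poly_bracket_0)
qed

lemma ev_centre: "z \<in> ZA \<Longrightarrow> ev z \<in> ZB"
  unfolding ev_def by (intro lookup_ZCB_0 f_centre) simp

text \<open>
  Let \<open>\<pi>\<close> be a candidate for an isomorphism.  A map \<open>r\<close> from \<open>A[t]\<close> to \<open>A\<close> through which evaluation
  at \<open>s = 0\<close> factors by \<open>\<pi>\<close> makes \<open>\<pi>\<close> surjective, and the restriction of \<open>r\<close> to the coefficients \<open>B\<close>
  is the candidate for its inverse.
\<close>

context
  fixes \<pi> :: "'a \<Rightarrow> 'b" and r :: "(nat, 'a) mpoly \<Rightarrow> 'a"
  assumes pi_hom: "hom_on UNIV \<pi>"
    and r_hom: "hom_on UNIV r"
    and comm: "\<And>p. p \<in> CA \<Longrightarrow> \<pi> (r p) = Poly_Mapping.lookup (f p) 0"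
    and pi_inj: "\<And>z. z \<in> ZA \<Longrightarrow> \<pi> z = 0 \<Longrightarrow> z = 0"
    and r_centre: "\<And>p. p \<in> ZCA \<Longrightarrow> r p \<in> ZA"
begin

interpretation pi: hom_on UNIV \<pi> by (rule pi_hom)
interpretation r: hom_on UNIV r by (rule r_hom)

text \<open>
  \<open>r\<close> factors through \<open>s = 0\<close> itself: it maps the central variable \<open>s\<^sub>j\<close> to a central element that
  \<open>\<pi>\<close> sends to zero.
\<close>

lemma r_g_ev: "q \<in> CB \<Longrightarrow> r (g (Const (Poly_Mapping.lookup q 0))) = r (g q)"
  unfolding polys_in_eq
proof (induction q rule: subring_of.polys_over_induct[OF subring_of_UNIV, consumes 1])
  case (2 j)
  then have "r (g (var j)) \<in> ZA" by (intro r_centre g_centre) auto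
  moreover have "\<pi> (r (g (var j))) = 0" using 2 comm[of "g (var j)"] by simp
  ultimately show ?case using pi_inj by simp
next
  case (3 p q)
  then show ?case
    by (simp add: lookup_add single_add g.h_add r.h_add flip: polys_in_eq)
next
  case (4 p q)
  then show ?case
    by (simp add: lookup_mult_0 Const_mult g.h_mult r.h_mult flip: polys_in_eq)
qed simp

lemma descend_hom: "hom_on UNIV (\<lambda>b. r (g (Const b)))"
  by unfold_locales (auto simp: single_add Const_mult g.h_add g.h_mult r.h_add r.h_mult)

lemma descend_fixes:
  assumes "\<pi> y = ev y" "r (Const y) = y"
  shows "r (g (Const (\<pi> y))) = y"
  using r_g_ev[of "f (Const y)"] assms by (simp add: ev_def)

lemma descend_fixes_centre:
  assumes "y \<in> ZA" "\<pi> y \<in> ZB"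
  shows "r (g (Const (\<pi> y))) = y"
proof -
  have "r (g (Const (\<pi> y))) \<in> ZA" using assms by (intro r_centre g_centre) auto
  moreover have "\<pi> (r (g (Const (\<pi> y)))) = \<pi> y" by (simp add: comm)
  ultimately show ?thesis
    using pi_inj[of "r (g (Const (\<pi> y))) - y"] assms(1) by (simp add: pi.h_diff ZA.diff_closed)
qed

lemma isomorphic_if_section:
  assumes "\<And>c a. \<pi> (sA c a) = sB c (\<pi> a)" "\<And>a b. \<pi> (bA a b) = bB (\<pi> a) (\<pi> b)"
    and left: "\<And>a. r (g (Const (\<pi> a))) = a"
  shows "poisson_isomorphic UNIV sA bA UNIV sB bB"
proof -
  have "surj \<pi>"
  proof (rule surjI)
    show "\<pi> (r (g (Const b))) = b" for b by (simp add: comm)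
  qed
  moreover have "inj \<pi>" by (metis left injI)
  ultimately show ?thesis
    unfolding poisson_isomorphic_def
    using assms by (intro exI[of _ \<pi>]) (auto simp: bij_def pi.h_add pi.h_mult)
qed

end

text \<open>
  The value of \<open>f t\<^sub>j\<close> at \<open>s = 0\<close> is central, hence the image of some \<open>c\<^sub>j\<close> in the centre of \<open>A\<close>;
  substituting \<open>c\<^sub>j\<close> for \<open>t\<^sub>j\<close> is the map \<open>r\<close> that inverts evaluation at \<open>s = 0\<close>.
\<close>

theorem isomorphic_if_centre_killed:
  assumes kill: "\<And>j z. j < n \<Longrightarrow> z \<in> ZA \<Longrightarrow> Ds j (Const z) = 0"
  shows "poisson_isomorphic UNIV sA bA UNIV sB bB"
proof -
  have "\<exists>z\<in>ZA. f (Const z) = Const (Poly_Mapping.lookup (f (var j)) 0)" if "j < n" for j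
    using that by (intro centres_correspond(2)[OF kill] lookup_ZCB_0 f_centre) auto
  then obtain c where c: "\<And>j. j < n \<Longrightarrow> c j \<in> ZA"
      "\<And>j. j < n \<Longrightarrow> f (Const (c j)) = Const (Poly_Mapping.lookup (f (var j)) 0)"
    by metis
  define r where "r = poly_eval (\<lambda>a :: 'a. a) c"
  have id: "hom_on UNIV (\<lambda>a :: 'a. a)" by unfold_locales auto
  have r_gen: "r (Const a) = a" "r (var j) = c j" for a j
    unfolding r_def by (simp_all add: hom_on.poly_eval_Const[OF id refl] hom_on.poly_eval_var[OF id refl])
  interpret r: hom_on UNIV r unfolding r_def by (rule hom_on.hom_poly_eval[OF id refl])
  have comm: "ev (r p) = Poly_Mapping.lookup (f p) 0" if "p \<in> CA" for p
    using that unfolding polys_in_eq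
  proof (induction p rule: subring_of.polys_over_induct[OF subring_of_UNIV, consumes 1])
    case (1 a)
    show ?case by (simp add: r_gen ev_def)
  next
    case (2 j)
    then show ?case using c(2)[of j] by (simp add: r_gen ev_def)
  next
    case (3 p q)
    then show ?case by (simp add: r.h_add ev.h_add f_add lookup_add flip: polys_in_eq)
  next
    case (4 p q)
    then show ?case by (simp add: r.h_mult ev.h_mult f_mult lookup_mult_0 flip: polys_in_eq)
  qed
  have inj: "z = 0" if "z \<in> ZA" "ev z = 0" for z
  proof -
    from centres_correspond(1)[OF kill that(1)] obtain w where "f (Const z) = Const w" by blast
    then have "f (Const z) = 0" using that(2) by (simp add: ev_def)
    then have "g (f (Const z)) = 0" by simp
    then have "Const z = (0 :: (nat, 'a) mpoly)" by (simp del: single_zero)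
    then show ?thesis by (metis Const_eq_iff single_zero)
  qed
  have rZ: "r p \<in> ZA" if "p \<in> ZCA" for p
    using that
    by (induction p rule: ZA.polys_over_induct) (auto simp: r_gen c(1) r.h_add r.h_mult)
  show ?thesis
  proof (rule isomorphic_if_section[OF ev.hom_on_axioms r.hom_on_axioms comm inj rZ])
    show "ev (sA k a) = sB k (ev a)" for k a by (rule ev_scale)
    show "ev (bA a b) = bB (ev a) (ev b)" for a b by (rule ev_bracket)
    show "r (g (Const (ev a))) = a" for a
      by (rule descend_fixes[OF ev.hom_on_axioms r.hom_on_axioms comm inj rZ])
        (auto simp: r_gen)
  qed
qed

end

section \<open>Cancellation for the affine line\<close>

lemma (in subring_of) det_closed:
  assumes "A \<in> carrier_mat n n" "\<And>i j. i < n \<Longrightarrow> j < n \<Longrightarrow> A $$ (i, j) \<in> C"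
  shows "det A \<in> C"
proof -
  have "(\<Prod>i = 0..<n. A $$ (i, p i)) \<in> C" if "p permutes {0..<n}" for p
    using that assms(2) by (intro prod_closed) (auto dest: permutes_in_image)
  then show ?thesis
    by (subst det_def'[OF assms(1)]) (auto intro!: sum_closed mult_closed)
qed

text \<open>
  The determinants of \<open>T\<close> and of \<open>S\<close>, each bordered by a unit vector, multiply to the determinant of a
  matrix that block elimination reduces to one entry of \<open>1 - S T\<close>.  So even over a ring this
  projection of rank one is a column times a row.
\<close>

lemma corank_one_projection:
  fixes T S :: "nat \<Rightarrow> nat \<Rightarrow> 'a::comm_ring_1"
  assumes C: "subring_of C"
    and T: "\<And>k a. k < n \<Longrightarrow> a < Suc n \<Longrightarrow> T k a \<in> C"
    and S: "\<And>k a. k < n \<Longrightarrow> a < Suc n \<Longrightarrow> S a k \<in> C"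
    and inv: "\<And>k l. k < n \<Longrightarrow> l < n \<Longrightarrow> (\<Sum>a<Suc n. T k a * S a l) = (if k = l then 1 else 0)"
  obtains u v where "\<And>a. u a \<in> C" "\<And>a. v a \<in> C"
    "\<And>a b. a < Suc n \<Longrightarrow> b < Suc n \<Longrightarrow>
      (if a = b then 1 else 0) - (\<Sum>k<n. S a k * T k b) = u a * v b"
proof -
  interpret subring_of C by fact
  define M1 where "M1 a = mat (Suc n) (Suc n) (\<lambda>(i, j).
    case i of 0 \<Rightarrow> (if j = a then 1 else 0) | Suc k \<Rightarrow> T k j)" for a
  define M2 where "M2 b = mat (Suc n) (Suc n) (\<lambda>(i, j).
    case j of 0 \<Rightarrow> (if i = b then 1 else 0) | Suc l \<Rightarrow> S i l)" for b
  define d where "d a b = (if a = b then 1 else 0) - (\<Sum>k<n. S a k * T k b)" for a b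
  define U where "U a = mat (Suc n) (Suc n) (\<lambda>(i, j).
    if i = j then 1 else if i = 0 then S a (j - 1) else 0)" for a
  define L where "L a b = mat (Suc n) (Suc n) (\<lambda>(i, j).
    if i = 0 \<and> j = 0 then d a b else if i = j then 1 else if j = 0 then T (i - 1) b else 0)" for a b
  have car: "M1 a \<in> carrier_mat (Suc n) (Suc n)" "M2 b \<in> carrier_mat (Suc n) (Suc n)"
    "U a \<in> carrier_mat (Suc n) (Suc n)" "L a b \<in> carrier_mat (Suc n) (Suc n)" for a b
    by (auto simp: M1_def M2_def U_def L_def)
  \<comment> \<open>Block elimination: \<open>d a b\<close> is the Schur complement of the identity block of \<open>M1 a * M2 b\<close>.\<close>
  have prod: "M1 a * M2 b = U a * L a b" if ab: "a < Suc n" "b < Suc n" for a b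
  proof (rule eq_matI)
    fix i j assume "i < dim_row (U a * L a b)" "j < dim_col (U a * L a b)"
    then have ij: "i < Suc n" "j < Suc n" by (auto simp: U_def L_def)
    have l: "(M1 a * M2 b) $$ (i, j) = (\<Sum>m<Suc n. M1 a $$ (i, m) * M2 b $$ (m, j))"
      using ij car by (simp add: scalar_prod_def atLeast0LessThan M1_def M2_def)
    have r: "(U a * L a b) $$ (i, j) = (\<Sum>m<Suc n. U a $$ (i, m) * L a b $$ (m, j))"
      using ij car by (simp add: scalar_prod_def atLeast0LessThan U_def L_def)
    show "(M1 a * M2 b) $$ (i, j) = (U a * L a b) $$ (i, j)"
    proof (cases i; cases j)
      assume "i = 0" "j = 0"
      have "(\<Sum>m<Suc n. M1 a $$ (0, m) * M2 b $$ (m, 0)) =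
          (\<Sum>m<Suc n. if m = a then if a = b then 1 else 0 else 0)"
        by (intro sum.cong) (auto simp: M1_def M2_def)
      also have "\<dots> = (if a = b then 1 else 0)"
        using ab by (subst sum.delta) auto
      finally have "(\<Sum>m<Suc n. M1 a $$ (0, m) * M2 b $$ (m, 0)) = (if a = b then 1 else 0)" .
      moreover have "(\<Sum>m<Suc n. U a $$ (0, m) * L a b $$ (m, 0)) = (if a = b then 1 else 0)"
        unfolding sum.lessThan_Suc_shift by (simp add: U_def L_def d_def)
      ultimately show ?thesis unfolding l r unfolding \<open>i = 0\<close> \<open>j = 0\<close> by (simp only:)
    next
      fix j' assume i: "i = 0" and j: "j = Suc j'"
      have "(\<Sum>m<Suc n. M1 a $$ (0, m) * M2 b $$ (m, j)) = (\<Sum>m<Suc n. if m = a then S a j' else 0)"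
        using ij j by (intro sum.cong) (auto simp: M1_def M2_def)
      moreover have "(\<Sum>m<Suc n. U a $$ (0, m) * L a b $$ (m, j)) =
          (\<Sum>m<Suc n. if m = j then S a j' else 0)"
        using ij j by (intro sum.cong) (auto simp: U_def L_def)
      ultimately show ?thesis unfolding l r unfolding i using ab ij by (simp only: sum.delta) simp
    next
      fix i' assume i: "i = Suc i'" and j: "j = 0"
      have "(\<Sum>m<Suc n. M1 a $$ (i, m) * M2 b $$ (m, 0)) = (\<Sum>m<Suc n. if m = b then T i' b else 0)"
        using ij i by (intro sum.cong) (auto simp: M1_def M2_def)
      moreover have "(\<Sum>m<Suc n. U a $$ (i, m) * L a b $$ (m, 0)) =
          (\<Sum>m<Suc n. if m = i then T i' b else 0)"
        using ij i by (intro sum.cong) (auto simp: U_def L_def)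
      ultimately show ?thesis unfolding l r unfolding j using ab ij by (simp only: sum.delta) simp
    next
      fix i' j' assume i: "i = Suc i'" and j: "j = Suc j'"
      have "(\<Sum>m<Suc n. M1 a $$ (i, m) * M2 b $$ (m, j)) = (\<Sum>m<Suc n. T i' m * S m j')"
        using ij i j by (intro sum.cong) (auto simp: M1_def M2_def)
      also have "\<dots> = (if i = j then 1 else 0)" using inv[of i' j'] ij i j by simp
      finally have "(\<Sum>m<Suc n. M1 a $$ (i, m) * M2 b $$ (m, j)) = (if i = j then 1 else 0)" .
      moreover have "(\<Sum>m<Suc n. U a $$ (i, m) * L a b $$ (m, j)) =
          (\<Sum>m<Suc n. if m = i then if i = j then 1 else 0 else 0)"
        using ij i j by (intro sum.cong) (auto simp: U_def L_def)
      ultimately show ?thesis unfolding l r using ij by (simp only: sum.delta) simp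
    qed
  qed (auto simp: M1_def M2_def U_def L_def)
  have detU: "det (U a) = 1" for a
  proof -
    have "upper_triangular (U a)" by (auto simp: U_def)
    from det_upper_triangular[OF this car(3)] have "det (U a) = prod_list (diag_mat (U a))" .
    also have "diag_mat (U a) = map (\<lambda>_. 1) [0..<Suc n]"
      unfolding diag_mat_def by (intro map_cong) (auto simp: U_def)
    also have "prod_list \<dots> = 1" by (induction n) auto
    finally show ?thesis .
  qed
  have detL: "det (L a b) = d a b" for a b
  proof -
    have "det (L a b) = prod_list (diag_mat (L a b))"
      by (rule det_lower_triangular[OF _ car(4)]) (auto simp: L_def)
    also have "diag_mat (L a b) = d a b # map (\<lambda>_. 1) [0..<n]"
      unfolding diag_mat_def
      by (intro nth_equalityI) (auto simp: L_def nth_Cons split: nat.split simp del: upt_Suc)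
    also have "prod_list \<dots> = d a b" by (induction n) auto
    finally show ?thesis .
  qed
  have d: "d a b = det (M1 a) * det (M2 b)" if "a < Suc n" "b < Suc n" for a b
    using det_mult[OF car(1,2), of a b] det_mult[OF car(3,4), of a a b]
    by (simp add: prod that detU detL)
  show ?thesis
  proof (rule that)
    show "det (M1 a) \<in> C" for a
      by (rule det_closed[OF car(1)]) (auto simp: M1_def T split: nat.split)
    show "det (M2 b) \<in> C" for b
      by (rule det_closed[OF car(2)]) (auto simp: M2_def S split: nat.split)
  qed (use d in \<open>simp add: d_def\<close>)
qed

text \<open>
  \<open>P\<close> is a polynomial ring over the field \<open>\<kappa>\<close> in \<open>X\<^sub>0, \<dots>, X\<^sub>n\<close> with partial derivatives \<open>E\<^sub>a\<close>, and at the
  same time a polynomial ring over the image \<open>R\<close> of the retraction \<open>\<rho>\<close> in the \<open>n\<close> variables \<open>s\<^sub>k\<close>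
  with partial derivatives \<open>D\<^sub>k\<close>.  Only this interplay is recorded, so that \<open>P\<close> can be any subring
  of a larger domain.
\<close>

locale line_retract =
  subring_of P + kap: hom_on UNIV \<kappa> + rho: hom_on P \<rho>
  for P :: "'p::{idom,ring_char_0} set" and \<kappa> :: "'k::field_char_0 \<Rightarrow> 'p" and \<rho> :: "'p \<Rightarrow> 'p" +
  fixes n :: nat and X s :: "nat \<Rightarrow> 'p" and E D :: "nat \<Rightarrow> 'p \<Rightarrow> 'p"
  assumes kap_closed [simp]: "\<kappa> c \<in> P"
    and X_closed [simp]: "a < Suc n \<Longrightarrow> X a \<in> P"
    and s_closed [simp]: "k < n \<Longrightarrow> s k \<in> P"
    and rho_closed [simp]: "p \<in> P \<Longrightarrow> \<rho> p \<in> P"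
    and rho_idem [simp]: "p \<in> P \<Longrightarrow> \<rho> (\<rho> p) = \<rho> p"
    and rho_kap [simp]: "\<rho> (\<kappa> c) = \<kappa> c"
    and E_der: "a < Suc n \<Longrightarrow> derivation P (E a)"
    and D_der: "k < n \<Longrightarrow> derivation P (D k)"
    and E_kap [simp]: "a < Suc n \<Longrightarrow> E a (\<kappa> c) = 0"
    and D_kap [simp]: "k < n \<Longrightarrow> D k (\<kappa> c) = 0"
    and E_X: "a < Suc n \<Longrightarrow> b < Suc n \<Longrightarrow> E a (X b) = (if a = b then 1 else 0)"
    and D_s: "k < n \<Longrightarrow> l < n \<Longrightarrow> D k (s l) = (if k = l then 1 else 0)"
    and D_rho: "k < n \<Longrightarrow> p \<in> P \<Longrightarrow> D k (\<rho> p) = 0"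
    and E_kernel: "p \<in> P \<Longrightarrow> (\<And>a. a < Suc n \<Longrightarrow> E a p = 0) \<Longrightarrow> p \<in> range \<kappa>"
    and X_induct: "p \<in> P \<Longrightarrow> (\<And>c. Q (\<kappa> c)) \<Longrightarrow> (\<And>a. a < Suc n \<Longrightarrow> Q (X a)) \<Longrightarrow>
      (\<And>p q. p \<in> P \<Longrightarrow> q \<in> P \<Longrightarrow> Q p \<Longrightarrow> Q q \<Longrightarrow> Q (p + q)) \<Longrightarrow>
      (\<And>p q. p \<in> P \<Longrightarrow> q \<in> P \<Longrightarrow> Q p \<Longrightarrow> Q q \<Longrightarrow> Q (p * q)) \<Longrightarrow> Q p"
    and s_induct: "p \<in> P \<Longrightarrow> (\<And>w. w \<in> P \<Longrightarrow> \<rho> w = w \<Longrightarrow> Q w) \<Longrightarrow> (\<And>k. k < n \<Longrightarrow> Q (s k)) \<Longrightarrow>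
      (\<And>p q. p \<in> P \<Longrightarrow> q \<in> P \<Longrightarrow> Q p \<Longrightarrow> Q q \<Longrightarrow> Q (p + q)) \<Longrightarrow>
      (\<And>p q. p \<in> P \<Longrightarrow> q \<in> P \<Longrightarrow> Q p \<Longrightarrow> Q q \<Longrightarrow> Q (p * q)) \<Longrightarrow> Q p"
begin

definition R :: "'p set" where "R = {w \<in> P. \<rho> w = w}"

lemma R_P: "w \<in> R \<Longrightarrow> w \<in> P" and R_rho: "w \<in> R \<Longrightarrow> \<rho> w = w"
  by (auto simp: R_def)

lemma R_kap [simp]: "\<kappa> c \<in> R"
  by (simp add: R_def)

lemma rho_in_R [simp]: "p \<in> P \<Longrightarrow> \<rho> p \<in> R"
  by (simp add: R_def)

sublocale R: subring_of R
  by unfold_locales (auto simp: R_def rho.h_diff rho.h_mult)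

lemma E_closed [simp]: "a < Suc n \<Longrightarrow> p \<in> P \<Longrightarrow> E a p \<in> P"
  by (rule derivation.D_closed[OF E_der])

lemma E_one [simp]: "a < Suc n \<Longrightarrow> E a 1 = 0"
  by (rule derivation.D_one[OF E_der])

lemmas E_add = derivation.D_add[OF E_der]
lemmas E_mult = derivation.D_mult[OF E_der]
lemmas D_add = derivation.D_add[OF D_der]
lemmas D_mult = derivation.D_mult[OF D_der]

lemma E_locally_nilpotent:
  assumes a: "a < Suc n"
  shows "locally_nilpotent P (E a)"
proof -
  interpret E: derivation P "E a" by (rule E_der[OF a])
  show ?thesis
  proof
    fix p assume "p \<in> P"
    then show "E.nil p"
    proof (induction rule: X_induct[consumes 1])
      fix c
      have "(E a ^^ 1) (\<kappa> c) = 0" using a by simp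
      then show "E.nil (\<kappa> c)" unfolding E.nil_def by blast
    next
      fix b assume "b < Suc n"
      then have "(E a ^^ 2) (X b) = 0" using a by (simp add: numeral_2_eq_2 E_X)
      then show "E.nil (X b)" unfolding E.nil_def by blast
    qed (auto intro: E.nil_add E.nil_mult)
  qed
qed

lemma chain_D:
  assumes "k < n" "p \<in> P"
  shows "D k p = (\<Sum>a<Suc n. D k (X a) * E a p)"
  using assms(2)
proof (induction rule: X_induct[consumes 1])
  fix p q assume pq: "p \<in> P" "q \<in> P" and IH: "D k p = (\<Sum>a<Suc n. D k (X a) * E a p)"
    "D k q = (\<Sum>a<Suc n. D k (X a) * E a q)"
  show "D k (p + q) = (\<Sum>a<Suc n. D k (X a) * E a (p + q))"
    unfolding D_add[OF assms(1) pq] IH sum.distrib[symmetric]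
    using pq by (intro sum.cong) (auto simp: E_add algebra_simps)
  show "D k (p * q) = (\<Sum>a<Suc n. D k (X a) * E a (p * q))"
    unfolding D_mult[OF assms(1) pq] IH sum_distrib_left sum_distrib_right sum.distrib[symmetric]
    using pq by (intro sum.cong) (auto simp: E_mult algebra_simps)
next
  fix b assume b: "b < Suc n"
  have "(\<Sum>a<Suc n. D k (X a) * E a (X b)) = (\<Sum>a<Suc n. if a = b then D k (X b) else 0)"
    using b by (intro sum.cong) (auto simp: E_X)
  then show "D k (X b) = (\<Sum>a<Suc n. D k (X a) * E a (X b))"
    using b by (simp only: sum.delta) simp
qed (use assms in \<open>simp del: sum.lessThan_Suc\<close>)

lemma chain_rho:
  assumes "a < Suc n" "p \<in> P"
  shows "E a (\<rho> p) = (\<Sum>b<Suc n. \<rho> (E b p) * E a (\<rho> (X b)))"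
  using assms(2)
proof (induction rule: X_induct[consumes 1])
  fix p q assume pq: "p \<in> P" "q \<in> P" and
    IH: "E a (\<rho> p) = (\<Sum>b<Suc n. \<rho> (E b p) * E a (\<rho> (X b)))"
    "E a (\<rho> q) = (\<Sum>b<Suc n. \<rho> (E b q) * E a (\<rho> (X b)))"
  show "E a (\<rho> (p + q)) = (\<Sum>b<Suc n. \<rho> (E b (p + q)) * E a (\<rho> (X b)))"
    unfolding rho.h_add[OF pq] E_add[OF assms(1) rho_closed[OF pq(1)] rho_closed[OF pq(2)]]
      IH sum.distrib[symmetric]
    using pq by (intro sum.cong) (auto simp: E_add rho.h_add algebra_simps)
  show "E a (\<rho> (p * q)) = (\<Sum>b<Suc n. \<rho> (E b (p * q)) * E a (\<rho> (X b)))"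
    unfolding rho.h_mult[OF pq] E_mult[OF assms(1) rho_closed[OF pq(1)] rho_closed[OF pq(2)]]
      IH sum_distrib_left sum_distrib_right sum.distrib[symmetric]
    using pq
    by (intro sum.cong) (auto simp: E_mult rho.h_add rho.h_mult mult_closed algebra_simps)
next
  fix b assume b: "b < Suc n"
  have "(\<Sum>c<Suc n. \<rho> (E c (X b)) * E a (\<rho> (X c))) = (\<Sum>c<Suc n. if c = b then E a (\<rho> (X b)) else 0)"
    using b by (intro sum.cong) (auto simp: E_X)
  then show "E a (\<rho> (X b)) = (\<Sum>c<Suc n. \<rho> (E c (X b)) * E a (\<rho> (X c)))"
    using b by (simp only: sum.delta) simp
qed (use assms in \<open>simp del: sum.lessThan_Suc\<close>)

text \<open>
  Otherwise \<open>P\<close> would be a polynomial ring in the \<open>n\<close> variables \<open>s\<^sub>k\<close> alone.  The two Jacobian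
  matrices between the \<open>s\<^sub>k\<close> and the \<open>n + 1\<close> variables \<open>X\<^sub>a\<close> would be inverse to each other, and the
  traces of their two products are \<open>n\<close> and \<open>n + 1\<close>.
\<close>

lemma R_not_constants: "\<exists>w\<in>R. w \<notin> range \<kappa>"
proof (rule ccontr)
  assume "\<not> ?thesis"
  then have const: "w \<in> R \<Longrightarrow> w \<in> range \<kappa>" for w by blast
  have E: "E a p = (\<Sum>k<n. E a (s k) * D k p)" if a: "a < Suc n" and p: "p \<in> P" for a p
    using p
  proof (induction rule: s_induct[consumes 1])
        fix w assume "w \<in> P" "\<rho> w = w"
    then have "w \<in> range \<kappa>" using const by (auto simp: R_def)
    then show "E a w = (\<Sum>k<n. E a (s k) * D k w)" using a by auto
  next
    fix p q assume pq: "p \<in> P" "q \<in> P" and IH: "E a p = (\<Sum>k<n. E a (s k) * D k p)"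
      "E a q = (\<Sum>k<n. E a (s k) * D k q)"
    show "E a (p + q) = (\<Sum>k<n. E a (s k) * D k (p + q))"
      unfolding E_add[OF a pq] IH sum.distrib[symmetric]
      using pq by (intro sum.cong) (auto simp: D_add algebra_simps)
    show "E a (p * q) = (\<Sum>k<n. E a (s k) * D k (p * q))"
      unfolding E_mult[OF a pq] IH sum_distrib_left sum_distrib_right sum.distrib[symmetric]
      using pq by (intro sum.cong) (auto simp: D_mult algebra_simps)
  next
    fix l assume l: "l < n"
    have "(\<Sum>k<n. E a (s k) * D k (s l)) = (\<Sum>k<n. if k = l then E a (s l) else 0)"
      using l by (intro sum.cong) (auto simp: D_s)
    then show "E a (s l) = (\<Sum>k<n. E a (s k) * D k (s l))"
      using l by simp
  qed
  have "of_nat (Suc n) = (\<Sum>a<Suc n. E a (X a))" by (simp add: E_X)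
  also have "\<dots> = (\<Sum>a<Suc n. \<Sum>k<n. E a (s k) * D k (X a))"
    by (intro sum.cong) (auto intro!: E)
  also have "\<dots> = (\<Sum>k<n. \<Sum>a<Suc n. D k (X a) * E a (s k))"
    by (subst sum.swap) (simp add: mult.commute)
  also have "\<dots> = (\<Sum>k<n. D k (s k))"
    by (intro sum.cong) (auto simp: chain_D simp del: sum.lessThan_Suc)
  also have "\<dots> = of_nat n" by (simp add: D_s)
  finally show False by (simp only: of_nat_eq_iff)
qed

text \<open>
  The \<open>D\<^sub>k\<close> kill \<open>R\<close>.  By the chain rule the gradients of elements of \<open>R\<close> are therefore fixed by the
  projection \<open>1 - S T\<close>, where \<open>S\<close> and \<open>T\<close> are the Jacobian matrices between the \<open>s\<^sub>k\<close> and the \<open>X\<^sub>a\<close>.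
  That projection is a column times a row, so all these gradients have the direction of the column.
\<close>

lemma gradient_on_R:
  obtains \<delta> v where "derivation R \<delta>" "\<And>a. a < Suc n \<Longrightarrow> v a \<in> P"
    "\<And>a w. a < Suc n \<Longrightarrow> w \<in> R \<Longrightarrow> E a w = \<delta> w * v a"
proof -
  have inv: "(\<Sum>a<Suc n. D k (X a) * E a (s l)) = (if k = l then 1 else 0)"
    if "k < n" "l < n" for k l
    using chain_D[of k "s l"] that by (simp add: D_s)
  have D_closed: "k < n \<Longrightarrow> p \<in> P \<Longrightarrow> D k p \<in> P" for k p
    by (rule derivation.D_closed[OF D_der])
  obtain u t where u: "\<And>a. u a \<in> P" and t: "\<And>a. t a \<in> P"
    and proj: "\<And>a b. a < Suc n \<Longrightarrow> b < Suc n \<Longrightarrow>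
      (if a = b then 1 else 0) - (\<Sum>k<n. E a (s k) * D k (X b)) = u a * t b"
    by (rule corank_one_projection[OF subring_of_axioms, of n "\<lambda>k a. D k (X a)" "\<lambda>a k. E a (s k)"])
      (auto simp: inv D_closed simp del: sum.lessThan_Suc)
  define J where "J w = (\<Sum>b<Suc n. t b * E b w)" for w
  have J_closed: "J w \<in> P" if "w \<in> P" for w
    unfolding J_def using that t by (intro sum_closed) auto
  have grad: "E a w = u a * J w" if "a < Suc n" "w \<in> R" for a w
  proof -
    have Dw: "D k w = 0" if "k < n" for k
      using D_rho[OF that, of w] \<open>w \<in> R\<close> by (simp add: R_P R_rho)
    have "u a * J w = (\<Sum>b<Suc n. (u a * t b) * E b w)"
      by (simp add: J_def sum_distrib_left mult.assoc del: sum.lessThan_Suc)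
    also have "\<dots> = (\<Sum>b<Suc n. ((if a = b then 1 else 0) -
        (\<Sum>k<n. E a (s k) * D k (X b))) * E b w)"
      using proj[OF that(1)] by (intro sum.cong) auto
    also have "\<dots> = (\<Sum>b<Suc n. (if a = b then E b w else 0) -
        (\<Sum>k<n. E a (s k) * (D k (X b) * E b w)))"
      by (intro sum.cong) (auto simp: left_diff_distrib sum_distrib_right mult.assoc)
    also have "\<dots> = (\<Sum>b<Suc n. if a = b then E b w else 0) -
        (\<Sum>b<Suc n. \<Sum>k<n. E a (s k) * (D k (X b) * E b w))"
      by (rule sum_subtractf)
    also have "(\<Sum>b<Suc n. \<Sum>k<n. E a (s k) * (D k (X b) * E b w)) =
        (\<Sum>k<n. E a (s k) * (\<Sum>b<Suc n. D k (X b) * E b w))"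
      by (subst sum.swap) (simp add: sum_distrib_left del: sum.lessThan_Suc)
    also have "\<dots> = 0"
      using Dw chain_D[OF _ R_P[OF that(2)]] by (simp del: sum.lessThan_Suc)
    also have "(\<Sum>b<Suc n. if a = b then E b w else 0) = E a w"
      using that(1) by (simp del: sum.lessThan_Suc)
    finally show ?thesis by simp
  qed
  \<comment> \<open>The factor \<open>J w\<close> need not lie in \<open>R\<close>.  Writing \<open>w = \<rho> w\<close> and applying the chain rule once more
    replaces it by \<open>\<rho> (J w)\<close>, at the cost of another fixed vector.\<close>
  define \<delta> where "\<delta> w = \<rho> (J w)" for w
  define v where "v a = (\<Sum>b<Suc n. \<rho> (u b) * E a (\<rho> (X b)))" for a
  have J_add: "J (x + y) = J x + J y" if "x \<in> P" "y \<in> P" for x y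
    unfolding J_def sum.distrib[symmetric]
    using that by (intro sum.cong) (auto simp: E_add algebra_simps)
  have J_mult: "J (x * y) = J x * y + x * J y" if "x \<in> P" "y \<in> P" for x y
    unfolding J_def sum_distrib_left sum_distrib_right sum.distrib[symmetric]
    using that by (intro sum.cong) (auto simp: E_mult algebra_simps)
  show ?thesis
  proof (rule that)
    show "derivation R \<delta>"
      by unfold_locales
        (auto simp: \<delta>_def J_add J_mult J_closed R_P rho.h_add rho.h_mult mult_closed R_rho)
    show "v a \<in> P" if "a < Suc n" for a
      unfolding v_def using that by (intro sum_closed) (auto simp: u)
    show "E a w = \<delta> w * v a" if "a < Suc n" "w \<in> R" for a w
    proof -
      have "E a w = E a (\<rho> w)" using that by (simp add: R_rho)
      also have "\<dots> = (\<Sum>b<Suc n. \<rho> (E b w) * E a (\<rho> (X b)))"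
        using that by (intro chain_rho) (auto simp: R_P)
      also have "\<dots> = (\<Sum>b<Suc n. (\<rho> (u b) * \<rho> (J w)) * E a (\<rho> (X b)))"
        using grad that(2) by (intro sum.cong) (auto simp: u J_closed R_P rho.h_mult)
      also have "\<dots> = \<delta> w * v a"
        unfolding v_def \<delta>_def sum_distrib_left by (intro sum.cong) (auto simp: algebra_simps)
      finally show ?thesis .
    qed
  qed
qed

text \<open>
  Since \<open>E\<^sub>a w = \<delta> w * v\<^sub>a\<close>, the derivation \<open>\<delta>\<close> lowers the nilpotency order with respect to \<open>E\<^sub>a\<close>.  An
  element \<open>\<gamma>\<close> of least positive order therefore has constant nonzero \<open>\<delta> \<gamma>\<close>, and every element of
  \<open>R\<close> is found by integrating its \<open>\<delta>\<close>-derivative as a polynomial in \<open>\<gamma>\<close>.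
\<close>

theorem R_is_polynomial_ring:
  obtains \<gamma> where "\<gamma> \<in> R"
    "\<And>w. w \<in> R \<Longrightarrow> \<exists>N c. w = (\<Sum>i<N. \<kappa> (c i) * \<gamma> ^ i)"
    "\<And>N c i. (\<Sum>i<N. \<kappa> (c i) * \<gamma> ^ i) = 0 \<Longrightarrow> i < N \<Longrightarrow> c i = 0"
proof -
  obtain \<delta> v where der: "derivation R \<delta>" and v: "\<And>a. a < Suc n \<Longrightarrow> v a \<in> P"
    and grad: "\<And>a w. a < Suc n \<Longrightarrow> w \<in> R \<Longrightarrow> E a w = \<delta> w * v a"
    by (rule gradient_on_R) blast
  interpret \<delta>: derivation R \<delta> by (rule der)
  obtain w0 where w0: "w0 \<in> R" "w0 \<notin> range \<kappa>" using R_not_constants by blast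
  then obtain a where a: "a < Suc n" "E a w0 \<noteq> 0" using E_kernel[of w0] by (auto simp: R_P)
  interpret E: locally_nilpotent P "E a" by (rule E_locally_nilpotent[OF a(1)])
  have va: "v a \<noteq> 0" using a grad[OF a(1) w0(1)] by auto
  have kernel: "w \<in> range \<kappa>" if "w \<in> R" "\<delta> w = 0" for w
    using that by (intro E_kernel) (auto simp: R_P grad)
  have kap_zero: "\<delta> (\<kappa> c) = 0" for c
    using grad[OF a(1), of "\<kappa> c"] a(1) va by simp
  have kap_inj: "c = 0" if "\<kappa> c = 0" for c
  proof (rule ccontr)
    assume "c \<noteq> 0"
    then have "\<kappa> c * \<kappa> (inverse c) = 1" by (simp flip: kap.h_mult)
    with that show False by simp
  qed
  have lower: "E.ndeg (\<delta> w) < E.ndeg w" if "w \<in> R" "\<delta> w \<noteq> 0" for w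
  proof -
    have "E a w = \<delta> w * v a" using grad[OF a(1) that(1)] .
    then have "E.ndeg w = Suc (E.ndeg (\<delta> w * v a))"
      using that va E.ndeg_D[OF R_P[OF that(1)]] by simp
    also have "E.ndeg (\<delta> w * v a) = E.ndeg (\<delta> w) + E.ndeg (v a)"
      using that va v[OF a(1)] by (intro E.ndeg_mult) (auto simp: R_P)
    finally show ?thesis by simp
  qed
  have "w0 \<in> R \<and> \<delta> w0 \<noteq> 0" using w0 kernel by auto
  from ex_has_least_nat[of "\<lambda>w. w \<in> R \<and> \<delta> w \<noteq> 0", OF this, of E.ndeg]
  obtain \<gamma> where \<gamma>: "\<gamma> \<in> R" "\<delta> \<gamma> \<noteq> 0"
    and least: "\<And>w. w \<in> R \<Longrightarrow> \<delta> w \<noteq> 0 \<Longrightarrow> E.ndeg \<gamma> \<le> E.ndeg w" by auto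
  have "\<delta> (\<delta> \<gamma>) = 0"
    using least[of "\<delta> \<gamma>"] lower[of \<gamma>] \<gamma> by fastforce
  then obtain e where e: "\<delta> \<gamma> = \<kappa> e" using kernel[of "\<delta> \<gamma>"] \<gamma> by auto
  then have "e \<noteq> 0" using \<gamma> by auto
  have of_nat: "\<kappa> (of_nat m) = of_nat m" for m by (rule kap.h_of_nat) simp
  have \<delta>_term: "\<delta> (\<kappa> c * \<gamma> ^ Suc i) = \<kappa> (c * of_nat (Suc i) * e) * \<gamma> ^ i" for c i
    using \<gamma>(1) by (simp add: \<delta>.D_mult kap_zero \<delta>.D_power e kap.h_mult of_nat algebra_simps
        del: power_Suc of_nat_Suc)
  show ?thesis
  proof (rule that)
    show "\<gamma> \<in> R" by (rule \<gamma>(1))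
    show "\<exists>N c. w = (\<Sum>i<N. \<kappa> (c i) * \<gamma> ^ i)" if "w \<in> R" for w
      using that
    proof (induction "E.ndeg w" arbitrary: w rule: less_induct)
      case less
      have const: "\<exists>N c. w = (\<Sum>i<N. \<kappa> (c i) * \<gamma> ^ i)"
        if "w - (\<Sum>i<N. \<kappa> (c i) * \<gamma> ^ Suc i) \<in> range \<kappa>" for N c
      proof -
        from that obtain c0 where "w - (\<Sum>i<N. \<kappa> (c i) * \<gamma> ^ Suc i) = \<kappa> c0" by blast
        then have "w = (\<Sum>i<Suc N. \<kappa> (case i of 0 \<Rightarrow> c0 | Suc i \<Rightarrow> c i) * \<gamma> ^ i)"
          unfolding sum.lessThan_Suc_shift by (simp add: algebra_simps)
        then show ?thesis by blast
      qed
      show ?case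
      proof (cases "\<delta> w = 0")
        case True
        with const[of "\<lambda>_. 0" 0] kernel[OF less.prems] show ?thesis by simp
      next
        case False
        from less.hyps[OF lower[OF less.prems False]] less.prems obtain N c
          where c: "\<delta> w = (\<Sum>i<N. \<kappa> (c i) * \<gamma> ^ i)" by auto
        define b where "b i = c i / (of_nat (Suc i) * e)" for i
        have b: "b i * of_nat (Suc i) * e = c i" for i
          using \<open>e \<noteq> 0\<close> of_nat_neq_0[of i] unfolding b_def by (simp del: of_nat_Suc)
        let ?q = "\<Sum>i<N. \<kappa> (b i) * \<gamma> ^ Suc i"
        have q: "?q \<in> R" using \<gamma>(1) by (intro R.sum_closed) auto
        have "\<delta> ?q = (\<Sum>i<N. \<delta> (\<kappa> (b i) * \<gamma> ^ Suc i))"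
          using \<gamma>(1) by (intro \<delta>.D_sum) auto
        also have "\<dots> = \<delta> w" unfolding c \<delta>_term b ..
        finally have "\<delta> (w - ?q) = 0" using q less.prems by (simp add: \<delta>.D_diff)
        then show ?thesis using q less.prems by (intro const kernel) auto
      qed
    qed
    show "c i = 0" if "(\<Sum>i<N. \<kappa> (c i) * \<gamma> ^ i) = 0" "i < N" for N c i
      using that
    proof (induction N arbitrary: c i)
      case (Suc N)
      have eq: "\<kappa> (c 0) + (\<Sum>i<N. \<kappa> (c (Suc i)) * \<gamma> ^ Suc i) = 0"
        using Suc.prems(1) unfolding sum.lessThan_Suc_shift by simp
      have "(\<Sum>i<N. \<delta> (\<kappa> (c (Suc i)) * \<gamma> ^ Suc i)) = \<delta> (\<Sum>i<N. \<kappa> (c (Suc i)) * \<gamma> ^ Suc i)"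
        using \<gamma>(1) by (intro \<delta>.D_sum[symmetric]) auto
      also have "\<dots> = \<delta> (\<kappa> (c 0) + (\<Sum>i<N. \<kappa> (c (Suc i)) * \<gamma> ^ Suc i))"
        using \<gamma>(1) by (subst \<delta>.D_add) (auto simp: kap_zero intro!: R.sum_closed)
      also have "\<dots> = 0" unfolding eq by simp
      finally have "(\<Sum>i<N. \<kappa> (c (Suc i) * of_nat (Suc i) * e) * \<gamma> ^ i) = 0"
        unfolding \<delta>_term .
      from Suc.IH[OF this] have tail: "c (Suc i) = 0" if "i < N" for i
        using that \<open>e \<noteq> 0\<close> of_nat_neq_0[of i] by (simp del: of_nat_Suc)
      with eq have "c 0 = 0" by (intro kap_inj) simp
      with tail Suc.prems(2) show ?case by (cases i) auto
    qed simp
  qed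
qed

end

section \<open>Quadratic Poisson brackets in three variables\<close>

subsection \<open>Homogeneous polynomials\<close>

lemma UNIV_three: "(UNIV :: 3 set) = {0, 1, 2}"
proof -
  have "card {0, 1, 2 :: 3} = 3" by simp
  then show ?thesis by (intro card_subset_eq[symmetric]) auto
qed

lemma sum_three: "(\<Sum>i\<in>(UNIV :: 3 set). h i) = h 0 + h 1 + h 2"
  unfolding UNIV_three by (simp add: add.assoc)

lemma all_three: "(\<forall>i :: 3. Q i) \<longleftrightarrow> Q 0 \<and> Q 1 \<and> Q 2"
  using UNIV_three by (metis UNIV_I insertE singletonD)

lemma total_deg_eq: "total_deg (m :: 'v::finite \<Rightarrow>\<^sub>0 nat) = (\<Sum>i\<in>UNIV. Poly_Mapping.lookup m i)"
  unfolding total_deg_def by (intro sum.mono_neutral_left) (auto simp: in_keys_iff)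

lemma total_deg_add: "total_deg (m + m' :: 'v::finite \<Rightarrow>\<^sub>0 nat) = total_deg m + total_deg m'"
  by (simp add: total_deg_eq lookup_add sum.distrib)

lemma total_deg_single [simp]: "total_deg (Poly_Mapping.single j k :: 'v::finite \<Rightarrow>\<^sub>0 nat) = k"
  by (simp add: total_deg_eq lookup_single when_def)

lemma total_deg_0_iff [simp]: "total_deg (m :: 'v::finite \<Rightarrow>\<^sub>0 nat) = 0 \<longleftrightarrow> m = 0"
  by (auto simp: total_deg_eq poly_mapping_eq_iff fun_eq_iff)

definition hcomp :: "nat \<Rightarrow> ('v, 'a::comm_ring_1) mpoly \<Rightarrow> ('v, 'a) mpoly" where
  "hcomp d p = Poly_Mapping.mapp (\<lambda>m a. a when total_deg m = d) p"

lemma lookup_hcomp: "Poly_Mapping.lookup (hcomp d p) m = (Poly_Mapping.lookup p m when total_deg m = d)"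
  by (simp add: hcomp_def lookup_mapp in_keys_iff when_def)

lemma hcomp_add: "hcomp d (p + q) = hcomp d p + hcomp d q"
  by (rule poly_mapping_eqI) (simp add: lookup_hcomp lookup_add when_def)

lemma hcomp_0 [simp]: "hcomp d 0 = 0"
  by (rule poly_mapping_eqI) (simp add: lookup_hcomp)

lemma hcomp_single: "hcomp d (Poly_Mapping.single m a) = (Poly_Mapping.single m a when total_deg m = d)"
  by (rule poly_mapping_eqI) (auto simp: lookup_hcomp lookup_single when_def)

lemma homogeneous_hcomp: "homogeneous d (hcomp d p)"
  by (auto simp: homogeneous_def lookup_hcomp in_keys_iff when_def split: if_splits)

lemma hcomp_homogeneous: "homogeneous d p \<Longrightarrow> hcomp e p = (p when d = e)"
  by (rule poly_mapping_eqI) (auto simp: lookup_hcomp homogeneous_def in_keys_iff when_def)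

lemma sum_hcomp: "\<exists>N. p = (\<Sum>d<N. hcomp d p)"
proof -
  obtain N where N: "total_deg m < N" if "m \<in> Poly_Mapping.keys p" for m
    using finite_nat_set_iff_bounded[of "total_deg ` Poly_Mapping.keys p"] by auto
  have "Poly_Mapping.lookup p m = 0" if "\<not> total_deg m < N" for m
    using N[of m] that by (auto simp: in_keys_iff)
  then have "p = (\<Sum>d<N. hcomp d p)"
    by (intro poly_mapping_eqI) (auto simp: lookup_sum lookup_hcomp when_def)
  then show ?thesis by blast
qed

lemma homogeneous_sum: "(\<And>i. i \<in> I \<Longrightarrow> homogeneous d (h i)) \<Longrightarrow> homogeneous d (sum h I)"
proof (induction I rule: infinite_finite_induct)
  case (insert i I)
  then have "homogeneous d (h i)" "homogeneous d (sum h I)" by auto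
  then show ?case using insert.hyps Poly_Mapping.keys_add[of "h i" "sum h I"]
    by (auto simp: homogeneous_def)
qed (auto simp: homogeneous_def)

lemma homogeneous_mult:
  fixes p q :: "('v::finite, 'a::comm_ring_1) mpoly"
  shows "homogeneous d p \<Longrightarrow> homogeneous e q \<Longrightarrow> homogeneous (d + e) (p * q)"
  using keys_mult[of p q] by (fastforce simp: homogeneous_def total_deg_add)

lemma homogeneous_dvar:
  fixes p :: "('v::finite, 'a::comm_ring_1) mpoly"
  assumes "homogeneous (Suc d) p"
  shows "homogeneous d (dvar j p)"
  unfolding homogeneous_def
proof
  fix m assume "m \<in> Poly_Mapping.keys (dvar j p)"
  then have "m + Poly_Mapping.single j 1 \<in> Poly_Mapping.keys p"
    by (auto simp: in_keys_iff lookup_dvar)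
  then have "total_deg (m + Poly_Mapping.single j 1) = Suc d"
    using assms by (auto simp: homogeneous_def)
  then show "total_deg m = d" by (simp add: total_deg_add del: One_nat_def)
qed

lemma homogeneous_0_Const:
  fixes p :: "('v::finite, 'a::comm_ring_1) mpoly"
  shows "homogeneous 0 p \<Longrightarrow> p = Const (Poly_Mapping.lookup p 0)"
  by (rule poly_mapping_eqI) (auto simp: lookup_single homogeneous_def in_keys_iff when_def)

lemma euler:
  fixes p :: "('v::finite, 'a::comm_ring_1) mpoly"
  assumes "homogeneous d p"
  shows "(\<Sum>i\<in>UNIV. var i * dvar i p) = of_nat d * p"
proof (rule poly_mapping_eqI)
  fix m
  have "Poly_Mapping.lookup (of_nat d * p) m = of_nat d * Poly_Mapping.lookup p m"
    using lookup_Const_mult[of "of_nat d" p m] by simp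
  moreover have "(\<Sum>i\<in>UNIV. of_nat (Poly_Mapping.lookup m i)) * Poly_Mapping.lookup p m =
      of_nat d * Poly_Mapping.lookup p m"
    using assms by (cases "m \<in> Poly_Mapping.keys p")
      (auto simp: homogeneous_def total_deg_eq in_keys_iff simp flip: of_nat_sum)
  ultimately show "Poly_Mapping.lookup (\<Sum>i\<in>UNIV. var i * dvar i p) m =
      Poly_Mapping.lookup (of_nat d * p) m"
    by (simp add: lookup_sum lookup_var_mult_dvar sum_distrib_right)
qed

lemma homogeneous_1_eq:
  fixes p :: "('v::finite, 'a::comm_ring_1) mpoly"
  assumes "homogeneous 1 p"
  shows "p = (\<Sum>i\<in>UNIV. Const (Poly_Mapping.lookup (dvar i p) 0) * var i)"
proof -
  have "dvar i p = Const (Poly_Mapping.lookup (dvar i p) 0)" for i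
    using assms by (intro homogeneous_0_Const homogeneous_dvar) simp
  then show ?thesis using euler[OF assms] by (simp add: mult.commute)
qed

lemma second_derivative_symmetric:
  "Poly_Mapping.lookup (dvar i (dvar j p)) 0 = Poly_Mapping.lookup (dvar j (dvar i p)) 0"
  by (simp add: lookup_dvar lookup_single add.commute when_def)

text \<open>
  A quadratic form with vanishing derivative in the direction \<open>v\<close> does not change when a multiple of
  \<open>v\<close> is subtracted from its argument.
\<close>

lemma quadratic_form_projected:
  fixes W :: "('v::finite, 'k::field_char_0) mpoly"
  assumes W: "homogeneous 2 W" and v: "(\<Sum>i\<in>UNIV. Const (v i) * dvar i W) = 0"
    and y: "\<And>i. y i = var i - Const (v i) * l"
  shows "\<exists>c. W = (\<Sum>i\<in>UNIV. \<Sum>j\<in>UNIV. Const (c i j) * (y i * y j))"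
proof -
  define c where "c i j = Poly_Mapping.lookup (dvar j (dvar i W)) 0" for i j
  have Wi: "dvar i W = (\<Sum>j\<in>UNIV. Const (c i j) * var j)" for i
    unfolding c_def using W by (intro homogeneous_1_eq homogeneous_dvar) (simp add: numeral_2_eq_2)
  have cv: "(\<Sum>j\<in>UNIV. c i j * v j) = 0" for i
  proof -
    interpret d: derivation UNIV "dvar i :: ('v, 'k) mpoly \<Rightarrow> _" by (rule derivation_dvar)
    have "0 = Poly_Mapping.lookup (dvar i (\<Sum>j\<in>UNIV. Const (v j) * dvar j W)) 0"
      unfolding v by simp
    also have "\<dots> = (\<Sum>j\<in>UNIV. v j * c j i)"
      by (simp add: d.D_sum d.D_mult lookup_sum lookup_Const_mult c_def)
    also have "\<dots> = (\<Sum>j\<in>UNIV. c i j * v j)"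
      by (simp add: c_def second_derivative_symmetric mult.commute)
    finally show ?thesis by simp
  qed
  have Wi_y: "(\<Sum>j\<in>UNIV. Const (c i j) * y j) = dvar i W" for i
  proof -
    have "(\<Sum>j\<in>UNIV. Const (c i j) * y j) =
        (\<Sum>j\<in>UNIV. Const (c i j) * var j) - Const (\<Sum>j\<in>UNIV. c i j * v j) * l"
      by (simp add: y Const_sum Const_mult algebra_simps sum_subtractf sum_distrib_left)
    then show ?thesis using cv[of i] Wi[of i] by simp
  qed
  have "(\<Sum>i\<in>UNIV. \<Sum>j\<in>UNIV. Const (c i j) * (y i * y j)) = (\<Sum>i\<in>UNIV. y i * dvar i W)"
    unfolding Wi_y[symmetric] by (simp add: sum_distrib_left algebra_simps)
  also have "\<dots> = (\<Sum>i\<in>UNIV. var i * dvar i W) - (\<Sum>i\<in>UNIV. Const (v i) * dvar i W) * l"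
    by (simp add: y algebra_simps sum_subtractf sum_distrib_left)
  also have "\<dots> = Const 2 * W"
    unfolding v euler[OF W] by simp
  finally have "Const (1 / 2) * (\<Sum>i\<in>UNIV. \<Sum>j\<in>UNIV. Const (c i j) * (y i * y j)) =
      Const (1 / 2) * (Const 2 * W)" by simp
  also have "\<dots> = Const (1 / 2 * 2) * W" by (simp only: Const_mult mult.assoc)
  also have "\<dots> = W" by simp
  finally have "W = (\<Sum>i\<in>UNIV. \<Sum>j\<in>UNIV. Const (c i j / 2) * (y i * y j))"
    by (simp add: sum_distrib_left mult_single flip: mult.assoc)
  then show ?thesis by (rule exI[of _ "\<lambda>i j. c i j / 2"])
qed

subsection \<open>Polynomials with proportional gradients\<close>

lemma lookup_mult_leading:
  fixes p q :: "('v::linorder, 'a::comm_ring_1) mpoly"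
  assumes p: "\<And>m. m \<in> Poly_Mapping.keys p \<Longrightarrow> m \<le> \<mu>"
    and q: "\<And>m. m \<in> Poly_Mapping.keys q \<Longrightarrow> m \<le> \<eta>"
  shows "Poly_Mapping.lookup (p * q) (\<mu> + \<eta>) = Poly_Mapping.lookup p \<mu> * Poly_Mapping.lookup q \<eta>"
proof -
  have eq: "m + m' = \<mu> + \<eta> \<longleftrightarrow> m = \<mu> \<and> m' = \<eta>"
    if "m \<in> Poly_Mapping.keys p" "m' \<in> Poly_Mapping.keys q" for m m'
    using p[OF that(1)] q[OF that(2)] add_less_le_mono[of m \<mu> m' \<eta>] add_le_less_mono[of m \<mu> m' \<eta>]
    by (auto simp: order.strict_iff_order)
  have "Poly_Mapping.lookup (p * q) (\<mu> + \<eta>) =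
      (\<Sum>m\<in>Poly_Mapping.keys p. \<Sum>m'\<in>Poly_Mapping.keys q.
        if m + m' = \<mu> + \<eta> then Poly_Mapping.lookup p m * Poly_Mapping.lookup q m' else 0)"
    unfolding mult_eq_sum by (simp add: lookup_sum lookup_single when_def)
  also have "\<dots> = (\<Sum>m\<in>Poly_Mapping.keys p. \<Sum>m'\<in>Poly_Mapping.keys q.
        if m' = \<eta> then if m = \<mu> then Poly_Mapping.lookup p \<mu> * Poly_Mapping.lookup q \<eta> else 0 else 0)"
    by (intro sum.cong refl) (auto simp: eq)
  also have "\<dots> = Poly_Mapping.lookup p \<mu> * Poly_Mapping.lookup q \<eta>"
    by (cases "Poly_Mapping.lookup q \<eta> = 0") (auto simp: in_keys_iff)
  finally show ?thesis .
qed

text \<open>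
  Subtract the multiple of \<open>G\<close> that cancels the coefficient of \<open>H\<close> at the leading monomial \<open>\<mu>\<close> of
  \<open>G\<close>.  If \<open>\<eta>\<close> were the leading monomial of the rest \<open>K\<close>, the Euler operators \<open>x\<^sub>j \<partial>\<^sub>j\<close>, which fix the
  support, would give \<open>\<eta>\<^sub>j = \<mu>\<^sub>j\<close> for all \<open>j\<close> by comparison of the coefficients at \<open>\<mu> + \<eta>\<close>.
\<close>

lemma proportional_if_gradients_proportional:
  fixes G H :: "('v::linorder, 'k::field_char_0) mpoly"
  assumes "G \<noteq> 0" and grad: "\<And>j. G * dvar j H = H * dvar j G"
  shows "\<exists>c. H = Const c * G"
proof -
  define \<mu> where "\<mu> = Max (Poly_Mapping.keys G)"
  have \<mu>: "m \<le> \<mu>" if "m \<in> Poly_Mapping.keys G" for m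
    unfolding \<mu>_def using that by simp
  have "\<mu> \<in> Poly_Mapping.keys G"
    unfolding \<mu>_def using \<open>G \<noteq> 0\<close> by (intro Max_in) (auto simp: poly_mapping_eq_iff fun_eq_iff in_keys_iff)
  then have G\<mu>: "Poly_Mapping.lookup G \<mu> \<noteq> 0" by (simp add: in_keys_iff)
  define c where "c = Poly_Mapping.lookup H \<mu> / Poly_Mapping.lookup G \<mu>"
  define K where "K = H - Const c * G"
  have K\<mu>: "Poly_Mapping.lookup K \<mu> = 0"
    using G\<mu> by (simp add: K_def c_def lookup_minus lookup_Const_mult)
  have gradK: "G * dvar j K = K * dvar j G" for j
  proof -
    interpret d: derivation UNIV "dvar j :: ('v, 'k) mpoly \<Rightarrow> _" by (rule derivation_dvar)
    show ?thesis
      using grad[of j] unfolding K_def by (simp add: d.D_diff d.D_mult algebra_simps)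
  qed
  have "K = 0"
  proof (rule ccontr)
    assume "K \<noteq> 0"
    define \<eta> where "\<eta> = Max (Poly_Mapping.keys K)"
    have \<eta>: "m \<le> \<eta>" if "m \<in> Poly_Mapping.keys K" for m
      unfolding \<eta>_def using that by simp
    have "\<eta> \<in> Poly_Mapping.keys K"
      unfolding \<eta>_def using \<open>K \<noteq> 0\<close> by (intro Max_in) (auto simp: poly_mapping_eq_iff fun_eq_iff in_keys_iff)
    then have K\<eta>: "Poly_Mapping.lookup K \<eta> \<noteq> 0" by (simp add: in_keys_iff)
    with K\<mu> have "\<mu> \<noteq> \<eta>" by auto
    then obtain j where j: "Poly_Mapping.lookup \<mu> j \<noteq> Poly_Mapping.lookup \<eta> j"
      by (auto simp: poly_mapping_eq_iff fun_eq_iff)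
    have keys: "Poly_Mapping.keys (var j * dvar j p) \<subseteq> Poly_Mapping.keys p" for p :: "('v, 'k) mpoly"
      by (auto simp: in_keys_iff lookup_var_mult_dvar)
    have "G * (var j * dvar j K) = var j * (G * dvar j K)" by (simp add: mult_ac)
    also have "\<dots> = K * (var j * dvar j G)" unfolding gradK by (simp add: mult_ac)
    finally have "Poly_Mapping.lookup (G * (var j * dvar j K)) (\<mu> + \<eta>) =
        Poly_Mapping.lookup (K * (var j * dvar j G)) (\<eta> + \<mu>)"
      by (simp only: add.commute[of \<mu>])
    also have "Poly_Mapping.lookup (G * (var j * dvar j K)) (\<mu> + \<eta>) =
        Poly_Mapping.lookup G \<mu> * (of_nat (Poly_Mapping.lookup \<eta> j) * Poly_Mapping.lookup K \<eta>)"
      using \<mu> \<eta> keys[of K] by (subst lookup_mult_leading) (auto simp: lookup_var_mult_dvar)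
    also have "Poly_Mapping.lookup (K * (var j * dvar j G)) (\<eta> + \<mu>) =
        Poly_Mapping.lookup K \<eta> * (of_nat (Poly_Mapping.lookup \<mu> j) * Poly_Mapping.lookup G \<mu>)"
      using \<mu> \<eta> keys[of G] by (subst lookup_mult_leading) (auto simp: lookup_var_mult_dvar)
    finally show False using G\<mu> K\<eta> j by simp
  qed
  then show ?thesis unfolding K_def by auto
qed

text \<open>
  By Euler's identity, parallel gradients satisfy \<open>a z \<partial>w = b w \<partial>z\<close>: the logarithmic derivatives of
  \<open>w\<^sup>a\<close> and \<open>z\<^sup>b\<close> agree.
\<close>

lemma power_relation:
  fixes z w :: "('v::{finite,linorder}, 'k::field_char_0) mpoly"
  assumes z: "homogeneous a z" "z \<noteq> 0" "a > 0" and w: "homogeneous b w"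
    and parallel: "\<And>i j. dvar i z * dvar j w = dvar j z * dvar i w"
  shows "\<exists>c. w ^ a = Const c * z ^ b"
proof (rule proportional_if_gradients_proportional)
  fix j
  interpret d: derivation UNIV "dvar j :: ('v, 'k) mpoly \<Rightarrow> _" by (rule derivation_dvar)
  have "of_nat a * z * dvar j w = (\<Sum>i\<in>UNIV. var i * dvar i z) * dvar j w"
    unfolding euler[OF z(1)] ..
  also have "\<dots> = (\<Sum>i\<in>UNIV. var i * (dvar i z * dvar j w))"
    by (simp add: sum_distrib_right mult.assoc)
  also have "\<dots> = (\<Sum>i\<in>UNIV. var i * (dvar j z * dvar i w))"
    unfolding parallel[of _ j] ..
  also have "\<dots> = (\<Sum>i\<in>UNIV. var i * dvar i w) * dvar j z"
    unfolding sum_distrib_right by (intro sum.cong refl) (simp only: mult_ac)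
  also have "\<dots> = of_nat b * w * dvar j z"
    unfolding euler[OF w] ..
  finally have rel: "of_nat a * z * dvar j w = of_nat b * w * dvar j z" .
  from z(3) obtain a' where a: "a = Suc a'" by (cases a) auto
  show "z ^ b * dvar j (w ^ a) = w ^ a * dvar j (z ^ b)"
  proof (cases b)
    case 0
    then have "dvar j w = 0" using rel z by simp
    with 0 show ?thesis by (simp add: d.D_power_zero)
  next
    case (Suc b')
    have "z ^ b * dvar j (w ^ a) = z ^ b' * w ^ a' * (of_nat a * z * dvar j w)"
      by (simp add: a Suc d.D_power algebra_simps del: of_nat_Suc power_Suc, simp add: algebra_simps)
    also have "\<dots> = w ^ a * dvar j (z ^ b)"
      unfolding rel by (simp add: a Suc d.D_power algebra_simps del: of_nat_Suc power_Suc, simp add: algebra_simps)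
    finally show ?thesis .
  qed
qed (use z in simp)

subsection \<open>The centre\<close>

lemma poly_scale_times: "poly_scale (*) c p = Const c * p"
  by (rule poly_mapping_eqI)
    (simp add: poly_scale_def Poly_Mapping.map.rep_eq lookup_Const_mult when_def)

locale quadratic_bracket =
  fixes bracket :: "(3, 'k::field_char_0) mpoly \<Rightarrow> (3, 'k) mpoly \<Rightarrow> (3, 'k) mpoly"
  assumes quadratic: "quadratic_poisson bracket"
    and nontrivial: "\<exists>p q. bracket p q \<noteq> 0"
begin

sublocale poisson_algebra "poly_scale (*)" bracket
  using quadratic by (simp add: quadratic_poisson_def)

abbreviation "Z \<equiv> poisson_centre bracket"

definition W :: "3 \<Rightarrow> 3 \<Rightarrow> (3, 'k) mpoly" where "W i j = bracket (var i) (var j)"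

lemma homogeneous_W: "homogeneous 2 (W i j)"
  using quadratic by (simp add: quadratic_poisson_def W_def)

lemma Const_centre [simp]: "Const c \<in> Z"
  using scale_one_in_centre[of c] by (simp add: poly_scale_times)

lemma bracket_formula: "bracket p q = (\<Sum>i\<in>UNIV. dvar i p * bracket (var i) q)"
proof (induction p rule: mpoly_gen_induct)
  case (var j)
  have "(\<Sum>i\<in>UNIV. dvar i (var j) * bracket (var i) q) =
      (\<Sum>i\<in>UNIV. if i = j then bracket (var j) q else 0)"
    by (intro sum.cong) (auto simp: dvar_var)
  then show ?case by simp
next
  case (mult p p')
  then show ?case
    by (simp add: bracket_leibniz_left dvar_mult sum_distrib_left sum_distrib_right algebra_simps
        sum.distrib)
qed (simp_all add: bracket_add dvar_add algebra_simps sum.distrib)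

lemma bracket_W: "bracket p q = (\<Sum>i\<in>UNIV. \<Sum>j\<in>UNIV. dvar i p * dvar j q * W i j)"
proof -
  have "bracket (var i) q = (\<Sum>j\<in>UNIV. dvar j q * W i j)" for i
  proof -
    have "bracket (var i) q = - (\<Sum>j\<in>UNIV. dvar j q * bracket (var j) (var i))"
      unfolding bracket_anti[of "var i" q] bracket_formula[of q "var i"] ..
    also have "\<dots> = (\<Sum>j\<in>UNIV. dvar j q * W i j)"
      unfolding sum_negf[symmetric] W_def bracket_anti[of "var i"] by simp
    finally show ?thesis .
  qed
  then show ?thesis
    unfolding bracket_formula[of p q] by (simp add: sum_distrib_left mult.assoc)
qed

lemma W_anti: "W j i = - W i j" and W_self [simp]: "W i i = 0"
  unfolding W_def by (rule bracket_anti, rule bracket_self)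

lemma centre_iff: "p \<in> Z \<longleftrightarrow> (\<forall>j. bracket p (var j) = 0)"
proof
  assume *: "\<forall>j. bracket p (var j) = 0"
  have "bracket p q = 0" for q
  proof -
    have "bracket (var j) p = 0" for j
      unfolding bracket_anti[of "var j" p] using * by simp
    then have "bracket q p = 0" unfolding bracket_formula[of q p] by simp
    then show ?thesis unfolding bracket_anti[of p q] by simp
  qed
  then show "p \<in> Z" unfolding poisson_centre_def by blast
qed simp

text \<open>
  In three variables the bracket is the triple product \<open>{p, q} = V \<cdot> (\<nabla>p \<times> \<nabla>q)\<close> for a vector field
  \<open>V\<close>, so that central elements have gradients parallel to \<open>V\<close>.
\<close>

definition V :: "3 \<Rightarrow> (3, 'k) mpoly" where
  "V i = (if i = 0 then W 1 2 else if i = 1 then W 2 0 else W 0 1)"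

lemma V_simps: "V 0 = W 1 2" "V 1 = W 2 0" "V 2 = W 0 1"
  by (simp_all add: V_def)

lemma W_V: "\<exists>s k. W i j = Const s * V k"
proof -
  have "\<forall>i j. \<exists>s k. W i j = Const s * V k"
    unfolding all_three
    apply (intro conjI)
    apply (rule exI[of _ 0], simp)
    apply (rule exI[of _ 1], rule exI[of _ 2], simp add: V_simps)
    apply (rule exI[of _ "-1"], rule exI[of _ 1], simp add: V_simps W_anti[of 0 2] single_uminus)
    apply (rule exI[of _ "-1"], rule exI[of _ 2], simp add: V_simps W_anti[of 1 0] single_uminus)
    apply (rule exI[of _ 0], simp)
    apply (rule exI[of _ 1], rule exI[of _ 0], simp add: V_simps)
    apply (rule exI[of _ 1], rule exI[of _ 1], simp add: V_simps)
    apply (rule exI[of _ "-1"], rule exI[of _ 0], simp add: V_simps W_anti[of 2 1] single_uminus)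
    apply (rule exI[of _ 0], simp)
    done
  then show ?thesis by blast
qed

lemma V_nonzero: "\<exists>k. V k \<noteq> 0"
proof (rule ccontr)
  assume "\<not> ?thesis"
  then have "W i j = 0" for i j using W_V[of i j] by auto
  then show False using nontrivial by (simp add: bracket_W)
qed

lemma gradient_parallel_V:
  assumes "z \<in> Z"
  shows "V i * dvar j z = V j * dvar i z"
proof -
  have *: "dvar 0 z * W 0 k + dvar 1 z * W 1 k + dvar 2 z * W 2 k = 0" for k
    using centreD(1)[OF assms, of "var k"] bracket_formula[of z "var k"]
    by (simp add: W_def sum_three)
  have "\<forall>i j. V i * dvar j z = V j * dvar i z"
    unfolding all_three
    using *[of 0] *[of 1] *[of 2] W_anti[of 0 1] W_anti[of 0 2] W_anti[of 1 2]
    by (simp add: V_simps algebra_simps add_eq_0_iff)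
  then show ?thesis by blast
qed

lemma central_gradients_parallel:
  assumes "z \<in> Z" "w \<in> Z"
  shows "dvar i z * dvar j w = dvar j z * dvar i w"
proof -
  from V_nonzero obtain k where k: "V k \<noteq> 0" by blast
  note z = gradient_parallel_V[OF assms(1), of k] and w = gradient_parallel_V[OF assms(2), of k]
  have "(V k * V k) * (dvar i z * dvar j w) = (V k * dvar i z) * (V k * dvar j w)"
    by (simp add: algebra_simps)
  also have "\<dots> = (V k * dvar j z) * (V k * dvar i w)"
    unfolding z w by (simp add: algebra_simps)
  also have "\<dots> = (V k * V k) * (dvar j z * dvar i w)" by (simp add: algebra_simps)
  finally show ?thesis using k by simp
qed

text \<open>
  The bracket with a coordinate raises degrees by exactly one and thus acts on each homogeneous
  component separately.
\<close>

lemma hcomp_centre: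
  assumes "w \<in> Z"
  shows "hcomp d w \<in> Z"
proof -
  have eq: "hcomp (Suc d) (bracket w (var j)) = bracket (hcomp d w) (var j)" for w j
  proof (induction w rule: single_induct)
    case (single m a)
    have "homogeneous (total_deg m + 1) (bracket (Poly_Mapping.single m a) (var j))"
      unfolding bracket_formula[of "Poly_Mapping.single m a"]
    proof (rule homogeneous_sum)
      fix i
      have m: "homogeneous (total_deg m) (Poly_Mapping.single m a)"
        by (simp add: homogeneous_def)
      have W: "homogeneous 2 (bracket (var i) (var j))" using homogeneous_W by (simp add: W_def)
      show "homogeneous (total_deg m + 1) (dvar i (Poly_Mapping.single m a) * bracket (var i) (var j))"
      proof (cases "total_deg m")
        case 0
        then have "m = 0" by simp
        then show ?thesis by (simp add: homogeneous_def)
      next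
        case (Suc e)
        then show ?thesis using homogeneous_mult[OF homogeneous_dvar W, of e] m by simp
      qed
    qed
    then show ?case by (auto simp: hcomp_homogeneous hcomp_single when_def)
  qed (auto simp: bracket_add hcomp_add)
  show ?thesis unfolding centre_iff using assms eq[of w] by (metis centreD(1) hcomp_0)
qed

lemma central_power_relation:
  assumes "z \<in> Z" "homogeneous a z" "z \<noteq> 0" "a > 0" "w \<in> Z" "homogeneous b w"
  shows "\<exists>c. w ^ a = Const c * z ^ b"
  by (rule power_relation) (use assms central_gradients_parallel in auto)

end

context quadratic_bracket
begin

text \<open>
  Homogeneous central elements have proportional powers, so each homogeneous component of \<open>w\<close> has a
  power that is divisible by \<open>z\<close>.
\<close>

lemma centre_in_radical:
  assumes z: "z \<in> Z" "homogeneous a z" "z \<noteq> 0" "a > 0"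
    and w: "w \<in> Z" "Poly_Mapping.lookup w 0 = 0"
  shows "w \<in> subring_of.radical UNIV z"
proof -
  interpret U: subring_of "UNIV :: (3, 'k) mpoly set" by simp
  obtain N where N: "w = (\<Sum>d<N. hcomp d w)" using sum_hcomp by blast
  have "hcomp d w \<in> U.radical z" for d
  proof (cases d)
    case 0
    have "hcomp 0 w = Const (Poly_Mapping.lookup (hcomp 0 w) 0)"
      by (rule homogeneous_0_Const[OF homogeneous_hcomp])
    also have "\<dots> = 0" using w(2) by (simp add: lookup_hcomp)
    finally show ?thesis using U.radical_zero 0 by simp
  next
    case (Suc e)
    from central_power_relation[OF z hcomp_centre[OF w(1)] homogeneous_hcomp, of d]
    obtain c where "hcomp d w ^ a = Const c * z ^ d" by blast
    then have "hcomp d w ^ a = z * (Const c * z ^ e)" by (simp add: Suc mult_ac)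
    then show ?thesis unfolding U.radical_def by blast
  qed
  then have "(\<Sum>d<N. hcomp d w) \<in> U.radical z" by (intro U.radical_sum) auto
  then show ?thesis by (simp only: N[symmetric])
qed

end

section \<open>Isomorphisms out of quadratic brackets\<close>

locale quadratic_iso = quadratic_bracket bracket +
  poisson_extension_iso "poly_scale (*)" bracket sB bB n f
  for bracket :: "(3, 'k::field_char_0) mpoly \<Rightarrow> (3, 'k) mpoly \<Rightarrow> (3, 'k) mpoly"
    and sB :: "'k \<Rightarrow> 'b::comm_ring_1 \<Rightarrow> 'b" and bB n f
begin

lemma Ds_Const_Const [simp]: "Ds j (Const (Const c)) = 0"
  using Ds_scale[of j c] by (simp add: poly_scale_times)

lemma Ds_locally_nilpotent: "locally_nilpotent CA (Ds j)"
  by unfold_locales (rule nil_Ds)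

lemma Ds_Const: "Ds j (Const z) = (\<Sum>i\<in>UNIV. Const (dvar i z) * Ds j (Const (var i)))"
proof (induction z rule: mpoly_gen_induct)
  case (var k)
  have "(\<Sum>i\<in>UNIV. Const (dvar i (var k)) * Ds j (Const (var i))) =
      (\<Sum>i\<in>UNIV. if i = k then Ds j (Const (var k)) else 0)"
    by (intro sum.cong) (auto simp: dvar_var)
  then show ?case by simp
next
  case (add p q)
  then show ?case
    by (simp add: single_add Ds.D_add dvar_add algebra_simps sum.distrib)
next
  case (mult p q)
  have "Ds j (Const (p * q)) = Ds j (Const p) * Const q + Const p * Ds j (Const q)"
    by (simp add: Const_mult Ds.D_mult)
  also have "\<dots> = (\<Sum>i\<in>UNIV. Const (dvar i (p * q)) * Ds j (Const (var i)))"
    unfolding mult sum_distrib_left sum_distrib_right sum.distrib[symmetric]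
    by (intro sum.cong refl) (simp add: dvar_mult single_add Const_mult algebra_simps)
  finally show ?case .
qed simp

lemma constant_coeff_Ds:
  "Poly_Mapping.lookup (Poly_Mapping.lookup (Ds j (Const z)) m) 0 =
    (\<Sum>i\<in>UNIV. Poly_Mapping.lookup (dvar i z) 0 *
      Poly_Mapping.lookup (Poly_Mapping.lookup (Ds j (Const (var i))) m) 0)"
  by (subst Ds_Const) (simp add: lookup_sum lookup_Const_mult lookup_mult_0)

subsection \<open>Derivations that preserve the augmentation ideal of the centre\<close>

definition aug :: "(nat, (3, 'k) mpoly) mpoly set" where
  "aug = {p. \<forall>m. Poly_Mapping.lookup (Poly_Mapping.lookup p m) 0 = 0}"

lemma aug_sum: "(\<And>i. i \<in> I \<Longrightarrow> h i \<in> aug) \<Longrightarrow> sum h I \<in> aug"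
  by (simp add: aug_def lookup_sum)

lemma aug_add: "p \<in> aug \<Longrightarrow> q \<in> aug \<Longrightarrow> p + q \<in> aug"
  by (simp add: aug_def lookup_add)

lemma aug_mult: "p \<in> aug \<Longrightarrow> p * q \<in> aug"
  by (subst mult_eq_sum, intro aug_sum) (simp add: aug_def lookup_single when_def lookup_mult_0)

context
  fixes j
  assumes aug: "\<And>z. z \<in> Z \<Longrightarrow> Ds j (Const z) \<in> aug"
begin

lemma Ds_aug:
  assumes "u \<in> ZCA" "u \<in> aug"
  shows "Ds j u \<in> aug"
proof -
  let ?t = "\<lambda>m. Poly_Mapping.single m 1 :: (nat, (3, 'k) mpoly) mpoly"
  have u: "u = (\<Sum>m\<in>Poly_Mapping.keys u. Const (Poly_Mapping.lookup u m) * ?t m)"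
    using sum_singles[of u] by (simp add: mult_single)
  have t: "?t m \<in> CA" if "m \<in> Poly_Mapping.keys u" for m
    using assms(1) that by (auto simp: polys_over_def polys_in_def)
  have "Ds j u = (\<Sum>m\<in>Poly_Mapping.keys u. Ds j (Const (Poly_Mapping.lookup u m) * ?t m))"
    by (subst u, rule Ds.D_sum) (auto intro: t)
  also have "\<dots> = (\<Sum>m\<in>Poly_Mapping.keys u. Ds j (Const (Poly_Mapping.lookup u m)) * ?t m +
      Const (Poly_Mapping.lookup u m) * Ds j (?t m))"
    by (intro sum.cong refl Ds.D_mult) (auto intro: t)
  also have "\<dots> \<in> aug" unfolding sum.distrib
  proof (rule aug_add)
    show "(\<Sum>m\<in>Poly_Mapping.keys u. Ds j (Const (Poly_Mapping.lookup u m)) * ?t m) \<in> aug"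
      using assms(1) by (intro aug_sum aug_mult aug) (auto simp: polys_over_def)
    show "(\<Sum>m\<in>Poly_Mapping.keys u. Const (Poly_Mapping.lookup u m) * Ds j (?t m)) \<in> aug"
      using assms(2) by (intro aug_sum aug_mult) (auto simp: aug_def lookup_single when_def)
  qed
  finally show ?thesis .
qed

lemma aug_in_radical:
  assumes z: "z \<in> Z" "homogeneous a z" "z \<noteq> 0" "a > 0" and u: "u \<in> ZCA" "u \<in> aug"
  shows "u \<in> CA.radical (Const z)"
proof -
  have "Const (Poly_Mapping.lookup u m) * Poly_Mapping.single m 1 \<in> CA.radical (Const z)"
    if m: "m \<in> Poly_Mapping.keys u" for m
  proof (rule CA.radical_mult)
    have "Poly_Mapping.lookup u m \<in> ev.radical z"
      using u m by (intro centre_in_radical[OF z]) (auto simp: polys_over_def aug_def)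
    then obtain N v where "Poly_Mapping.lookup u m ^ N = z * v" by (auto simp: ev.radical_def)
    then have "Const (Poly_Mapping.lookup u m) ^ N = Const z * Const v"
      by (simp flip: Const_power Const_mult)
    then show "Const (Poly_Mapping.lookup u m) \<in> CA.radical (Const z)"
      unfolding CA.radical_def using Const_CA by blast
    show "Poly_Mapping.single m 1 \<in> CA"
      using u(1) m by (auto simp: polys_over_def polys_in_def)
  qed
  then have "(\<Sum>m\<in>Poly_Mapping.keys u. Const (Poly_Mapping.lookup u m) * Poly_Mapping.single m 1)
      \<in> CA.radical (Const z)"
    by (intro CA.radical_sum) auto
  then show ?thesis by (simp add: mult_single sum_singles)
qed

text \<open>
  The last nonzero iterate \<open>y\<close> of the derivation on \<open>z\<close> lies in the kernel and in the augmentation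
  ideal of the centre.  So \<open>z\<close> divides a power of \<open>y\<close> and is a factor of an element of the kernel.
\<close>

lemma Ds_homogeneous_zero:
  assumes z: "z \<in> Z" "homogeneous a z" "z \<noteq> 0" "a > 0"
  shows "Ds j (Const z) = 0"
proof -
  interpret D: locally_nilpotent CA "Ds j" by (rule Ds_locally_nilpotent)
  have "0 \<notin> Poly_Mapping.keys z" 
  proof
    assume "0 \<in> Poly_Mapping.keys z"
    then have "total_deg (0 :: 3 \<Rightarrow>\<^sub>0 nat) = a" using z(2) unfolding homogeneous_def by blast
    then show False using z(4) by (simp add: total_deg_def)
  qed
  then have "Const z \<in> aug"
    by (auto simp: aug_def lookup_single when_def in_keys_iff)
  then have stable: "(Ds j ^^ N) (Const z) \<in> ZCA \<and> (Ds j ^^ N) (Const z) \<in> aug" for N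
    using z(1) by (induction N) (auto simp: Ds_ZCA Ds_aug)
  define y where "y = (Ds j ^^ Ds.ndeg j (Const z)) (Const z)"
  have y: "y \<in> ZCA" "y \<in> aug" "y \<noteq> 0" "Ds j y = 0"
    using stable D.funpow_ndeg[of "Const z"] z(3) by (auto simp: y_def)
  from aug_in_radical[OF z y(1,2)] obtain N v
    where v: "v \<in> CA" "y ^ N = Const z * v" by (auto simp: CA.radical_def)
  show ?thesis
  proof (rule D.kernel_factorially_closed[OF Const_CA v(1)])
    show "Const z * v \<noteq> 0" unfolding v(2)[symmetric] using y(3) by simp
    show "Ds j (Const z * v) = 0"
      unfolding v(2)[symmetric] using y by (intro Ds.D_power_zero) (auto intro: ZCA_CA)
  qed
qed

lemma Ds_centre_zero:
  assumes z: "z \<in> Z"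
  shows "Ds j (Const z) = 0"
proof -
  obtain N where N: "z = (\<Sum>d<N. hcomp d z)" using sum_hcomp by blast
  have "Ds j (Const (hcomp d z)) = 0" for d
  proof (cases "d = 0 \<or> hcomp d z = 0")
    case True
    then obtain c where "hcomp d z = Const c"
      using homogeneous_0_Const[OF homogeneous_hcomp, of z] single_zero[of 0] by metis
    then show ?thesis by simp
  next
    case False
    then show ?thesis
      by (intro Ds_homogeneous_zero[OF hcomp_centre[OF z] homogeneous_hcomp]) auto
  qed
  then show ?thesis by (subst N) (simp add: Const_sum Ds.D_sum)
qed

end

end

subsection \<open>A central linear form moved by a derivation\<close>

text \<open>
  Suppose that a transported derivation moves a central element out of the augmentation ideal.  Only
  the linear part \<open>lin\<close> of that element matters for this, and it is itself central.  The constant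
  terms of the derivation form a vector \<open>v\<close>, scaled so that \<open>lin\<close> has value one on it, and the aim
  is to show that the brackets of the coordinates are constant in the direction of \<open>v\<close>.
\<close>

locale moved_central_form = quadratic_iso +
  fixes j\<^sub>0 z\<^sub>0 m\<^sub>0
  assumes z0: "z\<^sub>0 \<in> Z"
    and moved: "Poly_Mapping.lookup (Poly_Mapping.lookup (Ds j\<^sub>0 (Const z\<^sub>0)) m\<^sub>0) 0 \<noteq> 0"
begin

definition lam :: "3 \<Rightarrow> 'a" where "lam i = Poly_Mapping.lookup (dvar i z\<^sub>0) 0"

definition lin :: "(3, 'a) mpoly" where "lin = (\<Sum>i\<in>UNIV. Const (lam i) * var i)"

definition v :: "3 \<Rightarrow> 'a" where
  "v i = Poly_Mapping.lookup (Poly_Mapping.lookup (Ds j\<^sub>0 (Const (var i))) m\<^sub>0) 0 /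
    Poly_Mapping.lookup (Poly_Mapping.lookup (Ds j\<^sub>0 (Const z\<^sub>0)) m\<^sub>0) 0"

lemma lam_v: "(\<Sum>i\<in>UNIV. lam i * v i) = 1"
  using moved constant_coeff_Ds[of j\<^sub>0 z\<^sub>0 m\<^sub>0]
  by (simp add: v_def lam_def flip: sum_divide_distrib)

lemma l_hcomp: "lin = hcomp 1 z\<^sub>0"
proof -
  have "Poly_Mapping.lookup (dvar i (hcomp 1 z\<^sub>0)) 0 = lam i" for i
    by (simp add: lam_def lookup_dvar lookup_hcomp)
  then show ?thesis
    using homogeneous_1_eq[OF homogeneous_hcomp[of 1 z\<^sub>0]] by (simp add: lin_def)
qed

lemma l_centre [simp]: "lin \<in> Z"
  using hcomp_centre[OF z0, of 1] by (simp only: l_hcomp)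

lemma homogeneous_l: "homogeneous 1 lin"
  unfolding l_hcomp by (rule homogeneous_hcomp)

lemma dvar_l: "dvar i lin = Const (lam i)"
proof -
  interpret d: derivation UNIV "dvar i :: (3, 'a) mpoly \<Rightarrow> _" by (rule derivation_dvar)
  have "dvar i lin = (\<Sum>k\<in>UNIV. Const (lam k) * dvar i (var k))"
    by (simp add: lin_def d.D_sum d.D_mult)
  also have "\<dots> = (\<Sum>k\<in>UNIV. if k = i then Const (lam i) else 0)"
    by (intro sum.cong) (auto simp: dvar_var)
  finally show ?thesis by simp
qed

lemma lam_nonzero: "\<exists>i. lam i \<noteq> 0"
proof (rule ccontr)
  assume "\<not> ?thesis"
  then show False using lam_v by simp
qed

lemma l_nonzero: "lin \<noteq> 0"
  using lam_nonzero dvar_l by (metis dvar_0 Const_eq_iff single_zero)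

lemma centre_polynomials: "w \<in> Z \<Longrightarrow> \<exists>N c. w = (\<Sum>d<N. Const (c d) * lin ^ d)"
proof -
  assume w: "w \<in> Z"
  have "\<exists>c. hcomp d w = Const c * lin ^ d" for d
    using central_power_relation[OF l_centre homogeneous_l l_nonzero _ hcomp_centre[OF w]
        homogeneous_hcomp, of d] by simp
  then obtain c where c: "\<And>d. hcomp d w = Const (c d) * lin ^ d" by metis
  obtain N where "w = (\<Sum>d<N. hcomp d w)" using sum_hcomp by blast
  then show ?thesis unfolding c by blast
qed

lemma V_multiple:
  obtains k s where "V k \<noteq> 0" "\<And>i. V i = V k * Const (s i)"
proof -
  obtain k where k: "lam k \<noteq> 0" using lam_nonzero by blast
  have eq: "V i = V k * Const (lam i / lam k)" for i
  proof -
    have "V i * Const (lam k) = V k * Const (lam i)"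
      using gradient_parallel_V[OF l_centre, of i k] by (simp add: dvar_l)
    then have "V i * Const (lam k) * Const (inverse (lam k)) =
        V k * Const (lam i) * Const (inverse (lam k))" by (rule arg_cong)
    then have "V i * Const (lam k * inverse (lam k)) = V k * Const (lam i * inverse (lam k))"
      by (simp only: Const_mult mult.assoc)
    then show ?thesis using k by (simp add: divide_inverse)
  qed
  have "V k \<noteq> 0" using V_nonzero eq by (metis mult_zero_left)
  then show ?thesis by (rule that[OF _ eq])
qed

text \<open>
  All brackets are multiples of a single \<open>q = {x\<^sub>a, x\<^sub>b}\<close>, so a Poisson derivation maps \<open>q\<close> to a
  multiple of itself; a locally nilpotent one then kills \<open>q\<close>.
\<close>

lemma Ds_W: "Ds j (Const (W a b)) = 0"
proof -
  interpret D: locally_nilpotent CA "Ds j" by (rule Ds_locally_nilpotent)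
  obtain k s where k: "V k \<noteq> 0" "\<And>i. V i = V k * Const (s i)" by (rule V_multiple) blast
  define q where "q = V k"
  have W_q: "\<exists>s. W a b = q * Const s" for a b
  proof -
    obtain c i where "W a b = Const c * V i" using W_V by blast
    then have "W a b = q * Const (s i * c)"
      using k(2)[of i] by (simp add: q_def Const_mult mult_ac)
    then show ?thesis by blast
  qed
  have "\<exists>h. bracket x y = q * h" for x y
  proof -
    obtain s' where s': "\<And>a b. W a b = q * Const (s' a b)" using W_q by metis
    have "bracket x y = q * (\<Sum>a\<in>UNIV. \<Sum>b\<in>UNIV. dvar a x * dvar b y * Const (s' a b))"
      unfolding bracket_W s' sum_distrib_left by (intro sum.cong refl) (simp add: mult_ac)
    then show ?thesis by blast
  qed
  then obtain h where h: "\<And>x y. bracket x y = q * h x y" by metis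
  have multiple: "\<exists>u\<in>CA. poly_bracket bracket x y = Const q * u" if "x \<in> CA" "y \<in> CA" for x y
  proof -
    define u where "u = (\<Sum>m\<in>Poly_Mapping.keys x. \<Sum>m'\<in>Poly_Mapping.keys y.
      Poly_Mapping.single (m + m') (h (Poly_Mapping.lookup x m) (Poly_Mapping.lookup y m')))"
    have "Poly_Mapping.single (m + m') a \<in> CA"
      if "m \<in> Poly_Mapping.keys x" "m' \<in> Poly_Mapping.keys y" for m m' a
      using that \<open>x \<in> CA\<close> \<open>y \<in> CA\<close> by (auto simp: polys_in_def keys_add_nat)
    then have "u \<in> CA" unfolding u_def by (intro CA.sum_closed) blast
    moreover have "poly_bracket bracket x y = Const q * u"
      unfolding u_def poly_bracket_def h sum_distrib_left by (simp add: mult_single)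
    ultimately show ?thesis by blast
  qed
  obtain a' b' where "q = W a' b'"
  proof -
    have "\<forall>k. \<exists>a b. V k = W a b" unfolding all_three V_simps by blast
    then show ?thesis using that unfolding q_def by blast
  qed
  then have q: "Const q = poly_bracket bracket (Const (var a')) (Const (var b'))"
    by (simp add: W_def poly_bracket_single)
  obtain u\<^sub>1 u\<^sub>2 where u: "u\<^sub>1 \<in> CA" "u\<^sub>2 \<in> CA"
    "poly_bracket bracket (Ds j (Const (var a'))) (Const (var b')) = Const q * u\<^sub>1"
    "poly_bracket bracket (Const (var a')) (Ds j (Const (var b'))) = Const q * u\<^sub>2"
    using multiple by (metis Const_CA Ds.D_closed)
  have "Ds j (Const q) = Const q * (u\<^sub>1 + u\<^sub>2)"
    unfolding q Ds_bracket[OF Const_CA Const_CA] u(3,4) unfolding q[symmetric]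
    by (simp add: distrib_left)
  then have "Ds j (Const q) = 0"
    using u by (intro D.kernel_if_dvd_derivative[of _ "u\<^sub>1 + u\<^sub>2"]) auto
  moreover obtain s where "W a b = q * Const s" using W_q by blast
  ultimately show ?thesis by (simp add: Const_mult Ds.D_mult)
qed

text \<open>
  The brackets of coordinates are quadratic forms, so the part of \<open>Ds j\<^sub>0 W = 0\<close> of degree one in the
  coordinates only involves the constant terms of the derivation, that is, \<open>v\<close>.
\<close>

lemma W_invariant: "(\<Sum>i\<in>UNIV. Const (v i) * dvar i (W a b)) = 0"
proof -
  define d where "d i = Poly_Mapping.lookup (Ds j\<^sub>0 (Const (var i))) m\<^sub>0" for i
  define e where "e = Poly_Mapping.lookup (Poly_Mapping.lookup (Ds j\<^sub>0 (Const z\<^sub>0)) m\<^sub>0) 0"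
  have v: "v i = Poly_Mapping.lookup (d i) 0 / e" for i by (simp add: v_def d_def e_def)
  let ?U = "\<Sum>i\<in>UNIV. Const (v i) * dvar i (W a b)"
  have hW: "homogeneous 1 (dvar i (W a b))" for i
    using homogeneous_W[of a b] by (intro homogeneous_dvar) (simp add: numeral_2_eq_2)
  then have W0: "Poly_Mapping.lookup (dvar i (W a b)) 0 = 0" for i
    using hcomp_homogeneous[OF hW, of 0 i] lookup_hcomp[of 0 "dvar i (W a b)" 0] by simp
  have "homogeneous 1 ?U"
  proof (rule homogeneous_sum)
    fix i
    have "homogeneous 0 (Const (v i) :: (3, 'a) mpoly)" by (simp add: homogeneous_def)
    from homogeneous_mult[OF this hW] show "homogeneous 1 (Const (v i) * dvar i (W a b))" by simp
  qed
  then have U: "?U = (\<Sum>k\<in>UNIV. Const (Poly_Mapping.lookup (dvar k ?U) 0) * var k)"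
    by (rule homogeneous_1_eq)
  have "Poly_Mapping.lookup (dvar k ?U) 0 = 0" for k
  proof -
    interpret dk: derivation UNIV "dvar k :: (3, 'a) mpoly \<Rightarrow> _" by (rule derivation_dvar)
    have "0 = Poly_Mapping.lookup (dvar k (Poly_Mapping.lookup (Ds j\<^sub>0 (Const (W a b))) m\<^sub>0)) 0"
      by (simp add: Ds_W)
    also have "\<dots> = (\<Sum>i\<in>UNIV. Poly_Mapping.lookup (dvar k (dvar i (W a b))) 0 * Poly_Mapping.lookup (d i) 0)"
      by (subst Ds_Const)
        (simp add: lookup_sum lookup_Const_mult dk.D_sum dk.D_mult lookup_add lookup_mult_0 W0
          flip: d_def)
    also have "\<dots> / e = Poly_Mapping.lookup (dvar k ?U) 0"
      by (simp add: dk.D_sum dk.D_mult lookup_sum lookup_mult_0 v sum_divide_distrib mult_ac)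
    finally show ?thesis by simp
  qed
  then show ?thesis by (subst U) simp
qed

text \<open>The coordinates projected along \<open>v\<close> to the plane \<open>lin = 0\<close>.\<close>

definition y :: "3 \<Rightarrow> (3, 'a) mpoly" where "y i = var i - Const (v i) * lin"

lemma var_y: "var i = y i + Const (v i) * lin"
  by (simp add: y_def)

lemma lam_y: "(\<Sum>i\<in>UNIV. Const (lam i) * y i) = 0"
proof -
  have "(\<Sum>i\<in>UNIV. Const (lam i) * y i) = lin - Const (\<Sum>i\<in>UNIV. lam i * v i) * lin"
    by (simp add: y_def lin_def Const_sum Const_mult right_diff_distrib sum_subtractf
        sum_distrib_right mult.assoc)
  then show ?thesis by (simp add: lam_v)
qed

lemma bracket_y: "bracket (y i) (y k) = W i k"
proof -
  have c: "Const (v i) * lin \<in> Z" for i by (intro ZA.mult_closed) auto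
  have "bracket (y i) b = bracket (var i) b" for i b
    unfolding y_def bracket_diff centreD(1)[OF c] by simp
  moreover from this have "bracket b (y i) = bracket b (var i)" for i b
    unfolding bracket_anti[of b] by simp
  ultimately show ?thesis by (simp add: W_def)
qed

lemma W_y: "\<exists>c. W a b = (\<Sum>i\<in>UNIV. \<Sum>k\<in>UNIV. Const (c i k) * (y i * y k))"
  by (rule quadratic_form_projected[OF homogeneous_W W_invariant y_def])

lemma hom_W_eq:
  assumes "hom_on UNIV h" "hom_on UNIV h'"
    and "\<And>c. h (Const c) = h' (Const c)" "\<And>i. h (y i) = h' (y i)"
  shows "h (W a b) = h' (W a b)"
proof -
  interpret h: hom_on UNIV h by fact
  interpret h': hom_on UNIV h' by fact
  obtain c where "W a b = (\<Sum>i\<in>UNIV. \<Sum>k\<in>UNIV. Const (c i k) * (y i * y k))" using W_y by blast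
  then show ?thesis by (simp add: h.h_sum h'.h_sum h.h_mult h'.h_mult assms(3,4))
qed

subsection \<open>The centre of the other algebra\<close>

definition dv :: "(3, 'a) mpoly \<Rightarrow> (3, 'a) mpoly" where
  "dv p = (\<Sum>i\<in>UNIV. Const (v i) * dvar i p)"

lemma derivation_dv: "derivation UNIV dv"
  by unfold_locales
    (auto simp: dv_def dvar_add dvar_mult algebra_simps sum.distrib sum_distrib_left)

lemma dv_l: "dv lin = 1"
proof -
  have "dv lin = Const (\<Sum>i\<in>UNIV. lam i * v i)"
    by (simp add: dv_def dvar_l Const_sum Const_mult mult.commute)
  then show ?thesis by (simp add: lam_v)
qed

lemma dv_Const [simp]: "dv (Const c) = 0"
  by (simp add: dv_def)

lemma dv_centre: "w \<in> Z \<Longrightarrow> dv w \<in> Z"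
proof -
  assume "w \<in> Z"
  then obtain N c where w: "w = (\<Sum>d<N. Const (c d) * lin ^ d)" using centre_polynomials by blast
  interpret d: derivation UNIV dv by (rule derivation_dv)
  have "dv (lin ^ d) \<in> Z" for d
    by (induction d) (auto simp: d.D_mult dv_l)
  then show ?thesis unfolding w by (subst d.D_sum) (auto simp: d.D_mult intro!: ZA.sum_closed)
qed

lemma dv_kernel: "w \<in> Z \<Longrightarrow> dv w = 0 \<Longrightarrow> w \<in> range Const"
proof -
  assume w: "w \<in> Z" "dv w = 0"
  have "dvar i w = 0" for i
  proof -
    have "dvar i w = Const (\<Sum>k\<in>UNIV. lam k * v k) * dvar i w" by (simp add: lam_v)
    also have "\<dots> = (\<Sum>k\<in>UNIV. Const (v k) * (dvar k lin * dvar i w))"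
      by (simp add: dvar_l Const_sum Const_mult sum_distrib_left mult_ac)
    also have "\<dots> = (\<Sum>k\<in>UNIV. Const (v k) * (dvar i lin * dvar k w))"
      by (intro sum.cong refl) (simp add: central_gradients_parallel[OF l_centre w(1)])
    also have "\<dots> = dvar i lin * dv w" by (simp add: dv_def sum_distrib_left mult_ac)
    finally show ?thesis using w(2) by simp
  qed
  then have "w = Const (Poly_Mapping.lookup w 0)"
    by (intro const_if_dvar_zero[where I = UNIV]) (auto simp del: of_nat_Suc)
  then show ?thesis by blast
qed

text \<open>The central polynomials form the polynomial ring in \<open>lin\<close> and the \<open>t\<^sub>k\<close> over the field.\<close>

lemma ZCA_induct [consumes 1, case_names kap X0 XSuc add mult]:
  assumes p: "p \<in> ZCA" and kap: "\<And>c. Q (Const (Const c))" and l: "Q (Const lin)"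
    and var: "\<And>k. k < n \<Longrightarrow> Q (var k)"
    and add: "\<And>p q. p \<in> ZCA \<Longrightarrow> q \<in> ZCA \<Longrightarrow> Q p \<Longrightarrow> Q q \<Longrightarrow> Q (p + q)"
    and mult: "\<And>p q. p \<in> ZCA \<Longrightarrow> q \<in> ZCA \<Longrightarrow> Q p \<Longrightarrow> Q q \<Longrightarrow> Q (p * q)"
  shows "Q p"
  using p
proof (induction p rule: ZA.polys_over_induct)
  case (Const w)
  then obtain N c where w: "w = (\<Sum>d<N. Const (c d) * lin ^ d)" using centre_polynomials by blast
  have pow: "Q (Const (lin ^ d))" for d
    by (induction d) (use kap[of 1] in \<open>auto simp: Const_mult intro!: mult l simp flip: Const_power\<close>)
  have "Q (Const (\<Sum>d<M. Const (c d) * lin ^ d))" for M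
  proof (induction M)
    case 0
    then show ?case using kap[of 0] by simp
  next
    case (Suc M)
    have "Q (Const (Const (c M) * lin ^ M))"
      unfolding Const_mult by (intro mult kap pow) auto
    then show ?case using Suc
      by (auto simp: single_add intro!: add ZA.sum_closed)
  qed
  then show ?case unfolding w .
qed (use var add mult in auto)

definition kap :: "'a \<Rightarrow> (nat, (3, 'a) mpoly) mpoly" where "kap c = Const (Const c)"
definition rho :: "(nat, (3, 'a) mpoly) mpoly \<Rightarrow> (nat, (3, 'a) mpoly) mpoly" where
  "rho p = g (Const (Poly_Mapping.lookup (f p) 0))"
definition X :: "nat \<Rightarrow> (nat, (3, 'a) mpoly) mpoly" where
  "X a = (case a of 0 \<Rightarrow> Const lin | Suc k \<Rightarrow> var k)"
definition E :: "nat \<Rightarrow> (nat, (3, 'a) mpoly) mpoly \<Rightarrow> (nat, (3, 'a) mpoly) mpoly" where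
  "E a = (case a of 0 \<Rightarrow> lift_coeff dv | Suc k \<Rightarrow> dvar k)"

lemma X_simps [simp]: "X 0 = Const lin" "X (Suc k) = var k"
  and E_simps [simp]: "E 0 = lift_coeff dv" "E (Suc k) = dvar k"
  by (simp_all add: X_def E_def)

lemma g_kap: "g (Const (sB c 1)) = kap c" and f_kap: "f (kap c) = Const (sB c 1)"
  using g_Const_scale[of c] f_Const_scale[of c] by (simp_all add: kap_def poly_scale_times)

lemma derivation_E:
  assumes "a < Suc n"
  shows "derivation ZCA (E a)"
proof -
  interpret dv: derivation UNIV dv by (rule derivation_dv)
  have closed: "E a p \<in> ZCA" if "p \<in> ZCA" for p
  proof (cases a)
    case 0
    have "Poly_Mapping.keys (lift_coeff dv p) \<subseteq> Poly_Mapping.keys p"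
      by (auto simp: in_keys_iff)
    then show ?thesis using that 0
      unfolding polys_over_def by (auto intro!: dv_centre)
  next
    case (Suc k)
    then show ?thesis using that by (simp add: ZA.dvar_polys_over)
  qed
  have "derivation UNIV (E a)"
    using dv.derivation_lift_coeff derivation_dvar by (cases a) auto
  then interpret D: derivation UNIV "E a" .
  show ?thesis
    by unfold_locales (auto simp: closed D.D_add D.D_mult)
qed

lemma line_retract: "line_retract ZCA kap rho n X (\<lambda>k. g (var k)) E Ds"
proof -
  interpret dv: derivation UNIV dv by (rule derivation_dv)
  have ZB0: "Poly_Mapping.lookup (f p) 0 \<in> ZB" if "p \<in> ZCA" for p
    using that by (intro lookup_ZCB_0 f_centre)
  interpret kap: hom_on UNIV kap
    by unfold_locales (auto simp: kap_def single_add Const_mult)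
  interpret rho: hom_on ZCA rho
    by unfold_locales (auto simp: rho_def f_one f_add f_mult g.h_add g.h_mult lookup_add
        lookup_mult_0 single_add Const_mult ZCA_CA)
  have "line_retract_axioms ZCA kap rho n X (\<lambda>k. g (var k)) E Ds"
    \<comment> \<open>The cases follow the order of the locale assumptions.\<close>
  proof (rule line_retract_axioms.intro, goal_cases)
    case (1 c) show ?case by (simp add: kap_def)
  next
    case (2 a) then show ?case by (cases a) auto
  next
    case (3 k) then show ?case by (intro g_centre) auto
  next
    case (4 p) then show ?case unfolding rho_def by (intro g_centre) (auto intro: ZB0)
  next
    case (5 p) then show ?case by (simp add: rho_def)
  next
    case (6 c) show ?case by (simp add: rho_def f_kap g_kap)
  next
    case (7 a) then show ?case by (rule derivation_E)
  next
    case (8 k)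
    then show ?case by unfold_locales (auto simp: Ds_ZCA Ds.D_add Ds.D_mult ZCA_CA)
  next
    case (9 a c) then show ?case by (cases a) (auto simp: kap_def)
  next
    case (10 k c) then show ?case by (simp add: kap_def)
  next
    case (11 a b)
    then show ?case by (cases a; cases b) (auto simp: dv_l dvar_var)
  next
    case (12 k l) then show ?case by (simp add: Ds_g_var)
  next
    case (13 k p) then show ?case by (simp add: rho_def)
  next
    case (14 p)
    have "dvar k p = 0" if "k < n" for k using 14(2)[of "Suc k"] that by simp
    then have p: "p = Const (Poly_Mapping.lookup p 0)"
      using 14(1) by (intro const_if_dvar_zero[where I = "{..<n}"])
        (auto simp: polys_over_def simp del: of_nat_Suc)
    then have c: "Poly_Mapping.lookup p 0 \<in> Z" using 14(1) by (metis ZA.Const_in_polys_over)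
    have "dv (Poly_Mapping.lookup p 0) = 0"
      using 14(2)[of 0] dv.lookup_lift_coeff[of p 0] by simp
    from dv_kernel[OF c this] obtain e where e: "Poly_Mapping.lookup p 0 = Const e" by blast
    have "p = kap e" using p unfolding e kap_def .
    then show ?case by blast
  next
    case (15 p Q)
    show ?case
      by (rule ZCA_induct[OF 15(1)]) (use 15(2,4,5) 15(3)[of 0] 15(3)[of "Suc _"] in \<open>auto simp: kap_def\<close>)
  next
    case (16 p Q)
    have "Q (g q)" if "q \<in> ZCB" for q
      using that
    proof (induction q rule: ZB.polys_over_induct)
      case (Const b)
      then show ?case by (intro 16(2) g_centre) (auto simp: rho_def)
    next
      case (var k)
      then show ?case by (intro 16(3)) auto
    next
      case (add p q)
      then show ?case by (simp add: g.h_add ZCB_CB) (intro 16(4) g_centre)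
    next
      case (mult p q)
      then show ?case by (simp add: g.h_mult ZCB_CB) (intro 16(5) g_centre)
    qed
    from this[of "f p"] 16(1) show ?case by (simp add: f_centre ZCA_CA)
  qed
  then show ?thesis
    by (intro line_retract.intro kap.hom_on_axioms rho.hom_on_axioms ZCA.subring_of_axioms)
qed

text \<open>
  The central polynomials are a polynomial ring over the field and also, in one variable less, over
  the centre of \<open>B\<close>.  By cancellation for the line that centre is a polynomial ring in one variable.
\<close>

lemma other_centre_polynomials:
  obtains g' where "g' \<in> ZB" "\<And>b. b \<in> ZB \<Longrightarrow> \<exists>N c. b = (\<Sum>i<N. sB (c i) 1 * g' ^ i)"
    "\<And>N c i. (\<Sum>i<N. sB (c i) 1 * g' ^ i) = 0 \<Longrightarrow> i < N \<Longrightarrow> c i = 0"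
proof -
  interpret L: line_retract ZCA kap rho n X "\<lambda>k. g (var k)" E Ds by (rule line_retract)
  obtain \<gamma> where \<gamma>: "\<gamma> \<in> L.R" "\<And>w. w \<in> L.R \<Longrightarrow> \<exists>N c. w = (\<Sum>i<N. kap (c i) * \<gamma> ^ i)"
    "\<And>N c i. (\<Sum>i<N. kap (c i) * \<gamma> ^ i) = 0 \<Longrightarrow> i < N \<Longrightarrow> c i = 0"
    by (rule L.R_is_polynomial_ring) blast
  define g' where "g' = Poly_Mapping.lookup (f \<gamma>) 0"
  have g': "g' \<in> ZB" unfolding g'_def using \<gamma>(1) by (intro lookup_ZCB_0 f_centre L.R_P)
  have "\<gamma> = g (Const g')" using L.R_rho[OF \<gamma>(1)] by (simp add: rho_def g'_def)
  then have f\<gamma>: "f \<gamma> = Const g'" by simp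
  have f_sum: "f (\<Sum>i<N. kap (c i) * \<gamma> ^ i) = Const (\<Sum>i<N. sB (c i) 1 * g' ^ i)" for N c
  proof -
    have CA: "\<gamma> \<in> CA" "kap c \<in> CA" for c using \<gamma>(1) by (auto simp: kap_def intro: ZCA_CA L.R_P)
    then show ?thesis
      by (subst f.h_sum) (auto simp: f_mult f.h_power f\<gamma> f_kap Const_sum Const_mult Const_power)
  qed
  show ?thesis
  proof (rule that[OF g'])
    show "\<exists>N c. b = (\<Sum>i<N. sB (c i) 1 * g' ^ i)" if b: "b \<in> ZB" for b
    proof -
      have "g (Const b) \<in> L.R"
        using b by (auto simp: L.R_def rho_def intro!: g_centre)
      from \<gamma>(2)[OF this] obtain N c where "g (Const b) = (\<Sum>i<N. kap (c i) * \<gamma> ^ i)" by blast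
      then have "Const b = f (\<Sum>i<N. kap (c i) * \<gamma> ^ i)" by (metis Const_CB f_g)
      then have "b = (\<Sum>i<N. sB (c i) 1 * g' ^ i)" unfolding f_sum by simp
      then show ?thesis by blast
    qed
    show "c i = 0" if "(\<Sum>i<N. sB (c i) 1 * g' ^ i) = 0" "i < N" for N c i
    proof (rule \<gamma>(3)[OF _ that(2)])
      have in_CA: "(\<Sum>i<N. kap (c i) * \<gamma> ^ i) \<in> CA"
        using \<gamma>(1) by (intro CA.sum_closed CA.mult_closed CA.power_closed)
          (auto simp: kap_def intro: ZCA_CA L.R_P)
      have "f (\<Sum>i<N. kap (c i) * \<gamma> ^ i) = 0" unfolding f_sum that(1) by simp
      with g_f[OF in_CA] show "(\<Sum>i<N. kap (c i) * \<gamma> ^ i) = 0" by simp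
    qed
  qed
qed

subsection \<open>The isomorphism\<close>

text \<open>
  \<open>A\<close> is generated by the \<open>y\<^sub>i\<close>, whose brackets only involve the \<open>y\<^sub>i\<close>, and the central element \<open>lin\<close>.
  Hence there is a Poisson homomorphism \<open>\<pi>\<close> that agrees with evaluation at \<open>s = 0\<close> on the \<open>y\<^sub>i\<close> but
  sends \<open>lin\<close> to the generator \<open>g'\<close> of the centre of \<open>B\<close>.  The map \<open>r\<close> fixes the \<open>y\<^sub>i\<close> and sends \<open>lin\<close>
  and the \<open>t\<^sub>k\<close> to the polynomials in \<open>lin\<close> whose images under \<open>\<pi>\<close> are the values of \<open>lin\<close> and the
  \<open>t\<^sub>k\<close> at \<open>s = 0\<close>.
\<close>

theorem isomorphic: "poisson_isomorphic UNIV (poly_scale (*)) bracket UNIV sB bB"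
proof -
  obtain g' where g': "g' \<in> ZB"
    and spanB: "\<And>b. b \<in> ZB \<Longrightarrow> \<exists>N c. b = (\<Sum>i<N. sB (c i) 1 * g' ^ i)"
    and indep: "\<And>N c i. (\<Sum>i<N. sB (c i) 1 * g' ^ i) = 0 \<Longrightarrow> i < N \<Longrightarrow> c i = 0"
    by (rule other_centre_polynomials) blast
  interpret kB: hom_on UNIV "\<lambda>c. sB c 1" by (rule B.hom_scale_one)
  define \<pi> where "\<pi> = poly_eval (\<lambda>c. sB c 1) (\<lambda>i. ev (y i) + sB (v i) 1 * g')"
  interpret pi: hom_on UNIV \<pi> unfolding \<pi>_def by (rule kB.hom_poly_eval) simp
  have pi_Const: "\<pi> (Const c) = sB c 1" for c
    unfolding \<pi>_def by (rule kB.poly_eval_Const) simp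
  have pi_var: "\<pi> (var i) = ev (y i) + sB (v i) 1 * g'" for i
    unfolding \<pi>_def by (rule kB.poly_eval_var) simp
  have ev_Const: "ev (Const c) = sB c 1" for c
    using ev_scale[of c 1] by (simp add: poly_scale_times)
  have pi_l: "\<pi> lin = g'"
  proof -
    have "\<pi> lin = ev (\<Sum>i\<in>UNIV. Const (lam i) * y i) + sB (\<Sum>i\<in>UNIV. lam i * v i) 1 * g'"
      unfolding lin_def
      by (simp add: pi.h_sum pi.h_mult pi_Const pi_var ev.h_sum ev.h_mult ev_Const kB.h_sum
          kB.h_mult distrib_left sum.distrib sum_distrib_right mult.assoc)
    then show ?thesis by (simp add: lam_y lam_v)
  qed
  have pi_y: "\<pi> (y i) = ev (y i)" for i
    unfolding y_def[of i] pi.h_diff[OF UNIV_I UNIV_I] pi.h_mult[OF UNIV_I UNIV_I] pi_var pi_Const pi_l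
    by (simp add: y_def)
  have pi_W: "\<pi> (W a b) = ev (W a b)" for a b
    by (rule hom_W_eq[OF pi.hom_on_axioms ev.hom_on_axioms]) (auto simp: pi_Const ev_Const pi_y)
  have pi_Z: "\<pi> (\<Sum>i<N. Const (c i) * lin ^ i) = (\<Sum>i<N. sB (c i) 1 * g' ^ i)" for N c
    by (simp add: pi.h_sum pi.h_mult pi.h_power pi_Const pi_l)
  have pi_bracket: "\<pi> (bracket a b) = bB (\<pi> a) (\<pi> b)" for a b
  proof -
    have c: "sB (v i) 1 * g' \<in> ZB" for i using g' by auto
    have gen: "\<pi> (bracket (var i) (var k)) = bB (\<pi> (var i)) (\<pi> (var k))" for i k
      unfolding pi_var B.bracket_add B.centreD[OF c] using pi_W[of i k]
      by (simp add: W_def bracket_y[unfolded W_def, symmetric] ev_bracket)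
    have gen2: "\<pi> (bracket a (var k)) = bB (\<pi> a) (\<pi> (var k))" for a k
    proof (induction a rule: mpoly_gen_induct)
      case (Const c)
      show ?case by (simp add: pi_Const)
    qed (auto simp: gen bracket_add B.bracket_add pi.h_add pi.h_mult bracket_leibniz_left
        B.bracket_leibniz_left)
    show ?thesis
    proof (induction b rule: mpoly_gen_induct)
      case (Const c)
      show ?case by (simp add: pi_Const)
    qed (auto simp: gen2 bracket_add B.bracket_add pi.h_add pi.h_mult bracket_leibniz_right
        B.bracket_leibniz_right)
  qed
  have pi_scale: "\<pi> (poly_scale (*) c a) = sB c (\<pi> a)" for c a
    using B.scale_eq[of c "\<pi> a"] by (simp add: poly_scale_times pi.h_mult pi_Const)
  have lift: "\<exists>a\<in>Z. \<pi> a = b" if b: "b \<in> ZB" for b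
  proof -
    obtain N c where "b = (\<Sum>i<N. sB (c i) 1 * g' ^ i)" using spanB[OF b] by blast
    then have "\<pi> (\<Sum>i<N. Const (c i) * lin ^ i) = b" by (simp add: pi_Z)
    then show ?thesis by (rule bexI) (auto intro!: ZA.sum_closed)
  qed
  obtain L where L: "L \<in> Z" "\<pi> L = ev lin" using lift[OF ev_centre[OF l_centre]] by blast
  have "\<exists>a\<in>Z. \<pi> a = Poly_Mapping.lookup (f (var k)) 0" if "k < n" for k
    using that by (intro lift lookup_ZCB_0 f_centre) auto
  then obtain c where c: "\<And>k. k < n \<Longrightarrow> c k \<in> Z" "\<And>k. k < n \<Longrightarrow> \<pi> (c k) = Poly_Mapping.lookup (f (var k)) 0"
    by metis
  define h where "h = poly_eval Const (\<lambda>i. y i + Const (v i) * L)"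
  interpret kA: hom_on UNIV "Const :: 'a \<Rightarrow> (3, 'a) mpoly" by (rule hom_Const)
  interpret h: hom_on UNIV h unfolding h_def by (rule kA.hom_poly_eval) simp
  have h_Const: "h (Const a) = Const a" for a unfolding h_def by (rule kA.poly_eval_Const) simp
  have h_var: "h (var i) = y i + Const (v i) * L" for i
    unfolding h_def by (rule kA.poly_eval_var) simp
  have h_l: "h lin = L"
  proof -
    have "h lin = (\<Sum>i\<in>UNIV. Const (lam i) * y i) + Const (\<Sum>i\<in>UNIV. lam i * v i) * L"
      unfolding lin_def
      by (simp add: h.h_sum h.h_mult h_Const h_var Const_sum Const_mult
          distrib_left sum.distrib sum_distrib_right mult.assoc)
    then show ?thesis by (simp add: lam_y lam_v)
  qed
  have h_y: "h (y i) = y i" for i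
    unfolding y_def[of i] h.h_diff[OF UNIV_I UNIV_I] h.h_mult[OF UNIV_I UNIV_I] h_var h_Const h_l
    by (simp add: y_def)
  define r where "r = poly_eval h c"
  interpret r: hom_on UNIV r unfolding r_def by (rule h.hom_poly_eval) simp
  have r_Const: "r (Const a) = h a" for a unfolding r_def by (rule h.poly_eval_Const) simp
  have r_var: "r (var k) = c k" for k unfolding r_def by (rule h.poly_eval_var) simp
  have pi_h: "\<pi> (h a) = ev a" for a
  proof (induction a rule: mpoly_gen_induct)
    case (Const a)
    show ?case by (simp add: h_Const pi_Const ev_Const)
  next
    case (var i)
    have "\<pi> (h (var i)) = ev (y i) + sB (v i) 1 * ev lin"
      by (simp add: h_var pi.h_add pi.h_mult pi_y pi_Const L)
    also have "\<dots> = ev (y i + Const (v i) * lin)" by (simp add: ev.h_add ev.h_mult ev_Const)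
    finally show ?case by (simp only: var_y[symmetric])
  qed (auto simp: h.h_add h.h_mult pi.h_add pi.h_mult ev.h_add ev.h_mult)
  have comm: "\<pi> (r p) = Poly_Mapping.lookup (f p) 0" if "p \<in> CA" for p
    using that unfolding polys_in_eq
  proof (induction p rule: subring_of.polys_over_induct[OF subring_of_UNIV, consumes 1])
    case (1 a)
    show ?case by (simp add: r_Const pi_h ev_def)
  next
    case (2 k)
    then show ?case using c(2)[of k] by (simp add: r_var)
  next
    case (3 p q)
    then show ?case by (simp add: r.h_add pi.h_add f_add lookup_add flip: polys_in_eq)
  next
    case (4 p q)
    then show ?case by (simp add: r.h_mult pi.h_mult f_mult lookup_mult_0 flip: polys_in_eq)
  qed
  have inj: "w = 0" if w: "w \<in> Z" "\<pi> w = 0" for w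
  proof -
    obtain N c where c: "w = (\<Sum>d<N. Const (c d) * lin ^ d)" using centre_polynomials[OF w(1)] by blast
    then have "c i = 0" if "i < N" for i
      using indep[OF _ that, of c] w(2) by (simp add: pi_Z)
    then show ?thesis unfolding c by simp
  qed
  have rZ: "r p \<in> Z" if "p \<in> ZCA" for p
    using that
    by (induction p rule: ZCA_induct) (auto simp: r_Const r_var h_Const h_l L c(1) r.h_add r.h_mult)
  note section_facts = pi.hom_on_axioms r.hom_on_axioms comm inj rZ
  show ?thesis
  proof (rule isomorphic_if_section[OF section_facts pi_scale pi_bracket])
    interpret H: hom_on UNIV "\<lambda>b. r (g (Const b))" by (rule descend_hom[OF section_facts])
    have H_y: "r (g (Const (\<pi> (y i)))) = y i" for i
      by (rule descend_fixes[OF section_facts]) (auto simp: pi_y r_Const h_y)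
    have H_l: "r (g (Const (\<pi> lin))) = lin"
      by (rule descend_fixes_centre[OF section_facts]) (auto simp: pi_l g')
    have H_Const: "r (g (Const (\<pi> (Const c)))) = Const c" for c
      by (simp add: pi_Const g_kap) (simp add: kap_def r_Const h_Const)
    show "r (g (Const (\<pi> a))) = a" for a
    proof (induction a rule: mpoly_gen_induct)
      case (Const a)
      show ?case by (rule H_Const)
    next
      case (var i)
      show ?case
        by (subst (1 2) var_y) (simp only: pi.h_add[OF UNIV_I UNIV_I] pi.h_mult[OF UNIV_I UNIV_I]
            H.h_add[OF UNIV_I UNIV_I] H.h_mult[OF UNIV_I UNIV_I] H_y H_l H_Const)
    next
      case (add p q)
      then show ?case by (simp only: pi.h_add[OF UNIV_I UNIV_I] H.h_add[OF UNIV_I UNIV_I])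
    next
      case (mult p q)
      then show ?case by (simp only: pi.h_mult[OF UNIV_I UNIV_I] H.h_mult[OF UNIV_I UNIV_I])
    qed
  qed
qed

end

theorem theorem3p11:
  fixes bracket :: "(3, 'k::{alg_closed_field, field_char_0}) mpoly \<Rightarrow> (3, 'k) mpoly \<Rightarrow> (3, 'k) mpoly"
  assumes "quadratic_poisson bracket"
    and "\<exists>p q. bracket p q \<noteq> 0"
  shows "strongly_poisson_cancellative TYPE('b::comm_ring_1) (poly_scale (*)) bracket"
  unfolding strongly_poisson_cancellative_def
proof (intro allI impI)
  fix n and sB :: "'k \<Rightarrow> 'b \<Rightarrow> 'b" and bB
  assume B: "poisson_algebra sB bB"
    and iso: "poisson_isomorphic
        (polys_in n) (poly_scale (poly_scale (*))) (poly_bracket bracket)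
        (polys_in n) (poly_scale sB) (poly_bracket bB)"
  interpret quadratic_bracket bracket by unfold_locales (rule assms)+
  interpret B: poisson_algebra sB bB by (rule B)
  obtain f where "poisson_extension_iso (poly_scale (*)) bracket sB bB n f"
  proof -
    from iso obtain f where f: "bij_betw f (polys_in n) (polys_in n)" "f 1 = 1"
      "\<forall>x\<in>polys_in n. \<forall>y\<in>polys_in n. f (x + y) = f x + f y"
      "\<forall>x\<in>polys_in n. \<forall>y\<in>polys_in n. f (x * y) = f x * f y"
      "\<forall>c. \<forall>x\<in>polys_in n. f (poly_scale (poly_scale (*)) c x) = poly_scale sB c (f x)"
      "\<forall>x\<in>polys_in n. \<forall>y\<in>polys_in n. f (poly_bracket bracket x y) = poly_bracket bB (f x) (f y)"
      unfolding poisson_isomorphic_def by blast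
    show ?thesis
      by (rule that[of f], unfold_locales) (use f in \<open>simp_all\<close>)
  qed
  then interpret poisson_extension_iso "poly_scale (*)" bracket sB bB n f .
  interpret quadratic_iso bracket sB bB n f ..
  show "poisson_isomorphic UNIV (poly_scale (*)) bracket UNIV sB bB"
  proof (cases "\<forall>j<n. \<forall>z\<in>Z. Ds j (Const z) \<in> aug")
    case True
    then show ?thesis by (intro isomorphic_if_centre_killed Ds_centre_zero) auto
  next
    case False
    then obtain j z m where "z \<in> Z"
      "Poly_Mapping.lookup (Poly_Mapping.lookup (Ds j (Const z)) m) 0 \<noteq> 0"
      by (auto simp: aug_def)
    then interpret moved_central_form bracket sB bB n f j z m by unfold_locales
    show ?thesis by (rule isomorphic)
  qed
qed

end
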